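(* Let $\mathcal M$ be an NIP structure and let $X_1,\ldots,X_n$ be orthogonal definable sets. Let $G$ be a compactly dominated abelian definable group whose underlying set is contained in $X_1\times\cdots\times X_n$. Then $G$ admits a decomposition with respect to $X_1,\ldots,X_n$: there are definable subsets $A_1,\ldots,A_n$ of $G$ with $G=A_1\cdots A_n$ and $A_i$ internal to $X_i$ for each $i$.
   Context: "Definable" means definable in $\mathcal M$ with parameters. A box for definable sets $Y_1,\ldots,Y_n$ is a definable set $U_1\times\cdots\times U_n$ with $U_i\subseteq Y_i$. Definable sets $X_1,\ldots,X_n$ are orthogonal if for all $k_1,\ldots,k_n\in\mathbb N$ every definable subset of $X_1^{k_1}\times\cdots\times X_n^{k_n}$ is a finite union of $(X_1^{k_1},\ldots,X_n^{k_n})$-boxes. A definable set $X$ is internal to $V$ if there is a definable surjection $V^m\to X$ for some $m$. $A_1\cdots A_n$ is the set of products $a_1\cdots a_n$, $a_i\in A_i$. Compact domination (in the NIP setting): working in a sufficiently saturated elementary extension, let $G^{00}$ be the smallest type-definable subgroup of $G$ of bounded index, $\pi:G\to G/G^{00}$ the quotient map, $G/G^{00}$ equipped with the logic topology (a compact group) and its normalized Haar measure $h$; $G$ is compactly dominated if for every definable $D\subseteq G$, the set of $c\in G/G^{00}$ such that $\pi^{-1}(c)$ meets both $D$ and $G\setminus D$ has $h$-measure $0$. *)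

theory Defs
  imports "HOL-Analysis.Analysis" "HOL-Algebra.FiniteProduct" "HOL-Algebra.Coset"
begin

unbundle cardinal_syntax

text \<open>
  First-order logic. A symbol is a name together with its arity, and the language of a structure
  is the pair of sets \<open>fsyms\<close>, \<open>rsyms\<close>. Variables are de Bruijn indices into the list of values of
  the free variables. Parameters occur in formulas as constants \<open>Par a\<close>.
\<close>

datatype ('f, 'a) tm = Var nat | Par 'a | Fn 'f "('f, 'a) tm list"

datatype ('f, 'r, 'a) fm =
    Eq "('f, 'a) tm" "('f, 'a) tm"
  | Rel 'r "('f, 'a) tm list"
  | Neg "('f, 'r, 'a) fm"
  | Conj "('f, 'r, 'a) fm" "('f, 'r, 'a) fm"
  | Ex "('f, 'r, 'a) fm"

record ('f, 'r, 'a) fo_structure =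
  universe :: "'a set"
  fsyms :: "('f \<times> nat) set"
  rsyms :: "('r \<times> nat) set"
  finterp :: "'f \<Rightarrow> 'a list \<Rightarrow> 'a"
  rinterp :: "'r \<Rightarrow> 'a list \<Rightarrow> bool"

definition tuples :: "('f, 'r, 'a) fo_structure \<Rightarrow> nat \<Rightarrow> 'a list set" where
  "tuples M m = {xs. length xs = m \<and> set xs \<subseteq> universe M}"

definition is_structure :: "('f, 'r, 'a) fo_structure \<Rightarrow> bool" where
  "is_structure M \<longleftrightarrow> universe M \<noteq> {} \<and>
     (\<forall>(f, k) \<in> fsyms M. \<forall>xs \<in> tuples M k. finterp M f xs \<in> universe M)"

fun wf_tm :: "('f, 'r, 'a) fo_structure \<Rightarrow> 'a set \<Rightarrow> nat \<Rightarrow> ('f, 'a) tm \<Rightarrow> bool" where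
  "wf_tm M A m (Var i) \<longleftrightarrow> i < m"
| "wf_tm M A m (Par a) \<longleftrightarrow> a \<in> A"
| "wf_tm M A m (Fn f ts) \<longleftrightarrow> (f, length ts) \<in> fsyms M \<and> (\<forall>t \<in> set ts. wf_tm M A m t)"

primrec wf_fm :: "('f, 'r, 'a) fo_structure \<Rightarrow> 'a set \<Rightarrow> nat \<Rightarrow> ('f, 'r, 'a) fm \<Rightarrow> bool" where
  "wf_fm M A m (Eq s t) \<longleftrightarrow> wf_tm M A m s \<and> wf_tm M A m t"
| "wf_fm M A m (Rel r ts) \<longleftrightarrow> (r, length ts) \<in> rsyms M \<and> (\<forall>t \<in> set ts. wf_tm M A m t)"
| "wf_fm M A m (Neg \<phi>) \<longleftrightarrow> wf_fm M A m \<phi>"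
| "wf_fm M A m (Conj \<phi> \<psi>) \<longleftrightarrow> wf_fm M A m \<phi> \<and> wf_fm M A m \<psi>"
| "wf_fm M A m (Ex \<phi>) \<longleftrightarrow> wf_fm M A (Suc m) \<phi>"

text \<open>Formulas in the language of \<open>M\<close>, with parameters in \<open>A\<close> and free variables among the first \<open>m\<close>.\<close>

definition formulas :: "('f, 'r, 'a) fo_structure \<Rightarrow> 'a set \<Rightarrow> nat \<Rightarrow> ('f, 'r, 'a) fm set" where
  "formulas M A m = {\<phi>. wf_fm M A m \<phi>}"

primrec tm_val :: "('f, 'r, 'a) fo_structure \<Rightarrow> 'a list \<Rightarrow> ('f, 'a) tm \<Rightarrow> 'a" where
  "tm_val M xs (Var i) = xs ! i"
| "tm_val M xs (Par a) = a"
| "tm_val M xs (Fn f ts) = finterp M f (map (tm_val M xs) ts)"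

primrec holds :: "('f, 'r, 'a) fo_structure \<Rightarrow> 'a list \<Rightarrow> ('f, 'r, 'a) fm \<Rightarrow> bool" where
  "holds M xs (Eq s t) \<longleftrightarrow> tm_val M xs s = tm_val M xs t"
| "holds M xs (Rel r ts) \<longleftrightarrow> rinterp M r (map (tm_val M xs) ts)"
| "holds M xs (Neg \<phi>) \<longleftrightarrow> \<not> holds M xs \<phi>"
| "holds M xs (Conj \<phi> \<psi>) \<longleftrightarrow> holds M xs \<phi> \<and> holds M xs \<psi>"
| "holds M xs (Ex \<phi>) \<longleftrightarrow> (\<exists>a \<in> universe M. holds M (a # xs) \<phi>)"

definition def_set :: "('f, 'r, 'a) fo_structure \<Rightarrow> nat \<Rightarrow> ('f, 'r, 'a) fm \<Rightarrow> 'a list set" where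
  "def_set M m \<phi> = {xs \<in> tuples M m. holds M xs \<phi>}"

definition definable :: "('f, 'r, 'a) fo_structure \<Rightarrow> nat \<Rightarrow> 'a list set \<Rightarrow> bool" where
  "definable M m X \<longleftrightarrow> (\<exists>\<phi> \<in> formulas M (universe M) m. X = def_set M m \<phi>)"

text \<open>
  NIP is a property of the theory of \<open>M\<close>; by compactness, \<open>\<phi>(x; y)\<close> has the independence property
  in some model iff \<open>M\<close> itself shatters finite families of every size.
\<close>

definition has_IP :: "('f, 'r, 'a) fo_structure \<Rightarrow> nat \<Rightarrow> nat \<Rightarrow> ('f, 'r, 'a) fm \<Rightarrow> bool" where
  "has_IP M p q \<phi> \<longleftrightarrow>
     (\<forall>k::nat. \<exists>a b. (\<forall>i<k. a i \<in> tuples M p) \<and> (\<forall>I \<subseteq> {..<k}. b I \<in> tuples M q) \<and>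
        (\<forall>i<k. \<forall>I \<subseteq> {..<k}. holds M (a i @ b I) \<phi> \<longleftrightarrow> i \<in> I))"

definition NIP :: "('f, 'r, 'a) fo_structure \<Rightarrow> bool" where
  "NIP M \<longleftrightarrow> (\<forall>p q. \<forall>\<phi> \<in> formulas M {} (p + q). \<not> has_IP M p q \<phi>)"


text \<open>
  Tuples are lists, and products of sets of tuples are formed by concatenation: for
  \<open>X i\<close> of arity \<open>d i\<close>, the product below is a set of tuples of length \<open>\<Sum>i<n. d i\<close>.
\<close>

definition tprod :: "nat \<Rightarrow> (nat \<Rightarrow> 'a list set) \<Rightarrow> 'a list set" where
  "tprod n X = {concat (map x [0..<n]) | x. \<forall>i<n. x i \<in> X i}"

definition tpower :: "'a list set \<Rightarrow> nat \<Rightarrow> 'a list set" where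
  "tpower X k = tprod k (\<lambda>_. X)"

definition is_box ::
  "('f, 'r, 'a) fo_structure \<Rightarrow> nat \<Rightarrow> (nat \<Rightarrow> nat) \<Rightarrow> (nat \<Rightarrow> 'a list set) \<Rightarrow> 'a list set \<Rightarrow> bool" where
  "is_box M n d Y B \<longleftrightarrow> definable M (\<Sum>i<n. d i) B \<and> (\<exists>U. (\<forall>i<n. U i \<subseteq> Y i) \<and> B = tprod n U)"

definition orthogonal_sets ::
  "('f, 'r, 'a) fo_structure \<Rightarrow> nat \<Rightarrow> (nat \<Rightarrow> nat) \<Rightarrow> (nat \<Rightarrow> 'a list set) \<Rightarrow> bool" where
  "orthogonal_sets M n d X \<longleftrightarrow>
     (\<forall>(k :: nat \<Rightarrow> nat) D.
        definable M (\<Sum>i<n. k i * d i) D \<and> D \<subseteq> tprod n (\<lambda>i. tpower (X i) (k i)) \<longrightarrow>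
        (\<exists>\<B>. finite \<B> \<and> (\<forall>B \<in> \<B>. is_box M n (\<lambda>i. k i * d i) (\<lambda>i. tpower (X i) (k i)) B) \<and>
             D = \<Union>\<B>))"

definition internal ::
  "('f, 'r, 'a) fo_structure \<Rightarrow> nat \<Rightarrow> 'a list set \<Rightarrow> nat \<Rightarrow> 'a list set \<Rightarrow> bool" where
  "internal M e X d V \<longleftrightarrow>
     (\<exists>m f. f ` tpower V m = X \<and> definable M (m * d + e) {v @ f v | v. v \<in> tpower V m})"


definition mult_graph :: "'a list monoid \<Rightarrow> 'a list set" where
  "mult_graph G = {x @ y @ (x \<otimes>\<^bsub>G\<^esub> y) | x y. x \<in> carrier G \<and> y \<in> carrier G}"

definition definable_group :: "('f, 'r, 'a) fo_structure \<Rightarrow> nat \<Rightarrow> 'a list monoid \<Rightarrow> bool" where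
  "definable_group M m G \<longleftrightarrow>
     group G \<and> definable M m (carrier G) \<and> definable M (m + m + m) (mult_graph G)"

text \<open>Elementary extensions, up to isomorphism: the smaller universe is a subset of the larger one.\<close>

definition elementary_extension ::
  "('f, 'r, 'a) fo_structure \<Rightarrow> ('f, 'r, 'a) fo_structure \<Rightarrow> bool" where
  "elementary_extension M N \<longleftrightarrow>
     is_structure N \<and> fsyms N = fsyms M \<and> rsyms N = rsyms M \<and> universe M \<subseteq> universe N \<and>
     (\<forall>m. \<forall>\<phi> \<in> formulas M {} m. \<forall>xs \<in> tuples M m. holds N xs \<phi> \<longleftrightarrow> holds M xs \<phi>)"

definition saturated :: "'k rel \<Rightarrow> ('f, 'r, 'a) fo_structure \<Rightarrow> bool" where
  "saturated \<kappa> N \<longleftrightarrow>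
     (\<forall>A \<Phi>. A \<subseteq> universe N \<and> |A| <o \<kappa> \<and> \<Phi> \<subseteq> formulas N A 1 \<and>
        (\<forall>\<Phi>\<^sub>0 \<subseteq> \<Phi>. finite \<Phi>\<^sub>0 \<longrightarrow> (\<exists>c \<in> universe N. \<forall>\<phi> \<in> \<Phi>\<^sub>0. holds N [c] \<phi>)) \<longrightarrow>
        (\<exists>c \<in> universe N. \<forall>\<phi> \<in> \<Phi>. holds N [c] \<phi>))"

text \<open>
  \<open>N\<close> is \<open>\<kappa>\<close>-saturated for a cardinal \<open>\<kappa>\<close> greater than \<open>2\<close> to the number of formulas with parameters
  in \<open>M\<close>. ``Small'' and ``bounded'' then mean of cardinality less than \<open>\<kappa>\<close>.
\<close>

definition sufficiently_saturated_extension ::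
  "'k rel \<Rightarrow> ('f, 'r, 'a) fo_structure \<Rightarrow> ('f, 'r, 'a) fo_structure \<Rightarrow> bool" where
  "sufficiently_saturated_extension \<kappa> M N \<longleftrightarrow>
     Card_order \<kappa> \<and> |Pow (\<Union>m. formulas M (universe M) m)| <o \<kappa> \<and>
     elementary_extension M N \<and> saturated \<kappa> N"

text \<open>
  The set defined in \<open>N\<close> by a formula that defines \<open>X\<close> in \<open>M\<close>; for elementary extensions it does not
  depend on the formula.
\<close>

definition extend_set ::
  "('f, 'r, 'a) fo_structure \<Rightarrow> ('f, 'r, 'a) fo_structure \<Rightarrow> nat \<Rightarrow> 'a list set \<Rightarrow> 'a list set" where
  "extend_set M N m X = \<Union> {def_set N m \<phi> | \<phi>. \<phi> \<in> formulas M (universe M) m \<and> X = def_set M m \<phi>}"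

definition extend_group ::
  "('f, 'r, 'a) fo_structure \<Rightarrow> ('f, 'r, 'a) fo_structure \<Rightarrow> nat \<Rightarrow> 'a list monoid \<Rightarrow> 'a list monoid" where
  "extend_group M N m G =
     \<lparr>carrier = extend_set M N m (carrier G),
      mult = (\<lambda>x y. THE z. x @ y @ z \<in> extend_set M N (m + m + m) (mult_graph G)),
      one = \<one>\<^bsub>G\<^esub>\<rparr>"

definition type_definable ::
  "'k rel \<Rightarrow> ('f, 'r, 'a) fo_structure \<Rightarrow> nat \<Rightarrow> 'a list set \<Rightarrow> bool" where
  "type_definable \<kappa> N m Y \<longleftrightarrow>
     (\<exists>A \<Phi>. A \<subseteq> universe N \<and> |A| <o \<kappa> \<and> \<Phi> \<subseteq> formulas N A m \<and>
        Y = {xs \<in> tuples N m. \<forall>\<phi> \<in> \<Phi>. holds N xs \<phi>})"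

definition bounded_type_definable_subgroup ::
  "'k rel \<Rightarrow> ('f, 'r, 'a) fo_structure \<Rightarrow> nat \<Rightarrow> 'a list monoid \<Rightarrow> 'a list set \<Rightarrow> bool" where
  "bounded_type_definable_subgroup \<kappa> N m G H \<longleftrightarrow>
     subgroup H G \<and> type_definable \<kappa> N m H \<and> |rcosets\<^bsub>G\<^esub> H| <o \<kappa>"

definition is_G00 ::
  "'k rel \<Rightarrow> ('f, 'r, 'a) fo_structure \<Rightarrow> nat \<Rightarrow> 'a list monoid \<Rightarrow> 'a list set \<Rightarrow> bool" where
  "is_G00 \<kappa> N m G H \<longleftrightarrow>
     bounded_type_definable_subgroup \<kappa> N m G H \<and>
     (\<forall>K. bounded_type_definable_subgroup \<kappa> N m G K \<longrightarrow> H \<subseteq> K)"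

text \<open>A subset of the quotient is closed iff its preimage under \<open>x \<mapsto> H #> x\<close> is type-definable.\<close>

definition logic_topology ::
  "'k rel \<Rightarrow> ('f, 'r, 'a) fo_structure \<Rightarrow> nat \<Rightarrow> 'a list monoid \<Rightarrow> 'a list set \<Rightarrow> 'a list set topology" where
  "logic_topology \<kappa> N m G H = topology (\<lambda>U. U \<subseteq> carrier (G Mod H) \<and>
     type_definable \<kappa> N m {x \<in> carrier G. H #>\<^bsub>G\<^esub> x \<in> carrier (G Mod H) - U})"

text \<open>
  Normalized Haar measure of a compact group \<open>Q\<close> with topology \<open>T\<close>. Inner regularity is what makes
  the Borel measure unique when \<open>T\<close> is not second countable.
\<close>

definition normalized_haar_measure ::
  "'c monoid \<Rightarrow> 'c topology \<Rightarrow> 'c measure \<Rightarrow> bool" where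
  "normalized_haar_measure Q T h \<longleftrightarrow>
     space h = carrier Q \<and> sets h = sigma_sets (carrier Q) {U. openin T U} \<and>
     emeasure h (carrier Q) = 1 \<and>
     (\<forall>q \<in> carrier Q. \<forall>A \<in> sets h.
        (\<lambda>x. q \<otimes>\<^bsub>Q\<^esub> x) ` A \<in> sets h \<and> emeasure h ((\<lambda>x. q \<otimes>\<^bsub>Q\<^esub> x) ` A) = emeasure h A) \<and>
     (\<forall>A \<in> sets h. emeasure h A = (SUP K \<in> {K. compactin T K \<and> K \<subseteq> A}. emeasure h K))"

definition compactly_dominated_in ::
  "'k rel \<Rightarrow> ('f, 'r, 'a) fo_structure \<Rightarrow> nat \<Rightarrow> 'a list monoid \<Rightarrow> bool" where
  "compactly_dominated_in \<kappa> N m G \<longleftrightarrow>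
     (\<exists>H h. is_G00 \<kappa> N m G H \<and>
        normalized_haar_measure (G Mod H) (logic_topology \<kappa> N m G H) h \<and>
        (\<forall>D. definable N m D \<and> D \<subseteq> carrier G \<longrightarrow>
           {c \<in> carrier (G Mod H).
              (\<exists>x \<in> D. H #>\<^bsub>G\<^esub> x = c) \<and> (\<exists>x \<in> carrier G - D. H #>\<^bsub>G\<^esub> x = c)} \<in> null_sets h))"

text \<open>
  Compact domination of a group \<open>G\<close> definable in \<open>M\<close>, computed in the extension \<open>N\<close>; the notion
  does not depend on the choice of \<open>\<kappa>\<close> and \<open>N\<close>.
\<close>

definition compactly_dominated ::
  "'k rel \<Rightarrow> ('f, 'r, 'a) fo_structure \<Rightarrow> ('f, 'r, 'a) fo_structure \<Rightarrow> nat \<Rightarrow> 'a list monoid \<Rightarrow> bool" where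
  "compactly_dominated \<kappa> M N m G \<longleftrightarrow> compactly_dominated_in \<kappa> N m (extend_group M N m G)"

definition admits_decomposition ::
  "('f, 'r, 'a) fo_structure \<Rightarrow> nat \<Rightarrow> (nat \<Rightarrow> nat) \<Rightarrow> (nat \<Rightarrow> 'a list set) \<Rightarrow> nat \<Rightarrow> 'a list monoid \<Rightarrow> bool" where
  "admits_decomposition M n d X m G \<longleftrightarrow>
     (\<exists>A. (\<forall>i<n. A i \<subseteq> carrier G \<and> definable M m (A i) \<and> internal M m (A i) (d i) (X i)) \<and>
          carrier G = {finprod G a {..<n} | a. \<forall>i<n. a i \<in> A i})"

end

theory Submission
  imports Defs
begin

text \<open>
  In the extension let \<open>H\<close> be \<open>G\<^sup>0\<^sup>0\<close>. For finitely many definable sets,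
  compact domination provides a coset of \<open>H\<close> on which all of them are constant; together with
  saturation, which allows only finitely many cosets to be considered at a time, an induction gives
  \<open>e\<^sub>1, \<dots>, e\<^sub>n\<close> such that, for a given finite definable cover of \<open>G\<^sup>n\<close>, replacing any single \<open>e\<^sub>i\<close> by
  \<open>h e\<^sub>i\<close> with \<open>h \<in> H\<close> does not leave the member \<open>D\<close> of the cover containing \<open>e\<close>. The set of \<open>h\<close>
  with this property is definable and contains \<open>H\<close>, hence finitely many translates of it cover the group, and this
  statement passes down to \<open>M\<close>.

  By orthogonality the graph of \<open>n\<close>-fold multiplication is a finite union of boxes, which gives the
  cover. As \<open>D\<close> comes from a box, the moves \<open>e\<^sub>i \<mapsto> h e\<^sub>i\<close> can be combined: change in each \<open>e\<^sub>i\<close>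
  only the \<open>X\<^sub>i\<close>-coordinate, to that of \<open>h e\<^sub>i\<close>. The result still lies in \<open>G\<^sup>n\<close> and has product
  \<open>h e\<^sub>1 \<cdots> e\<^sub>n\<close>. So \<open>G\<close> is covered by finitely many translates of \<open>A\<^sub>1 \<cdots> A\<^sub>n\<close>, where \<open>A\<^sub>i\<close> is the set of
  elements of \<open>G\<close> that agree with \<open>e\<^sub>i\<close> away from the \<open>X\<^sub>i\<close>-coordinate, and the translations are
  absorbed into one \<open>A\<^sub>i\<close> for which \<open>X\<^sub>i\<close> has two elements.
\<close>

text \<open>A direct choice of the tuple \<open>e\<close> would call for a measure on the n-th power
  of the quotient and a Fubini argument. Here compact domination is used in one variable only, and
  the difficulty moves elsewhere: the coset of a new factor must suit the slices cut out by every
  possible choice of the other factors, and these may be too numerous for a union of null sets to be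
  null. Hence the compactness lemma \<open>finite_subfamily\<close>, which is used once more for the
  finite cover by translates.

  Commutativity makes single moves sufficient: whichever factor is multiplied by \<open>h\<close>,
  the product is multiplied by \<open>h\<close>, so the moved points of a box agree on the product
  and their rows fit together.

  What comes back to \<open>M\<close> is only the set \<open>D\<close> and the number of translates;
  the factors and translates found in \<open>N\<close> are quantified existentially and chosen
  afresh in \<open>M\<close>. To make such transfers cheap, statements are kept as predicates and
  \<open>codef\<close> is derived along their shape; products then have to be expressed through the
  graph of multiplication.\<close>

section \<open>Formulas with parameters\<close>

text \<open>A substitution need only send a variable to a variable or to a parameter: the maps
  between tuples that occur later select and rearrange entries and insert constants.\<close>

primrec coord :: "'a list \<Rightarrow> nat + 'a \<Rightarrow> 'a" where
  "coord xs (Inl i) = xs ! i"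
| "coord xs (Inr a) = a"

definition coord_ok :: "'a set \<Rightarrow> nat \<Rightarrow> nat + 'a \<Rightarrow> bool" where
  "coord_ok A k c \<longleftrightarrow> c \<in> Inl ` {..<k} \<union> Inr ` A"

lemma coord_ok_simps [simp]:
  "coord_ok A k (Inl i) \<longleftrightarrow> i < k" "coord_ok A k (Inr a) \<longleftrightarrow> a \<in> A"
  by (auto simp: coord_ok_def)

primrec coord_tm :: "nat + 'a \<Rightarrow> ('f, 'a) tm" where
  "coord_tm (Inl i) = Var i"
| "coord_tm (Inr a) = Par a"

primrec subst_tm :: "(nat \<Rightarrow> nat + 'a) \<Rightarrow> ('f, 'a) tm \<Rightarrow> ('f, 'a) tm" where
  "subst_tm s (Var i) = coord_tm (s i)"
| "subst_tm s (Par a) = Par a"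
| "subst_tm s (Fn f ts) = Fn f (map (subst_tm s) ts)"

definition lift_subst :: "(nat \<Rightarrow> nat + 'a) \<Rightarrow> nat \<Rightarrow> nat + 'a" where
  "lift_subst s = case_nat (Inl 0) (\<lambda>i. map_sum Suc id (s i))"

primrec subst_fm :: "('f, 'r, 'a) fm \<Rightarrow> (nat \<Rightarrow> nat + 'a) \<Rightarrow> ('f, 'r, 'a) fm" where
  "subst_fm (Eq t u) = (\<lambda>s. Eq (subst_tm s t) (subst_tm s u))"
| "subst_fm (Rel r ts) = (\<lambda>s. Rel r (map (subst_tm s) ts))"
| "subst_fm (Neg \<phi>) = (\<lambda>s. Neg (subst_fm \<phi> s))"
| "subst_fm (Conj \<phi> \<psi>) = (\<lambda>s. Conj (subst_fm \<phi> s) (subst_fm \<psi> s))"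
| "subst_fm (Ex \<phi>) = (\<lambda>s. Ex (subst_fm \<phi> (lift_subst s)))"

lemma coord_lift: "coord (a # xs) (map_sum Suc id c) = coord xs c"
  by (cases c) auto

lemma coord_ok_lift: "coord_ok A (Suc k) (map_sum Suc id c) \<longleftrightarrow> coord_ok A k c"
  by (cases c) auto

lemma tm_val_coord_tm [simp]: "tm_val M xs (coord_tm c) = coord xs c"
  by (cases c) auto

lemma wf_tm_coord_tm [simp]: "wf_tm M A k (coord_tm c) \<longleftrightarrow> coord_ok A k c"
  by (cases c) auto

lemma tm_val_subst:
  "wf_tm M A k t \<Longrightarrow> (\<And>i. i < k \<Longrightarrow> coord xs (s i) = ys ! i) \<Longrightarrow>
    tm_val N xs (subst_tm s t) = tm_val N ys t"
  by (induction t) (auto simp: o_def intro!: arg_cong[where f="finterp N _"])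

lemma wf_tm_subst:
  "wf_tm M A k t \<Longrightarrow> (\<And>i. i < k \<Longrightarrow> coord_ok A l (s i)) \<Longrightarrow> wf_tm M A l (subst_tm s t)"
  by (induction t) auto

lemma holds_subst:
  "wf_fm M A k \<phi> \<Longrightarrow> (\<And>i. i < k \<Longrightarrow> coord xs (s i) = ys ! i) \<Longrightarrow>
    holds N xs (subst_fm \<phi> s) \<longleftrightarrow> holds N ys \<phi>"
proof (induction \<phi> arbitrary: k xs ys s)
  case (Eq t u)
  then show ?case by (simp add: tm_val_subst[of M A k])
next
  case (Rel r ts)
  have "map (tm_val N xs \<circ> subst_tm s) ts = map (tm_val N ys) ts"
    using Rel by (auto intro!: tm_val_subst[of M A k])
  then show ?case by (simp only: subst_fm.simps holds.simps map_map)
next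
  case (Ex \<phi>)
  have "holds N (a # xs) (subst_fm \<phi> (lift_subst s)) \<longleftrightarrow> holds N (a # ys) \<phi>" for a
    by (rule Ex.IH[of "Suc k"])
      (use Ex.prems in \<open>auto simp: lift_subst_def coord_lift split: nat.split\<close>)
  then show ?case by simp
next
  case (Conj \<phi> \<psi>)
  then show ?case by (metis holds.simps(4) subst_fm.simps(4) wf_fm.simps(4))
next
  case (Neg \<phi>)
  then show ?case by (metis holds.simps(3) subst_fm.simps(3) wf_fm.simps(3))
qed

lemma wf_fm_subst:
  "wf_fm M A k \<phi> \<Longrightarrow> (\<And>i. i < k \<Longrightarrow> coord_ok A l (s i)) \<Longrightarrow> wf_fm M A l (subst_fm \<phi> s)"
proof (induction \<phi> arbitrary: k l s)
  case (Ex \<phi>)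
  have "wf_fm M A (Suc l) (subst_fm \<phi> (lift_subst s))"
    by (rule Ex.IH[of "Suc k"])
      (use Ex.prems in \<open>auto simp: lift_subst_def coord_ok_lift split: nat.split\<close>)
  then show ?case by simp
next
  case (Conj \<phi> \<psi>)
  then show ?case by (metis subst_fm.simps(4) wf_fm.simps(4))
qed (auto intro: wf_tm_subst)

section \<open>Finite sets of parameters and their elimination\<close>

lemma wf_tm_mono: "wf_tm M A k t \<Longrightarrow> A \<subseteq> B \<Longrightarrow> wf_tm M B k t"
  by (induction t) auto

lemma wf_fm_mono: "wf_fm M A k \<phi> \<Longrightarrow> A \<subseteq> B \<Longrightarrow> wf_fm M B k \<phi>"
  by (induction \<phi> arbitrary: k) (auto intro: wf_tm_mono)

lemma wf_tm_finite: "wf_tm M A k t \<Longrightarrow> \<exists>B \<subseteq> A. finite B \<and> wf_tm M B k t"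
proof (induction t)
  case (Par a)
  then show ?case by (intro exI[of _ "{a}"]) auto
next
  case (Fn f ts)
  then have "\<forall>t\<in>set ts. \<exists>B \<subseteq> A. finite B \<and> wf_tm M B k t" by auto
  then obtain B where B: "\<And>t. t \<in> set ts \<Longrightarrow> B t \<subseteq> A \<and> finite (B t) \<and> wf_tm M (B t) k t"
    by metis
  show ?case
  proof (intro exI conjI)
    show "\<Union>(B ` set ts) \<subseteq> A" "finite (\<Union>(B ` set ts))" using B by auto
    show "wf_tm M (\<Union>(B ` set ts)) k (Fn f ts)"
      using Fn.prems B by (auto intro: wf_tm_mono[of M "B _"])
  qed
qed auto

lemma wf_tms_finite:
  assumes "\<forall>t\<in>set ts. wf_tm M A k t"
  shows "\<exists>B \<subseteq> A. finite B \<and> (\<forall>t\<in>set ts. wf_tm M B k t)"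
proof -
  obtain B where B: "\<And>t. t \<in> set ts \<Longrightarrow> B t \<subseteq> A \<and> finite (B t) \<and> wf_tm M (B t) k t"
    using assms wf_tm_finite by metis
  show ?thesis
    by (rule exI[of _ "\<Union>(B ` set ts)"]) (use B in \<open>auto intro: wf_tm_mono[of M "B _"]\<close>)
qed

lemma wf_fm_finite: "wf_fm M A k \<phi> \<Longrightarrow> \<exists>B \<subseteq> A. finite B \<and> wf_fm M B k \<phi>"
proof (induction \<phi> arbitrary: k)
  case (Eq t u)
  then show ?case using wf_tms_finite[of "[t, u]" M A k] by auto
next
  case (Rel r ts)
  then show ?case using wf_tms_finite[of ts M A k] by auto
next
  case (Conj \<phi> \<psi>)
  then obtain B C where "B \<subseteq> A" "finite B" "wf_fm M B k \<phi>" "C \<subseteq> A" "finite C" "wf_fm M C k \<psi>"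
    by (metis wf_fm.simps(4))
  then show ?case
    by (intro exI[of _ "B \<union> C"]) (auto intro: wf_fm_mono[of M B] wf_fm_mono[of M C])
qed auto

text \<open>
  Trading parameters for variables, in the form that the induction needs: under a quantifier new
  variables are added in front, so the list \<open>ps\<close> of parameters goes to the back.
\<close>

lemma abstract_tm:
  assumes "wf_tm M (set ps) k t"
  shows "\<exists>u. wf_tm M {} (k + length ps) u \<and>
    (\<forall>(N :: ('f, 'r, 'a) fo_structure) xs. length xs = k \<longrightarrow> tm_val N (xs @ ps) u = tm_val N xs t)"
  using assms
proof (induction t)
  case (Var i)
  then show ?case by (intro exI[of _ "Var i"]) (auto simp: nth_append)
next
  case (Par a)
  then obtain i where "i < length ps" "ps ! i = a" by (auto simp: in_set_conv_nth)
  then show ?case by (intro exI[of _ "Var (k + i)"]) (auto simp: nth_append)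
next
  case (Fn f ts)
  then obtain u where u: "\<And>t. t \<in> set ts \<Longrightarrow> wf_tm M {} (k + length ps) (u t)"
    "\<And>t (N :: ('f, 'r, 'a) fo_structure) xs. t \<in> set ts \<Longrightarrow> length xs = k \<Longrightarrow>
       tm_val N (xs @ ps) (u t) = tm_val N xs t"
    by (metis wf_tm.simps(3))
  show ?case
  proof (intro exI conjI allI impI)
    show "wf_tm M {} (k + length ps) (Fn f (map u ts))" using Fn u by auto
    show "tm_val N (xs @ ps) (Fn f (map u ts)) = tm_val N xs (Fn f ts)" if "length xs = k"
      for N :: "('f, 'r, 'a) fo_structure" and xs
    proof -
      have "map (tm_val N (xs @ ps) \<circ> u) ts = map (tm_val N xs) ts" using u(2) that by auto
      then show ?thesis by (metis tm_val.simps(3) map_map)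
    qed
  qed
qed

lemma abstract_fm:
  assumes "wf_fm M (set ps) k \<phi>"
  shows "\<exists>\<psi>. wf_fm M {} (k + length ps) \<psi> \<and>
    (\<forall>(N :: ('f, 'r, 'a) fo_structure) xs. length xs = k \<longrightarrow> holds N (xs @ ps) \<psi> = holds N xs \<phi>)"
  using assms
proof (induction \<phi> arbitrary: k)
  case (Eq t u)
  then obtain t' u' where "wf_tm M {} (k + length ps) t'" "wf_tm M {} (k + length ps) u'"
    "\<And>(N :: ('f, 'r, 'a) fo_structure) xs. length xs = k \<Longrightarrow> tm_val N (xs @ ps) t' = tm_val N xs t"
    "\<And>(N :: ('f, 'r, 'a) fo_structure) xs. length xs = k \<Longrightarrow> tm_val N (xs @ ps) u' = tm_val N xs u"
    using abstract_tm[of M ps k t] abstract_tm[of M ps k u] by auto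
  then show ?case by (intro exI[of _ "Eq t' u'"]) simp
next
  case (Rel r ts)
  then have "\<forall>t\<in>set ts. wf_tm M (set ps) k t" by auto
  then obtain u where u: "\<And>t. t \<in> set ts \<Longrightarrow> wf_tm M {} (k + length ps) (u t)"
    "\<And>t (N :: ('f, 'r, 'a) fo_structure) xs. t \<in> set ts \<Longrightarrow> length xs = k \<Longrightarrow>
       tm_val N (xs @ ps) (u t) = tm_val N xs t"
    using abstract_tm[of M ps k] by metis
  show ?case
  proof (intro exI conjI allI impI)
    show "wf_fm M {} (k + length ps) (Rel r (map u ts))" using Rel u by auto
    show "holds N (xs @ ps) (Rel r (map u ts)) = holds N xs (Rel r ts)" if "length xs = k"
      for N :: "('f, 'r, 'a) fo_structure" and xs
    proof -
      have "map (tm_val N (xs @ ps) \<circ> u) ts = map (tm_val N xs) ts" using u(2) that by auto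
      then show ?thesis by (metis holds.simps(2) map_map)
    qed
  qed
next
  case (Neg \<phi>)
  then obtain \<psi> where "wf_fm M {} (k + length ps) \<psi>"
    "\<And>(N :: ('f, 'r, 'a) fo_structure) xs. length xs = k \<Longrightarrow> holds N (xs @ ps) \<psi> = holds N xs \<phi>"
    by (metis wf_fm.simps(3))
  then show ?case by (intro exI[of _ "Neg \<psi>"]) simp
next
  case (Conj \<phi> \<eta>)
  then obtain \<psi> \<theta> where "wf_fm M {} (k + length ps) \<psi>" "wf_fm M {} (k + length ps) \<theta>"
    "\<And>(N :: ('f, 'r, 'a) fo_structure) xs. length xs = k \<Longrightarrow> holds N (xs @ ps) \<psi> = holds N xs \<phi>"
    "\<And>(N :: ('f, 'r, 'a) fo_structure) xs. length xs = k \<Longrightarrow> holds N (xs @ ps) \<theta> = holds N xs \<eta>"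
    by (metis wf_fm.simps(4))
  then show ?case by (intro exI[of _ "Conj \<psi> \<theta>"]) simp
next
  case (Ex \<phi>)
  then obtain \<psi> where "wf_fm M {} (Suc k + length ps) \<psi>"
    "\<And>(N :: ('f, 'r, 'a) fo_structure) xs. length xs = Suc k \<Longrightarrow>
       holds N (xs @ ps) \<psi> = holds N xs \<phi>"
    by (metis wf_fm.simps(5))
  then show ?case by (intro exI[of _ "Ex \<psi>"]) (simp flip: append_Cons)
qed

text \<open>\<open>elementary_extension\<close> speaks of parameter-free formulas only. The finitely
  many parameters of \<phi> lie in \<open>M\<close>, so they can be appended to the tuple as values
  of extra variables, and \<open>abstract_fm\<close> gives one formula that serves both
  structures.\<close>

lemma elementary_extension_holds:
  assumes "elementary_extension M N" "\<phi> \<in> formulas M (universe M) m" "xs \<in> tuples M m"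
  shows "holds N xs \<phi> \<longleftrightarrow> holds M xs \<phi>"
proof -
  obtain B where B: "B \<subseteq> universe M" "finite B" "wf_fm M B m \<phi>"
    using wf_fm_finite assms(2) unfolding formulas_def by blast
  then obtain ps where ps: "set ps = B" using finite_list by blast
  obtain \<psi> where \<psi>: "wf_fm M {} (m + length ps) \<psi>"
    "\<And>(N :: ('a, 'b, 'c) fo_structure) xs. length xs = m \<Longrightarrow> holds N (xs @ ps) \<psi> = holds N xs \<phi>"
    using abstract_fm[of M ps m \<phi>] B ps by auto
  have "holds N (xs @ ps) \<psi> \<longleftrightarrow> holds M (xs @ ps) \<psi>"
    using assms \<psi>(1) B ps unfolding elementary_extension_def formulas_def tuples_def by auto
  then show ?thesis using \<psi>(2) assms(3) by (simp add: tuples_def)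
qed

section \<open>Sets defined by a common formula\<close>

text \<open>The coordinate maps along which definability can be pulled back by substitution;
  \<open>A\<close> bounds the constants they insert. Only lists of length \<open>k\<close> matter,
  so \<open>p\<close> may be any function that agrees with the description there.\<close>

definition proj :: "'a set \<Rightarrow> nat \<Rightarrow> nat \<Rightarrow> ('a list \<Rightarrow> 'a list) \<Rightarrow> bool" where
  "proj A k l p \<longleftrightarrow> (\<exists>cs. length cs = l \<and> (\<forall>c\<in>set cs. coord_ok A k c) \<and>
     (\<forall>xs. length xs = k \<longrightarrow> p xs = map (coord xs) cs))"

lemma proj_id: "proj A k k (\<lambda>xs. xs)"
  unfolding proj_def by (rule exI[of _ "map Inl [0..<k]"]) (auto simp: list_eq_iff_nth_eq)

lemma proj_const: "set c \<subseteq> A \<Longrightarrow> length c = l \<Longrightarrow> proj A k l (\<lambda>xs. c)"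
  unfolding proj_def by (rule exI[of _ "map Inr c"]) (auto simp: list_eq_iff_nth_eq)

lemma proj_append:
  assumes "proj A k l p" "proj A k l' q"
  shows "proj A k (l + l') (\<lambda>xs. p xs @ q xs)"
proof -
  obtain cs ds where "length cs = l" "\<forall>c\<in>set cs. coord_ok A k c"
    "\<forall>xs. length xs = k \<longrightarrow> p xs = map (coord xs) cs"
    "length ds = l'" "\<forall>c\<in>set ds. coord_ok A k c"
    "\<forall>xs. length xs = k \<longrightarrow> q xs = map (coord xs) ds"
    using assms unfolding proj_def by metis
  then show ?thesis unfolding proj_def by (intro exI[of _ "cs @ ds"]) auto
qed

lemma proj_take_drop:
  assumes "proj A k l p" "o' + l' \<le> l"
  shows "proj A k l' (\<lambda>xs. take l' (drop o' (p xs)))"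
proof -
  obtain cs where "length cs = l" "\<forall>c\<in>set cs. coord_ok A k c"
    "\<forall>xs. length xs = k \<longrightarrow> p xs = map (coord xs) cs"
    using assms unfolding proj_def by metis
  then show ?thesis unfolding proj_def
    by (intro exI[of _ "take l' (drop o' cs)"])
      (use assms(2) in \<open>auto simp: take_map drop_map dest!: in_set_takeD in_set_dropD\<close>)
qed

lemma proj_take: "l' \<le> l \<Longrightarrow> proj A k l p \<Longrightarrow> proj A k l' (\<lambda>xs. take l' (p xs))"
  using proj_take_drop[of A k l p 0 l'] by simp

lemma proj_drop: "o' + l' = l \<Longrightarrow> proj A k l p \<Longrightarrow> proj A k l' (\<lambda>xs. drop o' (p xs))"
proof -
  assume a: "o' + l' = l" "proj A k l p"
  then have *: "\<And>xs. length xs = k \<Longrightarrow> length (p xs) = l" unfolding proj_def by auto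
  have "proj A k l' (\<lambda>xs. take l' (drop o' (p xs)))" using proj_take_drop a by blast
  moreover have "\<And>xs. length xs = k \<Longrightarrow> take l' (drop o' (p xs)) = drop o' (p xs)"
    using * a(1) by auto
  ultimately show ?thesis unfolding proj_def by metis
qed

lemma proj_concat:
  assumes "\<And>i. i < n \<Longrightarrow> proj A k (l i) (p i)"
  shows "proj A k (\<Sum>i<n. l i) (\<lambda>xs. concat (map (\<lambda>i. p i xs) [0..<n]))"
  using assms
proof (induction n)
  case 0
  then show ?case by (simp add: proj_const)
next
  case (Suc n)
  then show ?case using proj_append[of A k "\<Sum>i<n. l i" _ "l n" "p n"] by simp
qed

lemma proj_concat_const:
  assumes "\<And>i. i < n \<Longrightarrow> proj A k l (p i)"
  shows "proj A k (n * l) (\<lambda>xs. concat (map (\<lambda>i. p i xs) [0..<n]))"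
  using proj_concat[of n A k "\<lambda>_. l" p] assms by simp

text \<open>Under a quantifier the new tuple is put in front, so whatever depended on the outer
  tuple reappears after a \<open>drop\<close>.\<close>

lemma proj_comp_drop: "proj A k l p \<Longrightarrow> proj A (l' + k) l (\<lambda>xs. p (drop l' xs))"
proof -
  assume "proj A k l p"
  then obtain cs where cs: "length cs = l" "\<forall>c\<in>set cs. coord_ok A k c"
    "\<forall>xs. length xs = k \<longrightarrow> p xs = map (coord xs) cs"
    unfolding proj_def by metis
  have "coord (drop l' xs) c = coord xs (map_sum (\<lambda>i. l' + i) id c)"
    if "length xs = l' + k" for xs c using that by (cases c) auto
  moreover have "coord_ok A (l' + k) (map_sum (\<lambda>i. l' + i) id c)" if "coord_ok A k c" for c
    using that by (cases c) auto
  ultimately show ?thesis unfolding proj_def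
    by (intro exI[of _ "map (map_sum (\<lambda>i. l' + i) id) cs"]) (use cs in auto)
qed

lemma proj_take_left: "proj A (l + k) l (\<lambda>xs. take l xs)"
  using proj_take[of l "l + k" A "l + k" "\<lambda>xs. xs"] proj_id by auto

lemma proj_in_tuples:
  assumes "proj A k l p" "A \<subseteq> universe M" "xs \<in> tuples M k"
  shows "p xs \<in> tuples M l"
proof -
  obtain cs where cs: "length cs = l" "\<forall>c\<in>set cs. coord_ok A k c" "p xs = map (coord xs) cs"
    using assms unfolding proj_def tuples_def by auto
  have "coord xs c \<in> universe M" if "c \<in> set cs" for c
    using bspec[OF cs(2) that] assms(2,3) nth_mem[of _ xs]
    by (cases c) (auto simp: tuples_def simp del: nth_mem)
  then show ?thesis using cs by (auto simp: tuples_def)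
qed

text \<open>
  \<open>P\<close> and \<open>Q\<close> are the interpretations in \<open>M\<close> and in \<open>N\<close> of one formula with \<open>k\<close> free variables and
  parameters in \<open>A\<close>. With \<open>N = M\<close> and \<open>Q = P\<close> this is definability over \<open>A\<close>.
\<close>

definition codef ::
  "('f, 'r, 'a) fo_structure \<Rightarrow> ('f, 'r, 'a) fo_structure \<Rightarrow> 'a set \<Rightarrow> nat \<Rightarrow>
    ('a list \<Rightarrow> bool) \<Rightarrow> ('a list \<Rightarrow> bool) \<Rightarrow> bool" where
  "codef M N A k P Q \<longleftrightarrow> (\<exists>\<phi>\<in>formulas M A k.
     (\<forall>xs\<in>tuples M k. P xs \<longleftrightarrow> holds M xs \<phi>) \<and> (\<forall>xs\<in>tuples N k. Q xs \<longleftrightarrow> holds N xs \<phi>))"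

lemma codef_holds: "\<phi> \<in> formulas M A k \<Longrightarrow> codef M N A k (\<lambda>xs. holds M xs \<phi>) (\<lambda>xs. holds N xs \<phi>)"
  unfolding codef_def by auto

lemma codef_cong:
  assumes "codef M N A k P Q" "\<And>xs. xs \<in> tuples M k \<Longrightarrow> P' xs = P xs"
    "\<And>xs. xs \<in> tuples N k \<Longrightarrow> Q' xs = Q xs"
  shows "codef M N A k P' Q'"
  using assms unfolding codef_def by auto

lemma codef_mono: "codef M N A k P Q \<Longrightarrow> A \<subseteq> B \<Longrightarrow> codef M N B k P Q"
  unfolding codef_def formulas_def using wf_fm_mono by blast

lemma codef_not: "codef M N A k P Q \<Longrightarrow> codef M N A k (\<lambda>xs. \<not> P xs) (\<lambda>xs. \<not> Q xs)"
  unfolding codef_def formulas_def by (metis holds.simps(3) mem_Collect_eq wf_fm.simps(3))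

lemma codef_conj:
  assumes "codef M N A k P Q" "codef M N A k P' Q'"
  shows "codef M N A k (\<lambda>xs. P xs \<and> P' xs) (\<lambda>xs. Q xs \<and> Q' xs)"
proof -
  obtain \<phi> \<psi> where "\<phi> \<in> formulas M A k" "\<psi> \<in> formulas M A k"
    "\<forall>xs\<in>tuples M k. P xs \<longleftrightarrow> holds M xs \<phi>" "\<forall>xs\<in>tuples N k. Q xs \<longleftrightarrow> holds N xs \<phi>"
    "\<forall>xs\<in>tuples M k. P' xs \<longleftrightarrow> holds M xs \<psi>" "\<forall>xs\<in>tuples N k. Q' xs \<longleftrightarrow> holds N xs \<psi>"
    using assms unfolding codef_def by blast
  then show ?thesis unfolding codef_def by (intro bexI[of _ "Conj \<phi> \<psi>"]) (auto simp: formulas_def)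
qed

lemma codef_disj:
  assumes "codef M N A k P Q" "codef M N A k P' Q'"
  shows "codef M N A k (\<lambda>xs. P xs \<or> P' xs) (\<lambda>xs. Q xs \<or> Q' xs)"
  by (rule codef_cong[OF codef_not[OF codef_conj[OF codef_not[OF assms(1)] codef_not[OF assms(2)]]]])
    blast+

lemma codef_imp:
  assumes "codef M N A k P Q" "codef M N A k P' Q'"
  shows "codef M N A k (\<lambda>xs. P xs \<longrightarrow> P' xs) (\<lambda>xs. Q xs \<longrightarrow> Q' xs)"
  by (rule codef_cong[OF codef_disj[OF codef_not[OF assms(1)] assms(2)]]) blast+

lemma codef_iff:
  assumes "codef M N A k P Q" "codef M N A k P' Q'"
  shows "codef M N A k (\<lambda>xs. P xs \<longleftrightarrow> P' xs) (\<lambda>xs. Q xs \<longleftrightarrow> Q' xs)"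
  by (rule codef_cong[OF codef_conj[OF codef_imp[OF assms] codef_imp[OF assms(2,1)]]]) blast+

lemma codef_True: "codef M N A k (\<lambda>xs. True) (\<lambda>xs. True)"
  unfolding codef_def
  \<comment> \<open>A closed formula without parameters, since \<open>k\<close> may be 0 and
    \<open>A\<close> may be empty.\<close>
  by (rule bexI[of _ "Neg (Ex (Neg (Eq (Var 0) (Var 0))))"]) (auto simp: formulas_def)

lemma codef_False: "codef M N A k (\<lambda>xs. False) (\<lambda>xs. False)"
  using codef_not[OF codef_True] by simp

lemma codef_ball:
  assumes "finite I" "\<And>i. i \<in> I \<Longrightarrow> codef M N A k (P i) (Q i)"
  shows "codef M N A k (\<lambda>xs. \<forall>i\<in>I. P i xs) (\<lambda>xs. \<forall>i\<in>I. Q i xs)"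
  using assms by (induction I rule: finite_induct) (simp_all add: codef_True codef_conj)

lemma codef_bex:
  assumes "finite I" "\<And>i. i \<in> I \<Longrightarrow> codef M N A k (P i) (Q i)"
  shows "codef M N A k (\<lambda>xs. \<exists>i\<in>I. P i xs) (\<lambda>xs. \<exists>i\<in>I. Q i xs)"
  using assms by (induction I rule: finite_induct) (simp_all add: codef_False codef_disj)

lemma codef_all_less:
  fixes n :: nat
  assumes "\<And>i. i < n \<Longrightarrow> codef M N A k (P i) (Q i)"
  shows "codef M N A k (\<lambda>xs. \<forall>i<n. P i xs) (\<lambda>xs. \<forall>i<n. Q i xs)"
  using codef_ball[of "{..<n}" M N A k P Q] assms by (simp add: Ball_def)

lemma codef_ex_less:
  fixes n :: nat
  assumes "\<And>i. i < n \<Longrightarrow> codef M N A k (P i) (Q i)"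
  shows "codef M N A k (\<lambda>xs. \<exists>i<n. P i xs) (\<lambda>xs. \<exists>i<n. Q i xs)"
  using codef_bex[of "{..<n}" M N A k P Q] assms by (simp add: Bex_def)

text \<open>\<open>A\<close> lies in both universes so that \<open>p\<close> maps tuples to tuples,
  where \<open>P\<close> and \<open>Q\<close> are known to agree with the formula.\<close>

lemma codef_subst:
  assumes "codef M N A l P Q" "proj A k l p" "A \<subseteq> universe M" "A \<subseteq> universe N"
  shows "codef M N A k (\<lambda>xs. P (p xs)) (\<lambda>xs. Q (p xs))"
proof -
  obtain \<phi> where \<phi>: "\<phi> \<in> formulas M A l" "\<forall>xs\<in>tuples M l. P xs \<longleftrightarrow> holds M xs \<phi>"
    "\<forall>xs\<in>tuples N l. Q xs \<longleftrightarrow> holds N xs \<phi>"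
    using assms(1) unfolding codef_def by auto
  obtain cs where cs: "length cs = l" "\<forall>c\<in>set cs. coord_ok A k c"
    "\<forall>xs. length xs = k \<longrightarrow> p xs = map (coord xs) cs"
    using assms(2) unfolding proj_def by auto
  have "subst_fm \<phi> (\<lambda>i. cs ! i) \<in> formulas M A k"
    using \<phi>(1) cs unfolding formulas_def by (auto intro!: wf_fm_subst)
  moreover have "holds S xs (subst_fm \<phi> (\<lambda>i. cs ! i)) \<longleftrightarrow> holds S (p xs) \<phi>"
    if "length xs = k" for S :: "('a, 'b, 'c) fo_structure" and xs
    using that \<phi>(1) cs unfolding formulas_def by (auto intro!: holds_subst[of M A l])
  ultimately show ?thesis
    unfolding codef_def
    by (intro bexI[of _ "subst_fm \<phi> (\<lambda>i. cs ! i)"])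
      (use \<phi> proj_in_tuples[OF assms(2,3)] proj_in_tuples[OF assms(2,4)] in
        \<open>auto simp: tuples_def\<close>)
qed

lemma codef_eq:
  assumes "proj A k l p" "proj A k l q"
  shows "codef M N A k (\<lambda>xs. p xs = q xs) (\<lambda>xs. p xs = q xs)"
proof -
  obtain cs ds where *: "length cs = l" "\<forall>c\<in>set cs. coord_ok A k c"
    "\<forall>xs. length xs = k \<longrightarrow> p xs = map (coord xs) cs"
    "length ds = l" "\<forall>c\<in>set ds. coord_ok A k c"
    "\<forall>xs. length xs = k \<longrightarrow> q xs = map (coord xs) ds"
    using assms unfolding proj_def by metis
  have "codef M N A k (\<lambda>xs. \<forall>i<l. coord xs (cs ! i) = coord xs (ds ! i))
     (\<lambda>xs. \<forall>i<l. coord xs (cs ! i) = coord xs (ds ! i))"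
  proof (rule codef_all_less)
    fix i assume "i < l"
    then show "codef M N A k (\<lambda>xs. coord xs (cs ! i) = coord xs (ds ! i))
       (\<lambda>xs. coord xs (cs ! i) = coord xs (ds ! i))"
      unfolding codef_def using *
      by (intro bexI[of _ "Eq (coord_tm (cs ! i)) (coord_tm (ds ! i))"]) (auto simp: formulas_def)
  qed
  then show ?thesis
    by (rule codef_cong) (use * in \<open>auto simp: tuples_def list_eq_iff_nth_eq\<close>)
qed

lemma tuples_Suc: "tuples M (Suc l) = {xs. \<exists>v\<in>tuples M l. \<exists>a\<in>universe M. xs = a # v}"
  by (auto simp: tuples_def length_Suc_conv)

lemma tuples_0 [simp]: "tuples M 0 = {[]}"
  by (auto simp: tuples_def)

lemma tuples_append: "v \<in> tuples M l \<Longrightarrow> xs \<in> tuples M k \<Longrightarrow> v @ xs \<in> tuples M (l + k)"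
  by (auto simp: tuples_def)

lemma holds_Ex_pow:
  "holds M xs ((Ex ^^ l) \<phi>) \<longleftrightarrow> (\<exists>v\<in>tuples M l. holds M (v @ xs) \<phi>)"
proof (induction l arbitrary: \<phi>)
  case (Suc l)
  have "holds M xs ((Ex ^^ Suc l) \<phi>) \<longleftrightarrow> holds M xs ((Ex ^^ l) (Ex \<phi>))"
    by (simp add: funpow_swap1)
  also have "\<dots> \<longleftrightarrow> (\<exists>v\<in>tuples M l. \<exists>a\<in>universe M. holds M (a # v @ xs) \<phi>)"
    unfolding Suc.IH by simp
  also have "\<dots> \<longleftrightarrow> (\<exists>v\<in>tuples M (Suc l). holds M (v @ xs) \<phi>)"
    unfolding tuples_Suc by force
  finally show ?case .
qed simp

lemma wf_Ex_pow: "wf_fm M A k ((Ex ^^ l) \<phi>) \<longleftrightarrow> wf_fm M A (l + k) \<phi>"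
  by (induction l arbitrary: k) auto

text \<open>The premise is phrased with \<open>take\<close> and \<open>drop\<close> and with curried
  \<open>P\<close> so that \<open>intro\<close> can match nested quantifiers: the quantified tuple
  becomes \<open>take l xs\<close> and the outer one \<open>drop l xs\<close>.\<close>

lemma codef_ex:
  assumes "codef M N A (l + k) (\<lambda>xs. P (drop l xs) (take l xs)) (\<lambda>xs. Q (drop l xs) (take l xs))"
  shows "codef M N A k (\<lambda>xs. \<exists>v\<in>tuples M l. P xs v) (\<lambda>xs. \<exists>v\<in>tuples N l. Q xs v)"
proof -
  obtain \<phi> where \<phi>: "\<phi> \<in> formulas M A (l + k)"
    "\<And>xs. xs\<in>tuples M (l + k) \<Longrightarrow> P (drop l xs) (take l xs) \<longleftrightarrow> holds M xs \<phi>"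
    "\<And>xs. xs\<in>tuples N (l + k) \<Longrightarrow> Q (drop l xs) (take l xs) \<longleftrightarrow> holds N xs \<phi>"
    using assms unfolding codef_def by auto
  have "P xs v \<longleftrightarrow> holds M (v @ xs) \<phi>" if "xs \<in> tuples M k" "v \<in> tuples M l" for xs v
    using \<phi>(2)[OF tuples_append[OF that(2,1)]] that by (simp add: tuples_def)
  moreover have "Q xs v \<longleftrightarrow> holds N (v @ xs) \<phi>" if "xs \<in> tuples N k" "v \<in> tuples N l" for xs v
    using \<phi>(3)[OF tuples_append[OF that(2,1)]] that by (simp add: tuples_def)
  moreover have "(Ex ^^ l) \<phi> \<in> formulas M A k" using \<phi>(1) by (simp add: formulas_def wf_Ex_pow)
  ultimately show ?thesis
    unfolding codef_def by (intro bexI[of _ "(Ex ^^ l) \<phi>"]) (auto simp: holds_Ex_pow)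
qed

lemma codef_all:
  assumes "codef M N A (l + k) (\<lambda>xs. P (drop l xs) (take l xs)) (\<lambda>xs. Q (drop l xs) (take l xs))"
  shows "codef M N A k (\<lambda>xs. \<forall>v\<in>tuples M l. P xs v) (\<lambda>xs. \<forall>v\<in>tuples N l. Q xs v)"
proof -
  have "codef M N A k (\<lambda>xs. \<exists>v\<in>tuples M l. \<not> P xs v) (\<lambda>xs. \<exists>v\<in>tuples N l. \<not> Q xs v)"
    by (rule codef_ex) (rule codef_not[OF assms])
  from codef_not[OF this] show ?thesis by simp
qed

lemma codef_transfer:
  assumes "elementary_extension M N" "codef M N (universe M) k P Q" "xs \<in> tuples M k"
  shows "P xs \<longleftrightarrow> Q xs"
proof -
  have "xs \<in> tuples N k" using assms(1,3) by (auto simp: elementary_extension_def tuples_def)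
  then show ?thesis using assms elementary_extension_holds unfolding codef_def by blast
qed

text \<open>Arity 0 is the case of sentences with parameters in \<open>M\<close>, the form in which
  axioms and covers are moved between \<open>M\<close> and \<open>N\<close>.\<close>

lemma codef_transfer_0:
  "elementary_extension M N \<Longrightarrow> codef M N (universe M) 0 P Q \<Longrightarrow> P [] \<longleftrightarrow> Q []"
  using codef_transfer[of M N 0 P Q "[]"] by simp

lemma definable_iff_codef:
  "definable M k X \<longleftrightarrow>
    X \<subseteq> tuples M k \<and> codef M M (universe M) k (\<lambda>xs. xs \<in> X) (\<lambda>xs. xs \<in> X)"
  unfolding definable_def codef_def def_set_def by fastforce

lemma definable_Collect:
  "codef M M (universe M) k P P \<Longrightarrow> definable M k {xs \<in> tuples M k. P xs}"
  unfolding definable_iff_codef by (auto elim: codef_cong)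

text \<open>Two formulas that define \<open>X\<close> in \<open>M\<close> agree on all tuples of
  \<open>M\<close>. This is a sentence, so they agree on all tuples of \<open>N\<close>, and the
  union in \<open>extend_set\<close> is a union of equal sets.\<close>

lemma codef_extend_set:
  assumes "elementary_extension M N" "definable M k X"
  shows "codef M N (universe M) k (\<lambda>xs. xs \<in> X) (\<lambda>xs. xs \<in> extend_set M N k X)"
    and "extend_set M N k X \<subseteq> tuples N k"
proof -
  obtain \<phi> where \<phi>: "\<phi> \<in> formulas M (universe M) k" "X = def_set M k \<phi>"
    using assms(2) unfolding definable_def by auto
  have "def_set N k \<psi> = def_set N k \<phi>" if "\<psi> \<in> formulas M (universe M) k" "X = def_set M k \<psi>" for \<psi>
  proof -
    \<comment> \<open>\<open>k + 0\<close> is the shape that \<open>codef_all\<close> asks for when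
      there are no outer variables.\<close>
    have "codef M N (universe M) (k + 0)
        (\<lambda>xs. holds M (take k xs) \<phi> \<longleftrightarrow> holds M (take k xs) \<psi>)
        (\<lambda>xs. holds N (take k xs) \<phi> \<longleftrightarrow> holds N (take k xs) \<psi>)"
      using codef_cong[OF codef_iff[OF codef_holds[OF \<phi>(1)] codef_holds[OF that(1)]],
          where P'="\<lambda>xs. holds M (take k xs) \<phi> \<longleftrightarrow> holds M (take k xs) \<psi>"
            and Q'="\<lambda>xs. holds N (take k xs) \<phi> \<longleftrightarrow> holds N (take k xs) \<psi>"]
      by (simp add: tuples_def)
    from codef_all[where P="\<lambda>_ v. holds M v \<phi> \<longleftrightarrow> holds M v \<psi>"
        and Q="\<lambda>_ v. holds N v \<phi> \<longleftrightarrow> holds N v \<psi>", OF this]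
    have "(\<forall>v\<in>tuples M k. holds M v \<phi> \<longleftrightarrow> holds M v \<psi>) \<longleftrightarrow>
        (\<forall>v\<in>tuples N k. holds N v \<phi> \<longleftrightarrow> holds N v \<psi>)"
      by (rule codef_transfer_0[OF assms(1)])
    moreover have "\<forall>v\<in>tuples M k. holds M v \<phi> \<longleftrightarrow> holds M v \<psi>"
      using \<phi>(2) that(2) unfolding def_set_def by auto
    ultimately have "\<forall>v\<in>tuples N k. holds N v \<phi> \<longleftrightarrow> holds N v \<psi>"
      by blast
    then show ?thesis unfolding def_set_def by auto
  qed
  then have *: "extend_set M N k X = def_set N k \<phi>" unfolding extend_set_def using \<phi> by blast
  show "codef M N (universe M) k (\<lambda>xs. xs \<in> X) (\<lambda>xs. xs \<in> extend_set M N k X)"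
    unfolding * using \<phi> by (auto simp: codef_def def_set_def intro!: bexI[of _ \<phi>])
  show "extend_set M N k X \<subseteq> tuples N k" unfolding * def_set_def by auto
qed

section \<open>Saturation\<close>

locale saturated_structure =
  fixes \<kappa> :: "'k rel" and N :: "('f, 'r, 'a) fo_structure"
  assumes card: "Card_order \<kappa>"
    and inf: "infinite (Field \<kappa>)"
    and sat: "saturated \<kappa> N"
begin

lemma small_Un: "|A| <o \<kappa> \<Longrightarrow> |B| <o \<kappa> \<Longrightarrow> |A \<union> B| <o \<kappa>"
  using card_of_Un_ordLess_infinite_Field[OF inf card] .

lemma small_finite: "finite A \<Longrightarrow> |A| <o \<kappa>"
  using finite_ordLess_infinite[OF card_of_Well_order card_order_on_well_order_on[OF card] _ inf]
  by (simp add: Field_card_of)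

lemma saturated_1:
  assumes A: "A \<subseteq> universe N" "|A| <o \<kappa>"
    and def: "\<And>P. P \<in> \<P> \<Longrightarrow> codef N N A 1 (\<lambda>xs. xs \<in> P) (\<lambda>xs. xs \<in> P)"
    and fin: "\<And>\<Q>. \<Q> \<subseteq> \<P> \<Longrightarrow> finite \<Q> \<Longrightarrow> \<exists>xs\<in>tuples N 1. \<forall>P\<in>\<Q>. xs \<in> P"
  shows "\<exists>xs\<in>tuples N 1. \<forall>P\<in>\<P>. xs \<in> P"
proof -
  have "\<forall>P\<in>\<P>. \<exists>\<phi>. \<phi> \<in> formulas N A 1 \<and> (\<forall>xs\<in>tuples N 1. xs \<in> P \<longleftrightarrow> holds N xs \<phi>)"
    using def unfolding codef_def by blast
  from bchoice[OF this] obtain \<phi> where \<phi>: "\<And>P. P \<in> \<P> \<Longrightarrow> \<phi> P \<in> formulas N A 1"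
    "\<And>P xs. P \<in> \<P> \<Longrightarrow> xs \<in> tuples N 1 \<Longrightarrow> xs \<in> P \<longleftrightarrow> holds N xs (\<phi> P)"
    by blast
  have t1: "xs \<in> tuples N 1 \<longleftrightarrow> (\<exists>c\<in>universe N. xs = [c])" for xs
    by (auto simp: tuples_def length_Suc_conv)
  have "\<exists>c\<in>universe N. \<forall>\<psi>\<in>\<phi> ` \<P>. holds N [c] \<psi>"
  proof -
    have "\<exists>c\<in>universe N. \<forall>\<psi>\<in>\<Phi>\<^sub>0. holds N [c] \<psi>" if sub: "\<Phi>\<^sub>0 \<subseteq> \<phi> ` \<P>" "finite \<Phi>\<^sub>0" for \<Phi>\<^sub>0
    proof -
      obtain \<Q> where \<Q>: "\<Q> \<subseteq> \<P>" "finite \<Q>" "\<Phi>\<^sub>0 = \<phi> ` \<Q>" using finite_subset_image[OF sub(2,1)] by auto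
      then obtain c where c: "c \<in> universe N" "\<forall>P\<in>\<Q>. [c] \<in> P"
        using fin[of \<Q>] unfolding Bex_def t1 by blast
      moreover have "holds N [c] (\<phi> P)" if "P \<in> \<Q>" for P
        using \<phi>(2)[of P "[c]"] that c \<Q>(1) t1 by auto
      ultimately show ?thesis using \<Q>(3) by auto
    qed
    moreover have "\<phi> ` \<P> \<subseteq> formulas N A 1" using \<phi>(1) by auto
    ultimately show ?thesis
      using sat[unfolded saturated_def, THEN spec, THEN spec, of A "\<phi> ` \<P>"] A by simp
  qed
  then obtain c where c: "c \<in> universe N" "\<And>P. P \<in> \<P> \<Longrightarrow> holds N [c] (\<phi> P)" by auto
  then have "[c] \<in> P" if "P \<in> \<P>" for P using \<phi>(2)[of P "[c]"] that t1 by auto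
  then show ?thesis using c(1) t1 by blast
qed

text \<open>Saturation is given for one variable. In the step, the last \<open>m\<close> entries are
  realised first, by the induction hypothesis applied to projections; then the first entry is
  realised over them, with these entries as new parameters.\<close>

lemma saturated_tuples:
  assumes A: "A \<subseteq> universe N" "|A| <o \<kappa>"
    and def: "\<And>P. P \<in> \<P> \<Longrightarrow> codef N N A m (\<lambda>xs. xs \<in> P) (\<lambda>xs. xs \<in> P)"
    and fin: "\<And>\<Q>. \<Q> \<subseteq> \<P> \<Longrightarrow> finite \<Q> \<Longrightarrow> \<exists>xs\<in>tuples N m. \<forall>P\<in>\<Q>. xs \<in> P"
  shows "\<exists>xs\<in>tuples N m. \<forall>P\<in>\<P>. xs \<in> P"
  using def fin
proof (induction m arbitrary: \<P>)
  case 0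
  have "[] \<in> P" if "P \<in> \<P>" for P using 0(2)[of "{P}"] that by simp
  then show ?case by (intro bexI[of _ "[]"] ballI) auto
next
  case (Suc m)
  \<comment> \<open>Projections of finite intersections, not of single sets: this leaves the fibres
    over \<open>xs\<close> with the finite intersection property.\<close>
  define R where "R \<Q> = {xs. \<exists>v\<in>tuples N 1. \<forall>P\<in>\<Q>. v @ xs \<in> P}" for \<Q> :: "'a list set set"
  have R_def': "codef N N A m (\<lambda>xs. xs \<in> R \<Q>) (\<lambda>xs. xs \<in> R \<Q>)" if "\<Q> \<subseteq> \<P>" "finite \<Q>" for \<Q>
    unfolding R_def mem_Collect_eq by (rule codef_ex) (use that Suc.prems(1) in \<open>auto intro!: codef_ball\<close>)
  have "\<exists>xs\<in>tuples N m. \<forall>P\<in>R ` {\<Q>. \<Q> \<subseteq> \<P> \<and> finite \<Q>}. xs \<in> P"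
  proof (rule Suc.IH)
    fix P assume "P \<in> R ` {\<Q>. \<Q> \<subseteq> \<P> \<and> finite \<Q>}"
    then show "codef N N A m (\<lambda>xs. xs \<in> P) (\<lambda>xs. xs \<in> P)" using R_def' by auto
  next
    fix \<R> assume \<R>: "\<R> \<subseteq> R ` {\<Q>. \<Q> \<subseteq> \<P> \<and> finite \<Q>}" "finite \<R>"
    from finite_subset_image[OF \<R>(2,1)] obtain S where S: "S \<subseteq> {\<Q>. \<Q> \<subseteq> \<P> \<and> finite \<Q>}" "finite S" "\<R> = R ` S"
      by blast
    then obtain ys where ys: "ys \<in> tuples N (Suc m)" "\<forall>P\<in>\<Union>S. ys \<in> P"
      using Suc.prems(2)[of "\<Union>S"] by auto
    then obtain a xs where "ys = [a] @ xs" "xs \<in> tuples N m" "[a] \<in> tuples N 1"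
      by (auto simp: tuples_def length_Suc_conv)
    then show "\<exists>xs\<in>tuples N m. \<forall>P\<in>\<R>. xs \<in> P" unfolding S(3) R_def using ys(2) by blast
  qed
  then obtain xs where xs: "xs \<in> tuples N m"
    "\<And>\<Q>. \<Q> \<subseteq> \<P> \<Longrightarrow> finite \<Q> \<Longrightarrow> \<exists>v\<in>tuples N 1. \<forall>P\<in>\<Q>. v @ xs \<in> P"
    unfolding R_def by auto
  have "\<exists>v\<in>tuples N 1. \<forall>P\<in>(\<lambda>P. {v. v @ xs \<in> P}) ` \<P>. v \<in> P"
  proof (rule saturated_1)
    show sub: "A \<union> set xs \<subseteq> universe N" using A xs by (auto simp: tuples_def)
    show "|A \<union> set xs| <o \<kappa>" using small_Un[OF A(2) small_finite[of "set xs"]] by simp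
    fix P' assume "P' \<in> (\<lambda>P. {v. v @ xs \<in> P}) ` \<P>"
    then obtain P where P: "P \<in> \<P>" "P' = {v. v @ xs \<in> P}" by auto
    have "codef N N (A \<union> set xs) (1 + m) (\<lambda>xs. xs \<in> P) (\<lambda>xs. xs \<in> P)"
      using codef_mono[OF Suc.prems(1)[OF P(1)]] by auto
    from codef_subst[OF this proj_append[OF proj_id proj_const], of xs]
    show "codef N N (A \<union> set xs) 1 (\<lambda>xs. xs \<in> P') (\<lambda>xs. xs \<in> P')" using P sub xs(1) by (simp add: tuples_def)
  next
    fix \<Q> assume \<Q>: "\<Q> \<subseteq> (\<lambda>P. {v. v @ xs \<in> P}) ` \<P>" "finite \<Q>"
    from finite_subset_image[OF \<Q>(2,1)] obtain S where "S \<subseteq> \<P>" "finite S" "\<Q> = (\<lambda>P. {v. v @ xs \<in> P}) ` S"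
      by blast
    then show "\<exists>v\<in>tuples N 1. \<forall>P\<in>\<Q>. v \<in> P" using xs(2)[of S] by auto
  qed
  then obtain v where "v \<in> tuples N 1" "\<forall>P\<in>\<P>. v @ xs \<in> P" by auto
  moreover from this(1) have "v @ xs \<in> tuples N (Suc m)" using tuples_append[OF _ xs(1), of v 1] by simp
  ultimately show ?case by (intro bexI[of _ "v @ xs"])
qed

text \<open>Compactness in the variable \<open>b\<close>: the sets of \<open>b\<close> for which no
  \<open>h\<close> in \<open>H\<close> has \<open>h @ b\<close> in \<open>W e\<close> are open and
  cover everything. Since \<open>H\<close> is only type-definable, saturation is used twice, first
  for \<open>b\<close> and then for \<open>h\<close>.\<close>

lemma finite_subfamily:
  assumes A: "A \<subseteq> universe N" "|A| <o \<kappa>"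
    and H: "\<Phi> \<subseteq> formulas N A m" "H = {h \<in> tuples N m. \<forall>\<phi>\<in>\<Phi>. holds N h \<phi>}"
    and def: "\<And>e. e \<in> E \<Longrightarrow> codef N N A (m + q) (\<lambda>xs. xs \<in> W e) (\<lambda>xs. xs \<in> W e)"
    and cover: "\<And>b. b \<in> tuples N q \<Longrightarrow> \<exists>e\<in>E. \<forall>h\<in>H. h @ b \<notin> W e"
  shows "\<exists>F\<subseteq>E. finite F \<and> (\<forall>b\<in>tuples N q. \<exists>e\<in>F. \<forall>h\<in>H. h @ b \<notin> W e)"
proof (rule ccontr)
  assume neg: "\<not> ?thesis"
  have bad: "\<exists>b\<in>tuples N q. \<forall>e\<in>F. \<exists>h\<in>H. h @ b \<in> W e" if "F \<subseteq> E" "finite F" for F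
  proof -
    have "\<not> (\<forall>b\<in>tuples N q. \<exists>e\<in>F. \<forall>h\<in>H. h @ b \<notin> W e)" using neg that by auto
    then show ?thesis by simp
  qed
  \<comment> \<open>\<open>H\<close> is replaced by its definable approximations, given by finite
    \<open>\<Psi>\<close>; no \<open>h\<close> is claimed to satisfy all of \<open>\<Phi>\<close>
    yet.\<close>
  define S where "S = (\<lambda>(e, \<Psi>). {b. \<exists>h\<in>tuples N m. (\<forall>\<phi>\<in>\<Psi>. holds N h \<phi>) \<and> h @ b \<in> W e})"
  let ?I = "E \<times> {\<Psi>. \<Psi> \<subseteq> \<Phi> \<and> finite \<Psi>}"
  have "\<exists>b\<in>tuples N q. \<forall>T\<in>S ` ?I. b \<in> T"
  proof (rule saturated_tuples[OF A])
    fix T assume "T \<in> S ` ?I"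
    then obtain e \<Psi> where T: "e \<in> E" "\<Psi> \<subseteq> \<Phi>" "finite \<Psi>"
      "T = {b. \<exists>h\<in>tuples N m. (\<forall>\<phi>\<in>\<Psi>. holds N h \<phi>) \<and> h @ b \<in> W e}"
      unfolding S_def by auto
    have *: "codef N N A (m + q) (\<lambda>xs. holds N (take m xs) \<phi>) (\<lambda>xs. holds N (take m xs) \<phi>)"
      if "\<phi> \<in> \<Psi>" for \<phi>
      using codef_subst[OF codef_holds proj_take_left A(1) A(1)] that T(2) H(1) by blast
    have "codef N N A (m + q) (\<lambda>xs. take m xs @ drop m xs \<in> W e) (\<lambda>xs. take m xs @ drop m xs \<in> W e)"
      using def[OF T(1)] by simp
    with * show "codef N N A q (\<lambda>xs. xs \<in> T) (\<lambda>xs. xs \<in> T)"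
      unfolding T(4) mem_Collect_eq by (intro codef_ex codef_conj codef_ball T(3))
  next
    fix \<T> assume \<T>: "\<T> \<subseteq> S ` ?I" "finite \<T>"
    from finite_subset_image[OF \<T>(2,1)] obtain J where J: "J \<subseteq> ?I" "finite J" "\<T> = S ` J" by blast
    have "fst ` J \<subseteq> E" "finite (fst ` J)" using J(1,2) by auto
    from bad[OF this] obtain b where b: "b \<in> tuples N q" "\<forall>e\<in>fst ` J. \<exists>h\<in>H. h @ b \<in> W e"
      by blast
    have "b \<in> S j" if j: "j \<in> J" for j
    proof -
      obtain h where "h \<in> H" "h @ b \<in> W (fst j)" using b(2) j by auto
      moreover have "snd j \<subseteq> \<Phi>" using subsetD[OF J(1) j] by (auto simp: mem_Times_iff)
      ultimately show ?thesis unfolding S_def H(2) by (force split: prod.split)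
    qed
    then show "\<exists>b\<in>tuples N q. \<forall>T\<in>\<T>. b \<in> T" using b(1) J(3) by blast
  qed
  then obtain b where b0: "b \<in> tuples N q" "\<And>j. j \<in> ?I \<Longrightarrow> b \<in> S j" by blast
  then have b: "b \<in> tuples N q"
    "\<And>e \<Psi>. e \<in> E \<Longrightarrow> \<Psi> \<subseteq> \<Phi> \<Longrightarrow> finite \<Psi> \<Longrightarrow>
       \<exists>h\<in>tuples N m. (\<forall>\<phi>\<in>\<Psi>. holds N h \<phi>) \<and> h @ b \<in> W e"
    using b0(2)[of "(_, _)"] unfolding S_def by auto
  obtain e where e: "e \<in> E" "\<forall>h\<in>H. h @ b \<notin> W e" using cover[OF b(1)] by auto
  \<comment> \<open>With \<open>b\<close> and \<open>e\<close> fixed the approximations are glued: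
    saturation with \<open>b\<close> among the parameters yields one \<open>h\<close> in
    \<open>H\<close> with \<open>h @ b\<close> in \<open>W e\<close>, against the choice of
    \<open>e\<close>.\<close>
  have "\<exists>h\<in>tuples N m. \<forall>T\<in>insert {h. h @ b \<in> W e} ((\<lambda>\<phi>. {h. holds N h \<phi>}) ` \<Phi>). h \<in> T"
  proof (rule saturated_tuples)
    show sub: "A \<union> set b \<subseteq> universe N" using A b(1) by (auto simp: tuples_def)
    show "|A \<union> set b| <o \<kappa>" using small_Un[OF A(2) small_finite[of "set b"]] by simp
    fix T assume T: "T \<in> insert {h. h @ b \<in> W e} ((\<lambda>\<phi>. {h. holds N h \<phi>}) ` \<Phi>)"
    have "codef N N (A \<union> set b) (m + q) (\<lambda>xs. xs \<in> W e) (\<lambda>xs. xs \<in> W e)"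
      using codef_mono[OF def[OF e(1)]] by auto
    from codef_subst[OF this proj_append[OF proj_id proj_const], of b]
    have "codef N N (A \<union> set b) m (\<lambda>h. h @ b \<in> W e) (\<lambda>h. h @ b \<in> W e)"
      using sub b(1) by (simp add: tuples_def)
    moreover have "codef N N (A \<union> set b) m (\<lambda>h. holds N h \<phi>) (\<lambda>h. holds N h \<phi>)" if "\<phi> \<in> \<Phi>" for \<phi>
      using codef_mono[OF codef_holds] that H(1) by blast
    ultimately show "codef N N (A \<union> set b) m (\<lambda>xs. xs \<in> T) (\<lambda>xs. xs \<in> T)" using T by auto
  next
    fix \<T> assume \<T>: "\<T> \<subseteq> insert {h. h @ b \<in> W e} ((\<lambda>\<phi>. {h. holds N h \<phi>}) ` \<Phi>)" "finite \<T>"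
    then have *: "\<T> - {{h. h @ b \<in> W e}} \<subseteq> (\<lambda>\<phi>. {h. holds N h \<phi>}) ` \<Phi>" by auto
    from finite_subset_image[OF finite_Diff[OF \<T>(2)] *] obtain \<Psi> where "\<Psi> \<subseteq> \<Phi>" "finite \<Psi>" "\<T> - {{h. h @ b \<in> W e}} = (\<lambda>\<phi>. {h. holds N h \<phi>}) ` \<Psi>"
      by blast
    moreover from this(1,2) obtain h where "h \<in> tuples N m" "\<forall>\<phi>\<in>\<Psi>. holds N h \<phi>" "h @ b \<in> W e"
      using b(2)[OF e(1), of \<Psi>] by blast
    ultimately have "h \<in> T" if "T \<in> \<T>" for T
      using that by (cases "T = {h. h @ b \<in> W e}") auto
    then show "\<exists>h\<in>tuples N m. \<forall>T\<in>\<T>. h \<in> T" using \<open>h \<in> tuples N m\<close> by blast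
  qed
  then show False using e(2) H(2) by auto
qed

end

section \<open>Generic tuples modulo a subgroup of bounded index\<close>

lemma codef_mem:
  assumes "codef M N A l (\<lambda>xs. xs \<in> S) (\<lambda>xs. xs \<in> T)" "proj A k l p"
    "A \<subseteq> universe M" "A \<subseteq> universe N"
  shows "codef M N A k (\<lambda>xs. p xs \<in> S) (\<lambda>xs. p xs \<in> T)"
  using codef_subst[OF assms] .

lemma length_concat_const: "(\<And>x. x \<in> set xs \<Longrightarrow> length x = m) \<Longrightarrow> length (concat xs) = length xs * m"
  by (induction xs) auto

lemma proj_concat_update:
  assumes "\<And>e. e \<in> set es \<Longrightarrow> set e \<subseteq> A \<and> length e = m" "proj A k m p" "length es = n"
  shows "proj A k (n * m) (\<lambda>xs. concat (es[i := p xs]))"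
proof -
  have "proj A k (n * m) (\<lambda>xs. concat (map (\<lambda>j. if j = i then p xs else es ! j) [0..<n]))"
  proof (rule proj_concat_const)
    fix j assume j: "j < n"
    show "proj A k m (\<lambda>xs. if j = i then p xs else es ! j)"
      using assms(1)[of "es ! j"] assms(2,3) j by (cases "j = i") (auto intro: proj_const)
  qed
  moreover have "es[i := v] = map (\<lambda>j. if j = i then v else es ! j) [0..<n]" for v
    using assms(3) by (auto simp: list_eq_iff_nth_eq nth_list_update)
  ultimately show ?thesis by simp
qed

text \<open>What the argument uses of the extension. The representatives in \<open>R\<close> have
  their entries in the small set \<open>A\<close>, so lists over \<open>R\<close> index families
  that \<open>finite_subfamily\<close> accepts. \<open>constant_coset\<close> is the form in which
  compact domination enters; it allows arbitrary parameters because the slices to which it is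
  applied depend on a parameter tuple \<open>b\<close>.\<close>

locale compact_quotient = saturated_structure \<kappa> N + group G
  for \<kappa> :: "'k rel" and N :: "('f, 'r, 'a) fo_structure" and G :: "'a list monoid" (structure) +
  fixes m :: nat and A :: "'a set" and H R \<Gamma> :: "'a list set" and \<Phi> :: "('f, 'r, 'a) fm set"
  assumes A: "A \<subseteq> universe N" "|A| <o \<kappa>"
    and H: "\<Phi> \<subseteq> formulas N A m" "H = {h \<in> tuples N m. \<forall>\<phi>\<in>\<Phi>. holds N h \<phi>}" "subgroup H G"
    and carrier: "carrier G \<subseteq> tuples N m"
      "codef N N A m (\<lambda>xs. xs \<in> carrier G) (\<lambda>xs. xs \<in> carrier G)"
    and graph: "codef N N A (m + (m + m)) (\<lambda>xs. xs \<in> \<Gamma>) (\<lambda>xs. xs \<in> \<Gamma>)"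
      "\<And>x y z. x \<in> carrier G \<Longrightarrow> y \<in> carrier G \<Longrightarrow> x @ y @ z \<in> \<Gamma> \<longleftrightarrow> z = x \<otimes> y"
    and R: "R \<subseteq> carrier G" "\<And>r. r \<in> R \<Longrightarrow> set r \<subseteq> A"
      "\<And>z. z \<in> carrier G \<Longrightarrow> \<exists>r\<in>R. \<exists>h\<in>H. z = h \<otimes> r"
    and constant_coset: "\<And>\<D>. finite \<D> \<Longrightarrow> (\<And>D. D \<in> \<D> \<Longrightarrow> definable N m D) \<Longrightarrow>
      \<exists>r\<in>R. \<forall>D\<in>\<D>. \<forall>h\<in>H. r \<in> D \<longleftrightarrow> h \<otimes> r \<in> D"
begin

lemma H_carrier: "h \<in> H \<Longrightarrow> h \<in> carrier G"
  using subgroup.mem_carrier[OF H(3)] .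

lemma length_carrier: "x \<in> carrier G \<Longrightarrow> length x = m"
  using carrier(1) by (auto simp: tuples_def)

text \<open>The tail \<open>b\<close> holds parameters, among them the later factors of the product
  while they are kept fixed.\<close>

definition insensitive :: "'a list set set \<Rightarrow> 'a list \<Rightarrow> 'a list list \<Rightarrow> bool" where
  "insensitive \<D> b es \<longleftrightarrow> (\<forall>D\<in>\<D>. \<forall>i<length es. \<forall>h\<in>H.
     concat es @ b \<in> D \<longleftrightarrow> concat (es[i := h \<otimes> es ! i]) @ b \<in> D)"

text \<open>For a fixed list \<open>es\<close>, the tuples \<open>b\<close> at which some move by an
  element of \<open>H\<close> is noticed form the projection of a definable set along
  \<open>H\<close>, so \<open>finite_subfamily\<close> applies to the lists over
  \<open>R\<close>.\<close>

lemma insensitive_finite: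
  assumes fin: "finite \<D>"
    and def: "\<And>D. D \<in> \<D> \<Longrightarrow> codef N N A (n * m + q) (\<lambda>xs. xs \<in> D) (\<lambda>xs. xs \<in> D)"
    and ex: "\<And>b. b \<in> tuples N q \<Longrightarrow> \<exists>es. length es = n \<and> set es \<subseteq> R \<and> insensitive \<D> b es"
  shows "\<exists>F \<subseteq> {es. length es = n \<and> set es \<subseteq> R}. finite F \<and>
    (\<forall>b\<in>tuples N q. \<exists>es\<in>F. insensitive \<D> b es)"
proof -
  \<comment> \<open>The pairs \<open>h @ b\<close> for which moving one factor by \<open>h\<close>
    changes membership in some \<open>D\<close>; \<open>g\<close> is the moved factor, named through
    the graph to keep the set definable.\<close>
  define W where "W es = {xs. \<exists>D\<in>\<D>. \<exists>i<n. \<exists>g\<in>tuples N m. take m xs @ es ! i @ g \<in> \<Gamma> \<and>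
    \<not> (concat es @ drop m xs \<in> D \<longleftrightarrow> concat (es[i := g]) @ drop m xs \<in> D)}" for es
  let ?E = "{es. length es = n \<and> set es \<subseteq> R}"
  have W: "(\<forall>h\<in>H. h @ b \<notin> W es) \<longleftrightarrow> insensitive \<D> b es" if es: "es \<in> ?E" for es b
  proof -
    have *: "h @ es ! i @ g \<in> \<Gamma> \<longleftrightarrow> g = h \<otimes> es ! i" "h \<otimes> es ! i \<in> tuples N m" "length h = m"
      if "h \<in> H" "i < n" for h i g
    proof -
      have c: "h \<in> carrier G" "es ! i \<in> carrier G"
        using that es R(1) H_carrier subsetD[OF subset_trans, of "set es" R "carrier G"] by auto
      show "h @ es ! i @ g \<in> \<Gamma> \<longleftrightarrow> g = h \<otimes> es ! i" using graph(2)[OF c] .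
      show "h \<otimes> es ! i \<in> tuples N m" "length h = m" using c carrier(1) length_carrier by auto
    qed
    have "h @ b \<in> W es \<longleftrightarrow> (\<exists>D\<in>\<D>. \<exists>i<n.
        \<not> (concat es @ b \<in> D \<longleftrightarrow> concat (es[i := h \<otimes> es ! i]) @ b \<in> D))" if "h \<in> H" for h
    proof (cases "n = 0")
      case False
      have "length h = m" using *(3)[OF that] False by auto
      then have len: "take m (h @ b) = h" "drop m (h @ b) = b" by auto
      have "(\<exists>g\<in>tuples N m. h @ es ! i @ g \<in> \<Gamma> \<and> Q g) \<longleftrightarrow> Q (h \<otimes> es ! i)" if "i < n" for i Q
        using *(1,2)[OF \<open>h \<in> H\<close> that] by auto
      then show ?thesis unfolding W_def mem_Collect_eq len by (simp cong: conj_cong)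
    qed (simp add: W_def)
    then show ?thesis unfolding insensitive_def using es by auto
  qed
  have "\<exists>F\<subseteq>?E. finite F \<and> (\<forall>b\<in>tuples N q. \<exists>e\<in>F. \<forall>h\<in>H. h @ b \<notin> W e)"
  proof (rule finite_subfamily[OF A H(1,2)])
    fix es assume es: "es \<in> ?E"
    have e: "set e \<subseteq> A \<and> length e = m" if "e \<in> set es" for e
      using that es R(1,2) length_carrier by auto
    have e': "set (concat es) \<subseteq> A" "length (concat es) = n * m"
      using es e length_concat_const[of es m] by auto
    show "codef N N A (m + q) (\<lambda>xs. xs \<in> W es) (\<lambda>xs. xs \<in> W es)"
      unfolding W_def mem_Collect_eq
    proof (rule codef_bex[OF fin], intro codef_ex_less codef_ex codef_conj codef_not codef_iff)
      fix D i assume D: "D \<in> \<D>" "i < n"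
      have z: "proj A (m + (m + q)) m (\<lambda>xs. take m xs)" "proj A (m + (m + q)) m (\<lambda>xs. take m (drop m xs))"
        "proj A (m + (m + q)) q (\<lambda>xs. drop m (drop m xs))"
        by (intro proj_take_left proj_comp_drop proj_drop proj_id refl)+
      have "proj A (m + (m + q)) (m + (m + m)) (\<lambda>xs. take m (drop m xs) @ es ! i @ take m xs)"
        by (intro proj_append z proj_const) (use e[of "es ! i"] es D in auto)
      from codef_mem[OF graph(1) this A(1) A(1)]
      show "codef N N A (m + (m + q)) (\<lambda>xs. take m (drop m xs) @ es ! i @ take m xs \<in> \<Gamma>)
         (\<lambda>xs. take m (drop m xs) @ es ! i @ take m xs \<in> \<Gamma>)" .
      have "proj A (m + (m + q)) (n * m + q) (\<lambda>xs. concat es @ drop m (drop m xs))"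
        by (intro proj_append z proj_const e')
      from codef_mem[OF def[OF D(1)] this A(1) A(1)]
      show "codef N N A (m + (m + q)) (\<lambda>xs. concat es @ drop m (drop m xs) \<in> D)
         (\<lambda>xs. concat es @ drop m (drop m xs) \<in> D)" .
      have "proj A (m + (m + q)) (n * m + q)
          (\<lambda>xs. concat (es[i := take m xs]) @ drop m (drop m xs))"
        by (intro proj_append z proj_concat_update e) (use es in auto)
      from codef_mem[OF def[OF D(1)] this A(1) A(1)]
      show "codef N N A (m + (m + q)) (\<lambda>xs. concat (es[i := take m xs]) @ drop m (drop m xs) \<in> D)
         (\<lambda>xs. concat (es[i := take m xs]) @ drop m (drop m xs) \<in> D)" .
    qed
  next
    fix b assume "b \<in> tuples N q"
    then obtain es where "es \<in> ?E" "insensitive \<D> b es" using ex by blast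
    then show "\<exists>e\<in>?E. \<forall>h\<in>H. h @ b \<notin> W e" using W by blast
  qed
  then obtain F where F: "F \<subseteq> ?E" "finite F" "\<forall>b\<in>tuples N q. \<exists>e\<in>F. \<forall>h\<in>H. h @ b \<notin> W e" by auto
  then have "\<forall>b\<in>tuples N q. \<exists>es\<in>F. insensitive \<D> b es" using W by (meson subsetD)
  then show ?thesis using F(1,2) by blast
qed

text \<open>
  The new factor is at first one more parameter. By \<open>insensitive_finite\<close> finitely many choices of the
  other factors serve all its values, so its coset only has to be good for finitely many sets.
\<close>

lemma ex_insensitive:
  assumes "finite \<D>"
    and "\<And>D. D \<in> \<D> \<Longrightarrow> codef N N A (n * m + q) (\<lambda>xs. xs \<in> D) (\<lambda>xs. xs \<in> D)"
    and "b \<in> tuples N q"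
  shows "\<exists>es. length es = n \<and> set es \<subseteq> R \<and> insensitive \<D> b es"
  using assms
proof (induction n arbitrary: q b)
  case 0
  show ?case by (rule exI[of _ "[]"]) (simp add: insensitive_def)
next
  case (Suc n)
  have eq: "Suc n * m + q = n * m + (m + q)" by simp
  have def: "codef N N A (n * m + (m + q)) (\<lambda>xs. xs \<in> D) (\<lambda>xs. xs \<in> D)" if "D \<in> \<D>" for D
    using Suc.prems(2)[OF that] unfolding eq .
  \<comment> \<open>The factor still to be chosen becomes part of the parameters, so the induction
    hypothesis is used with \<open>m + q\<close> in place of \<open>q\<close>.\<close>
  from insensitive_finite[OF Suc.prems(1) def Suc.IH[OF Suc.prems(1) def]]
  obtain F where F: "F \<subseteq> {es. length es = n \<and> set es \<subseteq> R}" "finite F"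
    "\<forall>b\<in>tuples N (m + q). \<exists>es\<in>F. insensitive \<D> b es" by blast
  \<comment> \<open>The slices in the new factor, one for each set and each of the finitely many
    lists.\<close>
  define S where "S = (\<lambda>(D, es). {g \<in> tuples N m. concat es @ g @ b \<in> D})"
  have "\<exists>r\<in>R. \<forall>D\<in>S ` (\<D> \<times> F). \<forall>h\<in>H. r \<in> D \<longleftrightarrow> h \<otimes> r \<in> D"
  proof (rule constant_coset)
    show "finite (S ` (\<D> \<times> F))" using F(2) Suc.prems(1) by auto
    fix D' assume "D' \<in> S ` (\<D> \<times> F)"
    then obtain D es where D: "D \<in> \<D>" "es \<in> F" "D' = {g \<in> tuples N m. concat es @ g @ b \<in> D}"
      unfolding S_def by auto
    have es: "length es = n" "\<And>e. e \<in> set es \<Longrightarrow> e \<in> tuples N m"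
      using D(2) F(1) R(1) carrier(1) by blast+
    have "proj (universe N) m (n * m + (m + q)) (\<lambda>g. concat es @ g @ b)"
      by (intro proj_append proj_id proj_const)
        (use es Suc.prems(3) length_concat_const[of es m] in \<open>auto simp: tuples_def\<close>)
    moreover have "codef N N (universe N) (n * m + (m + q)) (\<lambda>xs. xs \<in> D) (\<lambda>xs. xs \<in> D)"
      by (rule codef_mono[OF def[OF D(1)] A(1)])
    ultimately show "definable N m D'"
      unfolding D(3) using codef_mem definable_Collect by blast
  qed
  then obtain r where r: "r \<in> R" "\<And>D es h. D \<in> \<D> \<Longrightarrow> es \<in> F \<Longrightarrow> h \<in> H \<Longrightarrow>
      r \<in> S (D, es) \<longleftrightarrow> h \<otimes> r \<in> S (D, es)" by blast
  have rt: "r \<in> tuples N m" "h \<in> H \<Longrightarrow> h \<otimes> r \<in> tuples N m" for h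
    using subsetD[OF R(1) r(1)] subsetD[OF carrier(1)] H_carrier m_closed by blast+
  then have "r @ b \<in> tuples N (m + q)" using tuples_append Suc.prems(3) by blast
  \<comment> \<open>No circularity: \<open>r\<close> suits every list in \<open>F\<close>, so the
    list that serves \<open>r @ b\<close> may be picked after it.\<close>
  then obtain es where es: "es \<in> F" "insensitive \<D> (r @ b) es" using F(3) by blast
  then have len: "length es = n" "set es \<subseteq> R" using F(1) by auto
  have "concat (es @ [r]) @ b \<in> D \<longleftrightarrow> concat ((es @ [r])[i := h \<otimes> (es @ [r]) ! i]) @ b \<in> D"
    if "D \<in> \<D>" "i < Suc n" "h \<in> H" for D i h
  proof (cases "i = n")
    case True
    then show ?thesis using r(2)[OF that(1) es(1) that(3)] rt that len
      by (simp add: S_def list_update_append nth_append)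
  next
    case False
    then have "i < length es" using that len by simp
    then show ?thesis
      using es(2)[unfolded insensitive_def, rule_format, OF that(1) _ that(3), of i]
      by (simp add: nth_append list_update_append)
  qed
  then show ?case using len r(1) unfolding insensitive_def by (intro exI[of _ "es @ [r]"]) auto
qed

text \<open>The type-definable \<open>H\<close> disappears from the conclusion. It lies in the
  definable set of those \<open>h\<close> whose single moves stay in \<open>D\<close>, and finitely
  many translates of that set cover the group. For a fixed number of translates this is a
  first-order statement.\<close>

lemma generic_slices:
  assumes fin: "finite \<D>"
    and def: "\<And>D. D \<in> \<D> \<Longrightarrow> codef N N A (n * m) (\<lambda>xs. xs \<in> D) (\<lambda>xs. xs \<in> D)"
    and cover: "\<And>es. length es = n \<Longrightarrow> set es \<subseteq> carrier G \<Longrightarrow> \<exists>D\<in>\<D>. concat es \<in> D"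
  shows "\<exists>D\<in>\<D>. \<exists>es. length es = n \<and> set es \<subseteq> carrier G \<and> concat es \<in> D \<and>
    (\<exists>F. finite F \<and> F \<subseteq> carrier G \<and> (\<forall>z\<in>carrier G. \<exists>r\<in>F. \<exists>h\<in>carrier G.
      z = h \<otimes> r \<and> (\<forall>i<n. concat (es[i := h \<otimes> es ! i]) \<in> D)))"
proof -
  obtain es where es: "length es = n" "set es \<subseteq> R" "insensitive \<D> [] es"
    using ex_insensitive[OF fin, of n 0 "[]"] def by (auto simp: tuples_0)
  then have esG: "set es \<subseteq> carrier G" using R(1) by auto
  obtain D where D: "D \<in> \<D>" "concat es \<in> D" using cover[OF es(1) esG] by auto
  have ins: "concat (es[i := h \<otimes> es ! i]) \<in> D" if "h \<in> H" "i < n" for h i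
    using es(3) that D es(1) unfolding insensitive_def by auto
  \<comment> \<open>\<open>g\<close> stands for \<open>h \<otimes> es ! i\<close>, which makes
    \<open>S\<close> definable.\<close>
  define S where "S h \<longleftrightarrow> (\<forall>i<n. \<exists>g\<in>tuples N m. h @ es ! i @ g \<in> \<Gamma> \<and> concat (es[i := g]) \<in> D)" for h
  have S: "S h \<longleftrightarrow> (\<forall>i<n. concat (es[i := h \<otimes> es ! i]) \<in> D)" if "h \<in> carrier G" for h
  proof -
    have "es ! i \<in> carrier G" if "i < n" for i using that es(1) esG nth_mem[of i es] by auto
    then show ?thesis unfolding S_def using graph(2)[OF that] carrier(1) that by auto
  qed
  \<comment> \<open>The condition concerns only \<open>drop m xs\<close>, an element not reached by
    the translate of \<open>S\<close> by \<open>r\<close>; the first \<open>m\<close> entries are a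
    dummy, present because \<open>finite_subfamily\<close> quantifies over \<open>H\<close>.\<close>
  define W where "W r = {xs. drop m xs \<in> carrier G \<and>
    \<not> (\<exists>h\<in>tuples N m. h \<in> carrier G \<and> h @ r @ drop m xs \<in> \<Gamma> \<and> S h)}" for r
  have "\<exists>F\<subseteq>R. finite F \<and> (\<forall>b\<in>tuples N m. \<exists>e\<in>F. \<forall>h\<in>H. h @ b \<notin> W e)"
  proof (rule finite_subfamily[OF A H(1,2)])
    fix r assume r: "r \<in> R"
    have rA: "set r \<subseteq> A" "length r = m" using r R(1,2) length_carrier by auto
    have e: "set e \<subseteq> A \<and> length e = m" if "e \<in> set es" for e
      using that es R(1,2) length_carrier by auto
    have S_def': "codef N N A k (\<lambda>xs. S (p xs)) (\<lambda>xs. S (p xs))" if p: "proj A k m p" for k p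
      unfolding S_def
    proof (intro codef_all_less codef_ex codef_conj)
      fix i assume i: "i < n"
      have "proj A (m + k) (m + (m + m)) (\<lambda>xs. p (drop m xs) @ es ! i @ take m xs)"
        by (intro proj_append proj_take_left proj_comp_drop p proj_const)
          (use e[of "es ! i"] es i in auto)
      from codef_mem[OF graph(1) this A(1) A(1)]
      show "codef N N A (m + k) (\<lambda>xs. p (drop m xs) @ es ! i @ take m xs \<in> \<Gamma>)
        (\<lambda>xs. p (drop m xs) @ es ! i @ take m xs \<in> \<Gamma>)" .
      have "proj A (m + k) (n * m) (\<lambda>xs. concat (es[i := take m xs]))"
        by (intro proj_concat_update e proj_take_left es(1))
      from codef_mem[OF def[OF D(1)] this A(1) A(1)]
      show "codef N N A (m + k) (\<lambda>xs. concat (es[i := take m xs]) \<in> D)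
        (\<lambda>xs. concat (es[i := take m xs]) \<in> D)" .
    qed
    show "codef N N A (m + m) (\<lambda>xs. xs \<in> W r) (\<lambda>xs. xs \<in> W r)"
      unfolding W_def mem_Collect_eq
    proof (intro codef_conj codef_not codef_ex)
      have "proj A (m + m) m (\<lambda>xs. drop m xs)" by (rule proj_comp_drop[OF proj_id])
      from codef_mem[OF carrier(2) this A(1) A(1)]
      show "codef N N A (m + m) (\<lambda>xs. drop m xs \<in> carrier G) (\<lambda>xs. drop m xs \<in> carrier G)" .
      from codef_mem[OF carrier(2) proj_take_left A(1) A(1)]
      show "codef N N A (m + (m + m)) (\<lambda>xs. take m xs \<in> carrier G) (\<lambda>xs. take m xs \<in> carrier G)" .
      have "proj A (m + (m + m)) (m + (m + m)) (\<lambda>xs. take m xs @ r @ drop m (drop m xs))"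
        by (intro proj_append proj_take_left proj_const rA proj_comp_drop proj_drop proj_id refl)
      from codef_mem[OF graph(1) this A(1) A(1)]
      show "codef N N A (m + (m + m)) (\<lambda>xs. take m xs @ r @ drop m (drop m xs) \<in> \<Gamma>)
        (\<lambda>xs. take m xs @ r @ drop m (drop m xs) \<in> \<Gamma>)" .
      show "codef N N A (m + (m + m)) (\<lambda>xs. S (take m xs)) (\<lambda>xs. S (take m xs))"
        by (rule S_def'[OF proj_take_left])
    qed
  next
    fix z assume z: "z \<in> tuples N m"
    show "\<exists>r\<in>R. \<forall>h\<in>H. h @ z \<notin> W r"
    proof (cases "z \<in> carrier G")
      case True
      then obtain r h where r: "r \<in> R" "h \<in> H" "z = h \<otimes> r" using R(3) by blast
      then have "h \<in> carrier G" "h \<in> tuples N m" "h @ r @ z \<in> \<Gamma>" "S h"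
        using S ins graph(2)[of h r z] R(1) H_carrier carrier(1) by auto
      then show ?thesis using r(1) H_carrier length_carrier unfolding W_def
        by (intro bexI[of _ r]) auto
    next
      case False
      moreover obtain r where "r \<in> R" using R(3)[OF one_closed] by auto
      ultimately show ?thesis using H_carrier length_carrier unfolding W_def
        by (intro bexI[of _ r]) auto
    qed
  qed
  then obtain F where F: "F \<subseteq> R" "finite F" "\<And>z. z \<in> tuples N m \<Longrightarrow> \<exists>r\<in>F. \<forall>h\<in>H. h @ z \<notin> W r" by blast
  have "\<exists>r\<in>F. \<exists>h\<in>carrier G. z = h \<otimes> r \<and> (\<forall>i<n. concat (es[i := h \<otimes> es ! i]) \<in> D)"
    if z: "z \<in> carrier G" for z
  proof -
    obtain r where r: "r \<in> F" "\<forall>h\<in>H. h @ z \<notin> W r" using F(3)[of z] z carrier(1) by auto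
    \<comment> \<open>Membership in \<open>W r\<close> does not depend on the first \<open>m\<close>
      entries, so the unit serves as the element of \<open>H\<close>.\<close>
    then have "\<one> @ z \<notin> W r" using subgroup.one_closed[OF H(3)] by blast
    then obtain h where "h \<in> carrier G" "h @ r @ z \<in> \<Gamma>" "S h"
      using z length_carrier[OF one_closed] by (auto simp: W_def)
    moreover have "r \<in> carrier G" using r(1) F(1) R(1) by blast
    ultimately show ?thesis using r(1) S graph(2)[of h r z] by blast
  qed
  then show ?thesis using D es(1) esG F(1,2) R(1) by (intro bexI[of _ D] exI[of _ es] conjI exI[of _ F]) auto
qed

end

section \<open>Passing to the extension\<close>

definition part :: "(nat \<Rightarrow> nat) \<Rightarrow> nat \<Rightarrow> 'a list \<Rightarrow> 'a list" where
  "part l i xs = take (l i) (drop (\<Sum>j<i. l j) xs)"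

lemma part_bound:
  fixes i n :: nat
  shows "i < n \<Longrightarrow> (\<Sum>j<i. l j) + l i \<le> (\<Sum>j<n. l j :: nat)"
  using sum_mono2[of "{..<n}" "{..<Suc i}" l] by simp

lemma length_concat_map:
  "(\<And>j. j < n \<Longrightarrow> length (x j) = l j) \<Longrightarrow> length (concat (map x [0..<n])) = (\<Sum>j<n. l j)"
  by (induction n) auto

lemma part_concat:
  "(\<And>j. j < n \<Longrightarrow> length (x j) = l j) \<Longrightarrow> i < n \<Longrightarrow> part l i (concat (map x [0..<n])) = x i"
proof (induction n)
  case (Suc n)
  have len: "length (concat (map x [0..<n])) = (\<Sum>j<n. l j)" using Suc.prems by (intro length_concat_map) auto
  show ?case
  proof (cases "i = n")
    case True
    then show ?thesis using len Suc.prems by (simp add: part_def)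
  next
    case False
    then have "i < n" using Suc.prems by simp
    then show ?thesis using Suc part_bound[of i n l] len by (simp add: part_def)
  qed
qed simp

lemma concat_parts: "length xs = (\<Sum>j<n. l j) \<Longrightarrow> concat (map (\<lambda>i. part l i xs) [0..<n]) = xs"
proof (induction n arbitrary: xs)
  case (Suc n)
  have "map (\<lambda>i. part l i xs) [0..<n] = map (\<lambda>i. part l i (take (\<Sum>j<n. l j) xs)) [0..<n]"
  proof (rule map_cong[OF refl])
    fix i assume "i \<in> set [0..<n]"
    then have "(\<Sum>j<i. l j) + l i \<le> (\<Sum>j<n. l j)" using part_bound by auto
    then have "l i \<le> (\<Sum>j<n. l j) - (\<Sum>j<i. l j)" by linarith
    then show "part l i xs = part l i (take (\<Sum>j<n. l j) xs)"
      unfolding part_def by (simp add: drop_take)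
  qed
  then have "concat (map (\<lambda>i. part l i xs) [0..<n]) = take (\<Sum>j<n. l j) xs"
    using Suc.IH[of "take (\<Sum>j<n. l j) xs"] Suc.prems by (simp only:) simp
  moreover have "part l n xs = drop (\<Sum>j<n. l j) xs" using Suc.prems by (simp add: part_def)
  ultimately show ?case by simp
qed simp

lemma part_eqI:
  assumes "length x = (\<Sum>j<n. l j)" "length y = (\<Sum>j<n. l j)" "\<And>i. i < n \<Longrightarrow> part l i x = part l i y"
  shows "x = y"
proof -
  have "map (\<lambda>i. part l i x) [0..<n] = map (\<lambda>i. part l i y) [0..<n]" using assms(3) by simp
  then show ?thesis using concat_parts[OF assms(1)] concat_parts[OF assms(2)] by metis
qed

lemma length_part: "length xs = (\<Sum>j<n. l j) \<Longrightarrow> i < n \<Longrightarrow> length (part l i xs) = l i"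
proof -
  assume *: "length xs = (\<Sum>j<n. l j)" "i < n"
  have "l i \<le> (\<Sum>j<n. l j) - (\<Sum>j<i. l j)" using part_bound[OF *(2), of l] by linarith
  then show ?thesis using *(1) by (simp add: part_def)
qed

lemma proj_part: "i < n \<Longrightarrow> proj A k (\<Sum>j<n. l j) p \<Longrightarrow> proj A k (l i) (\<lambda>xs. part l i (p xs))"
  unfolding part_def by (rule proj_take_drop[OF _ part_bound])

definition block :: "nat \<Rightarrow> nat \<Rightarrow> 'a list \<Rightarrow> 'a list" where
  "block m i xs = take m (drop (i * m) xs)"

lemma part_const: "part (\<lambda>_. m) i xs = block m i xs"
  by (simp add: part_def block_def)

lemma block_bound: "i < n \<Longrightarrow> i * m + m \<le> n * (m::nat)"
  by (metis Suc_leI add.commute mult_Suc mult_le_mono1)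

lemma proj_block: "i < n \<Longrightarrow> proj A k (n * m) p \<Longrightarrow> proj A k m (\<lambda>xs. block m i (p xs))"
  unfolding block_def by (rule proj_take_drop[OF _ block_bound])

lemma block_concat:
  "(\<And>x. x \<in> set xs \<Longrightarrow> length x = m) \<Longrightarrow> i < length xs \<Longrightarrow> block m i (concat xs) = xs ! i"
proof (induction xs arbitrary: i)
  case (Cons x xs)
  then show ?case by (cases i) (auto simp: block_def)
qed simp

lemma block_tuples: "xs \<in> tuples M (n * m) \<Longrightarrow> i < n \<Longrightarrow> block m i xs \<in> tuples M m"
  using block_bound[of i n m] by (auto simp: tuples_def block_def dest!: in_set_takeD in_set_dropD)

lemma concat_blocks: "length xs = n * m \<Longrightarrow> concat (map (\<lambda>i. block m i xs) [0..<n]) = xs"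
  using concat_parts[of xs "\<lambda>_. m" n] by (simp add: part_const)

section \<open>Language and cardinality of the extension\<close>

lemma wf_tm_cong: "fsyms N = fsyms M \<Longrightarrow> wf_tm N A k t = wf_tm M A k t"
  by (induction t) auto

lemma wf_fm_cong:
  "fsyms N = fsyms M \<Longrightarrow> rsyms N = rsyms M \<Longrightarrow> wf_fm N A k \<phi> = wf_fm M A k \<phi>"
  by (induction \<phi> arbitrary: k) (auto simp: wf_tm_cong[of N M])

lemma codef_right:
  assumes "elementary_extension M N" "codef M N A k P Q"
  shows "codef N N A k Q Q"
proof -
  have "formulas N A k = formulas M A k"
    using assms(1) wf_fm_cong[of N M] unfolding elementary_extension_def formulas_def by auto
  then show ?thesis using assms(2) unfolding codef_def by auto
qed

text \<open>A cardinal above the power set of the formulas is infinite because there are infinitely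
  many formulas, and it exceeds the size of \<open>M\<close> because each element occurs as a
  parameter.\<close>

lemma sufficiently_saturated_imp:
  assumes "sufficiently_saturated_extension \<kappa> M N" "is_structure M"
  shows "saturated_structure \<kappa> N" "|universe M| <o \<kappa>"
proof -
  let ?F = "\<Union>m. formulas M (universe M) m"
  have \<kappa>: "Card_order \<kappa>" "|Pow ?F| <o \<kappa>" "saturated \<kappa> N"
    using assms(1) by (auto simp: sufficiently_saturated_extension_def)
  obtain a where a: "a \<in> universe M" using assms(2) by (auto simp: is_structure_def)
  \<comment> \<open>Iterated negations of one equation give infinitely many formulas whatever the
    language is.\<close>
  have neg: "(Neg ^^ k) (Eq (Par a) (Par a)) \<in> ?F" for k
    using a by (induction k) (auto simp: formulas_def)
  have "inj (\<lambda>k. (Neg ^^ k) (Eq (Par a) (Par a)))"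
  proof (rule injI)
    fix k l assume "(Neg ^^ k) (Eq (Par a) (Par a)) = (Neg ^^ l) (Eq (Par a) (Par a))"
    then show "k = l"
    proof (induction k arbitrary: l)
      case 0 then show ?case by (cases l) auto
    next
      case (Suc k) then show ?case by (cases l) auto
    qed
  qed
  from range_inj_infinite[OF this] have "infinite ?F"
    by (rule infinite_super[rotated]) (use neg in blast)
  then have "infinite (Pow ?F)" by simp
  moreover have "|Pow ?F| \<le>o |Field \<kappa>|"
    using \<kappa>(1,2) ordLeq_ordIso_trans[OF ordLess_imp_ordLeq ordIso_symmetric[OF card_of_Field_ordIso]] by blast
  ultimately have "infinite (Field \<kappa>)" using card_of_ordLeq_finite by blast
  then show "saturated_structure \<kappa> N" using \<kappa> by unfold_locales auto
  have "|universe M| \<le>o |?F|"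
  proof (rule card_of_ordLeqI)
    show "inj_on (\<lambda>a. Eq (Par a) (Par a)) (universe M)" by (auto simp: inj_on_def)
  qed (auto simp: formulas_def)
  also have "|?F| <o |Pow ?F|" by (rule card_of_Pow)
  finally show "|universe M| <o \<kappa>" using \<kappa>(2) ordLess_transitive by blast
qed

lemma (in saturated_structure) small_UN:
  "finite I \<Longrightarrow> (\<And>i. i \<in> I \<Longrightarrow> |B i| <o \<kappa>) \<Longrightarrow> |\<Union>i\<in>I. B i| <o \<kappa>"
  by (induction I rule: finite_induct) (auto simp: small_finite small_Un)

section \<open>The group that the same formulas define in the extension\<close>

locale definable_extension =
  fixes M N :: "('f, 'r, 'a) fo_structure" and G :: "'a list monoid" (structure) and m :: nat
  assumes ext: "elementary_extension M N" and G: "definable_group M m G"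
begin

abbreviation (input) "G' \<equiv> extend_group M N m G"
abbreviation (input) "\<Gamma> \<equiv> mult_graph G"
abbreviation (input) "\<Gamma>' \<equiv> extend_set M N (m + m + m) (mult_graph G)"
abbreviation (input) "C' \<equiv> extend_set M N m (carrier G)"

lemma universes: "universe M \<subseteq> universe M" "universe M \<subseteq> universe N"
  using ext by (auto simp: elementary_extension_def)

lemma def_carrier: "codef M N (universe M) m (\<lambda>xs. xs \<in> carrier G) (\<lambda>xs. xs \<in> C')"
  and carrier_tuples: "carrier G \<subseteq> tuples M m" "C' \<subseteq> tuples N m"
  using codef_extend_set[OF ext, of m "carrier G"] G
  by (auto simp: definable_group_def definable_iff_codef)

lemma def_graph: "codef M N (universe M) (m + (m + m)) (\<lambda>xs. xs \<in> \<Gamma>) (\<lambda>xs. xs \<in> \<Gamma>')"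
  and graph_tuples: "\<Gamma>' \<subseteq> tuples N (m + (m + m))"
  using codef_extend_set[OF ext, of "m + m + m" \<Gamma>] G
  by (auto simp: definable_group_def add.assoc)

lemmas codef_carrier = codef_mem[OF def_carrier _ universes]
lemmas codef_graph = codef_mem[OF def_graph _ universes]

lemmas codef_intros = codef_all codef_ex codef_imp codef_conj codef_carrier codef_graph
  codef_eq[where l=m] proj_append proj_take_left proj_comp_drop

lemma group_G: "group G" using G by (simp add: definable_group_def)

lemma graph_iff:
  assumes "x \<in> tuples M m" "y \<in> tuples M m" "z \<in> tuples M m"
  shows "x @ y @ z \<in> \<Gamma> \<longleftrightarrow> x \<in> carrier G \<and> y \<in> carrier G \<and> z = x \<otimes> y"
proof
  assume "x @ y @ z \<in> \<Gamma>"
  then obtain x' y' where *: "x @ y @ z = x' @ y' @ (x' \<otimes> y')" "x' \<in> carrier G" "y' \<in> carrier G"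
    by (auto simp: mult_graph_def)
  then have "length x' = length x" "length y' = length y"
    using carrier_tuples(1) assms by (auto simp: tuples_def)
  then show "x \<in> carrier G \<and> y \<in> carrier G \<and> z = x \<otimes> y" using * by auto
qed (auto simp: mult_graph_def)

text \<open>The product in \<open>extend_group\<close> is a definite description over
  \<open>\<Gamma>'\<close>. Existence here and uniqueness in \<open>graph'_unique\<close> give it a
  value; both are transferred from \<open>M\<close> as sentences about the graph.\<close>

lemma graph'_total:
  assumes "x \<in> C'" "y \<in> C'"
  shows "\<exists>z\<in>tuples N m. z \<in> C' \<and> x @ y @ z \<in> \<Gamma>'"
proof -
  interpret group G by (rule group_G)
  have "codef M N (universe M) 0
    (\<lambda>xs. \<forall>x\<in>tuples M m. \<forall>y\<in>tuples M m. x \<in> carrier G \<and> y \<in> carrier G \<longrightarrow>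
       (\<exists>z\<in>tuples M m. z \<in> carrier G \<and> x @ y @ z \<in> \<Gamma>))
    (\<lambda>xs. \<forall>x\<in>tuples N m. \<forall>y\<in>tuples N m. x \<in> C' \<and> y \<in> C' \<longrightarrow>
       (\<exists>z\<in>tuples N m. z \<in> C' \<and> x @ y @ z \<in> \<Gamma>'))"
    by (intro codef_intros)
  note trans = codef_transfer_0[OF ext this]
  have "\<forall>x\<in>tuples M m. \<forall>y\<in>tuples M m. x \<in> carrier G \<and> y \<in> carrier G \<longrightarrow>
       (\<exists>z\<in>tuples M m. z \<in> carrier G \<and> x @ y @ z \<in> \<Gamma>)"
  proof (intro ballI impI)
    fix x y assume "x \<in> carrier G \<and> y \<in> carrier G"
    then have "x \<otimes> y \<in> carrier G" "x @ y @ (x \<otimes> y) \<in> \<Gamma>" by (auto simp: mult_graph_def)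
    then show "\<exists>z\<in>tuples M m. z \<in> carrier G \<and> x @ y @ z \<in> \<Gamma>" using carrier_tuples(1) by blast
  qed
  then have "\<forall>x\<in>tuples N m. \<forall>y\<in>tuples N m. x \<in> C' \<and> y \<in> C' \<longrightarrow>
       (\<exists>z\<in>tuples N m. z \<in> C' \<and> x @ y @ z \<in> \<Gamma>')"
    by (rule iffD1[OF trans])
  then show ?thesis using assms subsetD[OF carrier_tuples(2)] by simp
qed

lemma graph'_unique:
  assumes "x \<in> C'" "y \<in> C'" "x @ y @ z \<in> \<Gamma>'" "x @ y @ w \<in> \<Gamma>'"
  shows "z = w"
proof -
  have "codef M N (universe M) 0
    (\<lambda>xs. \<forall>x\<in>tuples M m. \<forall>y\<in>tuples M m. \<forall>z\<in>tuples M m. \<forall>w\<in>tuples M m.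
       x @ y @ z \<in> \<Gamma> \<and> x @ y @ w \<in> \<Gamma> \<longrightarrow> z = w)
    (\<lambda>xs. \<forall>x\<in>tuples N m. \<forall>y\<in>tuples N m. \<forall>z\<in>tuples N m. \<forall>w\<in>tuples N m.
       x @ y @ z \<in> \<Gamma>' \<and> x @ y @ w \<in> \<Gamma>' \<longrightarrow> z = w)"
    by (intro codef_intros)
  note trans = codef_transfer_0[OF ext this]
  have "\<forall>x\<in>tuples N m. \<forall>y\<in>tuples N m. \<forall>z\<in>tuples N m.
      \<forall>w\<in>tuples N m. x @ y @ z \<in> \<Gamma>' \<and> x @ y @ w \<in> \<Gamma>' \<longrightarrow> z = w"
    by (rule iffD1[OF trans]) (auto simp: graph_iff)
  \<comment> \<open>The transferred sentence speaks of tuples only; that \<open>z\<close> and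
    \<open>w\<close> are tuples follows from their place in the graph.\<close>
  moreover have t: "x \<in> tuples N m" "y \<in> tuples N m" using assms carrier_tuples by auto
  moreover have "v \<in> tuples N m" if "x @ y @ v \<in> \<Gamma>'" for v
    using subsetD[OF graph_tuples that] t by (auto simp: tuples_def)
  ultimately show ?thesis using assms by blast
qed

lemma graph'_iff: "x \<in> C' \<Longrightarrow> y \<in> C' \<Longrightarrow> x @ y @ z \<in> \<Gamma>' \<longleftrightarrow> z = x \<otimes>\<^bsub>G'\<^esub> y"
proof -
  assume *: "x \<in> C'" "y \<in> C'"
  then obtain z where "x @ y @ z \<in> \<Gamma>'" using graph'_total by blast
  then have "\<exists>!z. x @ y @ z \<in> \<Gamma>'" using graph'_unique[OF *] by blast
  from theI'[OF this] have "x @ y @ (x \<otimes>\<^bsub>G'\<^esub> y) \<in> \<Gamma>'" by (simp add: extend_group_def)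
  then show ?thesis using graph'_unique[OF *] by blast
qed

lemma one_tuples: "\<one> \<in> tuples M m" "\<one> \<in> tuples N m" "set \<one> \<subseteq> universe M" "length \<one> = m"
  using group.is_monoid[OF group_G] monoid.one_closed carrier_tuples(1) universes(2)
  by (fastforce simp: tuples_def)+

text \<open>Each group axiom that mentions products becomes a sentence about the graph, with
  quantified variables for the products; the unit is a tuple of \<open>M\<close> and enters as a
  constant.\<close>

lemma group_G': "group G'"
proof (rule groupI)
  interpret group G by (rule group_G)
  have car: "carrier G' = C'" and one: "\<one>\<^bsub>G'\<^esub> = \<one>" by (simp_all add: extend_group_def)
  show "x \<otimes>\<^bsub>G'\<^esub> y \<in> carrier G'" if "x \<in> carrier G'" "y \<in> carrier G'" for x y
    using graph'_total[of x y] graph'_iff[of x y] that unfolding car by auto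
  note closed = this
  show "\<one>\<^bsub>G'\<^esub> \<in> carrier G'" unfolding car one
    using codef_transfer[OF ext def_carrier one_tuples(1)] by simp
  have "codef M N (universe M) 0
    (\<lambda>xs. \<forall>x\<in>tuples M m. \<forall>y\<in>tuples M m. \<forall>z\<in>tuples M m. \<forall>u\<in>tuples M m. \<forall>v\<in>tuples M m.
       \<forall>w\<in>tuples M m. x @ y @ u \<in> \<Gamma> \<and> y @ z @ v \<in> \<Gamma> \<and> u @ z @ w \<in> \<Gamma> \<longrightarrow> x @ v @ w \<in> \<Gamma>)
    (\<lambda>xs. \<forall>x\<in>tuples N m. \<forall>y\<in>tuples N m. \<forall>z\<in>tuples N m. \<forall>u\<in>tuples N m. \<forall>v\<in>tuples N m.
       \<forall>w\<in>tuples N m. x @ y @ u \<in> \<Gamma>' \<and> y @ z @ v \<in> \<Gamma>' \<and> u @ z @ w \<in> \<Gamma>' \<longrightarrow> x @ v @ w \<in> \<Gamma>')"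
    by (intro codef_intros)
  moreover have "\<forall>x\<in>tuples M m. \<forall>y\<in>tuples M m. \<forall>z\<in>tuples M m. \<forall>u\<in>tuples M m. \<forall>v\<in>tuples M m.
      \<forall>w\<in>tuples M m. x @ y @ u \<in> \<Gamma> \<and> y @ z @ v \<in> \<Gamma> \<and> u @ z @ w \<in> \<Gamma> \<longrightarrow> x @ v @ w \<in> \<Gamma>"
  proof (intro ballI impI)
    fix x y z u v w
    assume "x \<in> tuples M m" "y \<in> tuples M m" "z \<in> tuples M m" "u \<in> tuples M m" "v \<in> tuples M m"
      "w \<in> tuples M m" "x @ y @ u \<in> \<Gamma> \<and> y @ z @ v \<in> \<Gamma> \<and> u @ z @ w \<in> \<Gamma>"
    then show "x @ v @ w \<in> \<Gamma>" by (simp add: graph_iff m_assoc)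
  qed
  ultimately have assoc: "\<forall>x\<in>tuples N m. \<forall>y\<in>tuples N m.
      \<forall>z\<in>tuples N m. \<forall>u\<in>tuples N m. \<forall>v\<in>tuples N m. \<forall>w\<in>tuples N m.
      x @ y @ u \<in> \<Gamma>' \<and> y @ z @ v \<in> \<Gamma>' \<and> u @ z @ w \<in> \<Gamma>' \<longrightarrow> x @ v @ w \<in> \<Gamma>'"
    by (rule iffD1[OF codef_transfer_0[OF ext]])
  show "x \<otimes>\<^bsub>G'\<^esub> y \<otimes>\<^bsub>G'\<^esub> z = x \<otimes>\<^bsub>G'\<^esub> (y \<otimes>\<^bsub>G'\<^esub> z)"
    if *: "x \<in> carrier G'" "y \<in> carrier G'" "z \<in> carrier G'" for x y z
  proof -
    have c: "v \<in> C' \<Longrightarrow> v \<in> tuples N m" for v using carrier_tuples by blast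
    let ?u = "x \<otimes>\<^bsub>G'\<^esub> y" and ?v = "y \<otimes>\<^bsub>G'\<^esub> z" let ?w = "?u \<otimes>\<^bsub>G'\<^esub> z"
    note cl = closed[OF *(1,2)] closed[OF *(2,3)] closed[OF closed[OF *(1,2)] *(3)]
    have "x @ y @ ?u \<in> \<Gamma>'" "y @ z @ ?v \<in> \<Gamma>'" "?u @ z @ ?w \<in> \<Gamma>'"
      using graph'_iff * cl unfolding car by auto
    then have "x @ ?v @ ?w \<in> \<Gamma>'" using assoc c * cl unfolding car by blast
    then show ?thesis using graph'_iff[of x ?v ?w] * cl unfolding car by auto
  qed
  have "codef M N (universe M) 0
    (\<lambda>xs. \<forall>x\<in>tuples M m. x \<in> carrier G \<longrightarrow> \<one> @ x @ x \<in> \<Gamma>)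
    (\<lambda>xs. \<forall>x\<in>tuples N m. x \<in> C' \<longrightarrow> \<one> @ x @ x \<in> \<Gamma>')"
    by (intro codef_intros proj_const one_tuples)
  note trans = codef_transfer_0[OF ext this]
  have "\<forall>x\<in>tuples N m. x \<in> C' \<longrightarrow> \<one> @ x @ x \<in> \<Gamma>'"
    by (rule iffD1[OF trans]) (use one_tuples in \<open>auto simp: graph_iff\<close>)
  then show "\<one>\<^bsub>G'\<^esub> \<otimes>\<^bsub>G'\<^esub> x = x" if "x \<in> carrier G'" for x
    using graph'_iff[of \<one> x x] that \<open>\<one>\<^bsub>G'\<^esub> \<in> carrier G'\<close> carrier_tuples unfolding car one by auto
  have "codef M N (universe M) 0
    (\<lambda>xs. \<forall>x\<in>tuples M m. x \<in> carrier G \<longrightarrow> (\<exists>y\<in>tuples M m. y \<in> carrier G \<and> y @ x @ \<one> \<in> \<Gamma>))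
    (\<lambda>xs. \<forall>x\<in>tuples N m. x \<in> C' \<longrightarrow> (\<exists>y\<in>tuples N m. y \<in> C' \<and> y @ x @ \<one> \<in> \<Gamma>'))"
    by (intro codef_intros proj_const one_tuples)
  note trans = codef_transfer_0[OF ext this]
  have "\<forall>x\<in>tuples M m. x \<in> carrier G \<longrightarrow> (\<exists>y\<in>tuples M m. y \<in> carrier G \<and> y @ x @ \<one> \<in> \<Gamma>)"
  proof (intro ballI impI)
    fix x assume x: "x \<in> carrier G"
    then have "inv x \<in> carrier G" "inv x @ x @ \<one> \<in> \<Gamma>"
      using carrier_tuples(1) one_tuples by (auto simp: graph_iff subset_iff)
    then show "\<exists>y\<in>tuples M m. y \<in> carrier G \<and> y @ x @ \<one> \<in> \<Gamma>"
      using carrier_tuples(1) by blast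
  qed
  then have "\<forall>x\<in>tuples N m. x \<in> C' \<longrightarrow> (\<exists>y\<in>tuples N m. y \<in> C' \<and> y @ x @ \<one> \<in> \<Gamma>')"
    by (rule iffD1[OF trans])
  note inv_ex = this
  show "\<exists>y\<in>carrier G'. y \<otimes>\<^bsub>G'\<^esub> x = \<one>\<^bsub>G'\<^esub>" if x: "x \<in> carrier G'" for x
  proof -
    obtain y where "y \<in> C'" "y @ x @ \<one> \<in> \<Gamma>'"
      using bspec[OF inv_ex, of x] x carrier_tuples(2) unfolding car by auto
    then show ?thesis using graph'_iff[of y x \<one>] x unfolding car one by auto
  qed
qed

end

section \<open>Compact domination as constancy on a coset\<close>

context definable_extension
begin

text \<open>The cosets split by some member of \<open>\<D>\<close> form a finite union of null sets,
  which cannot be the whole space of measure 1; any remaining coset will do.\<close>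

lemma constant_on_coset:
  assumes H: "subgroup H G'"
    and h: "emeasure h (carrier (G' Mod H)) = 1"
      "\<And>D. definable N m D \<Longrightarrow> D \<subseteq> carrier G' \<Longrightarrow>
        {c \<in> carrier (G' Mod H). (\<exists>x\<in>D. H #>\<^bsub>G'\<^esub> x = c) \<and>
           (\<exists>x\<in>carrier G' - D. H #>\<^bsub>G'\<^esub> x = c)} \<in> null_sets h"
    and \<D>: "finite \<D>" "\<And>D. D \<in> \<D> \<Longrightarrow> definable N m D"
  shows "\<exists>c\<in>rcosets\<^bsub>G'\<^esub> H. \<forall>D\<in>\<D>. \<forall>x\<in>carrier G'. \<forall>y\<in>carrier G'.
    H #>\<^bsub>G'\<^esub> x = c \<longrightarrow> H #>\<^bsub>G'\<^esub> y = c \<longrightarrow> x \<in> D \<longrightarrow> y \<in> D"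
proof -
  have car: "carrier G' = C'" by (simp add: extend_group_def)
  define bad where "bad D = {c \<in> carrier (G' Mod H). (\<exists>x\<in>D. H #>\<^bsub>G'\<^esub> x = c) \<and>
           (\<exists>x\<in>carrier G' - D. H #>\<^bsub>G'\<^esub> x = c)}" for D
  \<comment> \<open>Compact domination speaks of subsets of the group, hence the intersection with
    \<open>C'\<close>.\<close>
  have "bad (D \<inter> C') \<in> null_sets h" if D: "D \<in> \<D>" for D
    unfolding bad_def
  proof (rule h(2))
    have "codef N N (universe N) m (\<lambda>xs. xs \<in> D) (\<lambda>xs. xs \<in> D)"
      using \<D>(2)[OF D] by (simp add: definable_iff_codef)
    moreover have "codef N N (universe N) m (\<lambda>xs. xs \<in> C') (\<lambda>xs. xs \<in> C')"
      by (rule codef_mono[OF codef_right[OF ext def_carrier] universes(2)])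
    ultimately have "codef N N (universe N) m (\<lambda>xs. xs \<in> D \<inter> C') (\<lambda>xs. xs \<in> D \<inter> C')"
      unfolding Int_iff by (rule codef_conj)
    then show "definable N m (D \<inter> C')" using carrier_tuples(2) by (auto simp: definable_iff_codef)
  qed (simp add: car)
  then have "(\<Union>D\<in>\<D>. bad (D \<inter> C')) \<in> null_sets h"
    using \<D>(1) by (intro null_sets.finite_UN) auto
  then have "carrier (G' Mod H) \<noteq> (\<Union>D\<in>\<D>. bad (D \<inter> C'))" using h(1) by force
  moreover have "(\<Union>D\<in>\<D>. bad (D \<inter> C')) \<subseteq> carrier (G' Mod H)" unfolding bad_def by blast
  ultimately obtain c where c: "c \<in> carrier (G' Mod H)" "\<And>D. D \<in> \<D> \<Longrightarrow> c \<notin> bad (D \<inter> C')"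
    by blast
  then show ?thesis
    unfolding bad_def car by (intro bexI[of _ c]) (auto simp: FactGroup_def)
qed

text \<open>Bounded index means fewer than \<open>\<kappa>\<close> cosets, so the entries of one
  representative for each of them can be added to the parameters.\<close>

lemma ex_compact_quotient:
  assumes M: "is_structure M" and ssat: "sufficiently_saturated_extension \<kappa> M N"
    and dom: "compactly_dominated \<kappa> M N m G"
  shows "\<exists>A H R \<Phi>. universe M \<subseteq> A \<and> compact_quotient \<kappa> N G' m A H R \<Gamma>' \<Phi>"
proof -
  interpret G': group G' by (rule group_G')
  interpret saturated_structure \<kappa> N by (rule sufficiently_saturated_imp[OF ssat M])
  have car: "carrier G' = C'" by (simp add: extend_group_def)
  obtain H h where "is_G00 \<kappa> N m G' H" and haar: "normalized_haar_measure (G' Mod H) (logic_topology \<kappa> N m G' H) h"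
    and null: "\<And>D. definable N m D \<Longrightarrow> D \<subseteq> carrier G' \<Longrightarrow>
        {c \<in> carrier (G' Mod H). (\<exists>x\<in>D. H #>\<^bsub>G'\<^esub> x = c) \<and>
           (\<exists>x\<in>carrier G' - D. H #>\<^bsub>G'\<^esub> x = c)} \<in> null_sets h"
    using dom unfolding compactly_dominated_def compactly_dominated_in_def
    by (elim exE conjE) (rule that, assumption, assumption, drule spec, erule mp, rule conjI)
  then have H: "subgroup H G'" "type_definable \<kappa> N m H" "|rcosets\<^bsub>G'\<^esub> H| <o \<kappa>"
    by (auto simp: is_G00_def bounded_type_definable_subgroup_def)
  obtain A\<^sub>0 \<Phi> where \<Phi>: "A\<^sub>0 \<subseteq> universe N" "|A\<^sub>0| <o \<kappa>" "\<Phi> \<subseteq> formulas N A\<^sub>0 m"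
    "H = {xs \<in> tuples N m. \<forall>\<phi>\<in>\<Phi>. holds N xs \<phi>}"
    using H(2) unfolding type_definable_def by blast
  have h1: "emeasure h (carrier (G' Mod H)) = 1" using haar by (simp add: normalized_haar_measure_def)
  define rep where "rep c = (SOME x. x \<in> carrier G' \<and> H #>\<^bsub>G'\<^esub> x = c)" for c
  have rep: "rep c \<in> carrier G'" "H #>\<^bsub>G'\<^esub> rep c = c" if "c \<in> rcosets\<^bsub>G'\<^esub> H" for c
    using someI_ex[of "\<lambda>x. x \<in> carrier G' \<and> H #>\<^bsub>G'\<^esub> x = c"] that
    unfolding rep_def RCOSETS_def by auto
  define R where "R = rep ` (rcosets\<^bsub>G'\<^esub> H)"
  have R: "R \<subseteq> carrier G'" using rep(1) unfolding R_def by blast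
  then have RN: "r \<in> tuples N m" if "r \<in> R" for r using that carrier_tuples(2) unfolding car by blast
  have "|R| <o \<kappa>" unfolding R_def using card_of_image H(3) ordLeq_ordLess_trans by blast
  then have "|(\<lambda>r. r ! i) ` R| <o \<kappa>" for i using card_of_image ordLeq_ordLess_trans by blast
  \<comment> \<open>Sorted by coordinate, the entries of the representatives form a union of only
    \<open>m\<close> small sets, so closure of small sets under finite unions is enough.\<close>
  then have "|\<Union>i\<in>{..<m}. (\<lambda>r. r ! i) ` R| <o \<kappa>" by (intro small_UN) auto
  moreover have "(\<Union>r\<in>R. set r) \<subseteq> (\<Union>i\<in>{..<m}. (\<lambda>r. r ! i) ` R)"
  proof
    fix a assume "a \<in> (\<Union>r\<in>R. set r)"
    then obtain r i where "r \<in> R" "i < length r" "a = r ! i" by (auto simp: in_set_conv_nth)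
    moreover from this(1) have "length r = m" using RN by (simp add: tuples_def)
    ultimately show "a \<in> (\<Union>i\<in>{..<m}. (\<lambda>r. r ! i) ` R)" by blast
  qed
  ultimately have smallR: "|\<Union>r\<in>R. set r| <o \<kappa>" using card_of_mono1 ordLeq_ordLess_trans by blast
  have "(\<Union>r\<in>R. set r) \<subseteq> universe N" using RN by (force simp: tuples_def)
  \<comment> \<open>\<open>M\<close> supplies the parameters of the group and of the cover,
    \<open>A\<^sub>0\<close> those of the type that defines \<open>H\<close>.\<close>
  define A where "A = universe M \<union> (A\<^sub>0 \<union> (\<Union>r\<in>R. set r))"
  have A: "A \<subseteq> universe N" "|A| <o \<kappa>" "universe M \<subseteq> A" "A\<^sub>0 \<subseteq> A"
    unfolding A_def using universes(2) \<Phi>(1,2) sufficiently_saturated_imp(2)[OF ssat M] smallR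
      \<open>(\<Union>r\<in>R. set r) \<subseteq> universe N\<close> by (auto intro!: small_Un)
  have Hcar: "h \<in> H \<Longrightarrow> h \<in> carrier G'" for h using subgroup.mem_carrier[OF H(1)] .
  have coset: "H #>\<^bsub>G'\<^esub> (h \<otimes>\<^bsub>G'\<^esub> x) = H #>\<^bsub>G'\<^esub> x" if "h \<in> H" "x \<in> carrier G'" for h x
    using G'.coset_mult_assoc[OF subgroup.subset[OF H(1)] Hcar[OF that(1)] that(2)]
      G'.coset_join2[OF Hcar[OF that(1)] H(1) that(1)] by simp
  have "compact_quotient \<kappa> N G' m A H R \<Gamma>' \<Phi>"
  proof (rule compact_quotient.intro[OF _ _ compact_quotient_axioms.intro], goal_cases)
    case 1
    show ?case ..
  next
    case 2
    show ?case ..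
  next
    case 5
    show ?case using \<Phi>(3) A(4) wf_fm_mono unfolding formulas_def by blast
  next
    case 10
    show ?case by (rule codef_mono[OF codef_right[OF ext def_graph] A(3)])
  next
    case (14 z)
    then have "H #>\<^bsub>G'\<^esub> z \<in> rcosets\<^bsub>G'\<^esub> H" by (simp add: G'.rcosetsI subgroup.subset[OF H(1)])
    then have r: "rep (H #>\<^bsub>G'\<^esub> z) \<in> R" "H #>\<^bsub>G'\<^esub> rep (H #>\<^bsub>G'\<^esub> z) = H #>\<^bsub>G'\<^esub> z"
      using rep unfolding R_def by auto
    moreover have "z \<in> H #>\<^bsub>G'\<^esub> z" by (rule G'.rcos_self[OF 14 H(1)])
    ultimately have "z \<in> H #>\<^bsub>G'\<^esub> rep (H #>\<^bsub>G'\<^esub> z)" by simp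
    then obtain h where "h \<in> H" "z = h \<otimes>\<^bsub>G'\<^esub> rep (H #>\<^bsub>G'\<^esub> z)" unfolding r_coset_def by auto
    then show ?case using r(1) by (intro bexI)
  next
    case (15 \<D>)
    from constant_on_coset[OF H(1) h1 null 15]
    obtain c where c: "c \<in> rcosets\<^bsub>G'\<^esub> H" "\<forall>D\<in>\<D>. \<forall>x\<in>carrier G'. \<forall>y\<in>carrier G'.
        H #>\<^bsub>G'\<^esub> x = c \<longrightarrow> H #>\<^bsub>G'\<^esub> y = c \<longrightarrow> x \<in> D \<longrightarrow> y \<in> D" ..
    show ?case
    proof (intro bexI[of _ "rep c"] ballI)
      fix D h assume "D \<in> \<D>" "h \<in> H"
      moreover from this(2) have "h \<otimes>\<^bsub>G'\<^esub> rep c \<in> carrier G'" "H #>\<^bsub>G'\<^esub> (h \<otimes>\<^bsub>G'\<^esub> rep c) = c"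
        using rep[OF c(1)] coset Hcar by auto
      ultimately show "rep c \<in> D \<longleftrightarrow> h \<otimes>\<^bsub>G'\<^esub> rep c \<in> D"
        using c(2) rep[OF c(1)] by metis
    qed (simp add: R_def c(1))
  next
    case 9
    show ?case unfolding car by (rule codef_mono[OF codef_right[OF ext def_carrier] A(3)])
  next
    case (13 r)
    then show ?case unfolding A_def by blast
  qed (use A(1,2) \<Phi>(4) H(1) R carrier_tuples(2) graph'_iff in \<open>simp_all add: car\<close>)
  then show ?thesis using A(3) by blast
qed

end

text \<open>The assertion proved in \<open>compact_quotient\<close>, now for \<open>M\<close>. That
  the cover exhausts the n-th power is one sentence and goes up; the conclusion, for the set
  \<open>D\<close> and the number of translates found in \<open>N\<close>, is another and comes
  down.\<close>

lemma (in definable_extension) generic_slices: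
  assumes M: "is_structure M" and ssat: "sufficiently_saturated_extension \<kappa> M N"
    and dom: "compactly_dominated \<kappa> M N m G"
    and fin: "finite \<D>"
    and def: "\<And>D. D \<in> \<D> \<Longrightarrow> definable M (n * m) D"
    and cover: "\<And>es. length es = n \<Longrightarrow> set es \<subseteq> carrier G \<Longrightarrow> \<exists>D\<in>\<D>. concat es \<in> D"
  shows "\<exists>D\<in>\<D>. \<exists>es. length es = n \<and> set es \<subseteq> carrier G \<and> concat es \<in> D \<and>
    (\<exists>F. finite F \<and> F \<subseteq> carrier G \<and> (\<forall>z\<in>carrier G. \<exists>r\<in>F. \<exists>h\<in>carrier G.
      z = h \<otimes> r \<and> (\<forall>i<n. concat (es[i := h \<otimes> es ! i]) \<in> D)))"
proof -
  define star where "star = extend_set M N (n * m)"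
  obtain A H R \<Phi> where A: "universe M \<subseteq> A" and cq: "compact_quotient \<kappa> N G' m A H R \<Gamma>' \<Phi>"
    using ex_compact_quotient[OF M ssat dom] by blast
  interpret cq: compact_quotient \<kappa> N G' m A H R \<Gamma>' \<Phi> by (rule cq)
  interpret group G by (rule group_G)
  have car: "carrier G' = C'" by (simp add: extend_group_def)
  have star: "codef M N (universe M) (n * m) (\<lambda>xs. xs \<in> D) (\<lambda>xs. xs \<in> star D)" if "D \<in> \<D>" for D
    unfolding star_def by (rule codef_extend_set(1)[OF ext def[OF that]])
  have in_tuples: "length (concat es) = n * m" "concat es \<in> tuples M' (n * m)"
    "i < n \<Longrightarrow> block m i (concat es) = es ! i"
    if "length es = n" "set es \<subseteq> tuples M' m" for es i n and M' :: "('f, 'r, 'a) fo_structure"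
  proof -
    have l: "length x = m \<and> set x \<subseteq> universe M'" if "x \<in> set es" for x
      using that \<open>set es \<subseteq> tuples M' m\<close> by (auto simp: tuples_def)
    then show "length (concat es) = n * m" using length_concat_const[of es m] that(1) by simp
    then show "concat es \<in> tuples M' (n * m)" using l by (auto simp: tuples_def)
    show "block m i (concat es) = es ! i" if "i < n" using block_concat[of es m i] l that \<open>length es = n\<close> by simp
  qed
  have blocks: "length (map (\<lambda>i. block m i xs) [0..<n]) = n" "concat (map (\<lambda>i. block m i xs) [0..<n]) = xs"
    "set (map (\<lambda>i. block m i xs) [0..<n]) \<subseteq> C \<longleftrightarrow> (\<forall>i<n. block m i xs \<in> C)"
    if "xs \<in> tuples M' (n * m)" for xs C n and M' :: "('f, 'r, 'a) fo_structure"
    using that concat_blocks[of xs n m] by (auto simp: tuples_def)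
  have cover': "\<exists>D\<in>star ` \<D>. concat es \<in> D" if es: "length es = n" "set es \<subseteq> carrier G'" for es
  proof -
    \<comment> \<open>The list is quantified over as one tuple of length \<open>n * m\<close>, and
      its members are recovered as blocks.\<close>
    have "codef M N (universe M) 0
      (\<lambda>_. \<forall>x\<in>tuples M (n * m). (\<forall>i<n. block m i x \<in> carrier G) \<longrightarrow> (\<exists>D\<in>\<D>. x \<in> D))
      (\<lambda>_. \<forall>x\<in>tuples N (n * m). (\<forall>i<n. block m i x \<in> C') \<longrightarrow> (\<exists>D\<in>\<D>. x \<in> star D))"
      by (intro codef_all codef_imp codef_all_less codef_carrier codef_bex[OF fin]
          codef_mem[OF star _ universes] proj_block[where n=n] proj_take_left)
    note trans = codef_transfer_0[OF ext this]
    have "\<forall>x\<in>tuples N (n * m). (\<forall>i<n. block m i x \<in> C') \<longrightarrow> (\<exists>D\<in>\<D>. x \<in> star D)"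
    proof (rule iffD1[OF trans], intro ballI impI)
      fix x assume x: "x \<in> tuples M (n * m)" "\<forall>i<n. block m i x \<in> carrier G"
      then show "\<exists>D\<in>\<D>. x \<in> D" using cover blocks[OF x(1)] by metis
    qed
    moreover have esN: "set es \<subseteq> tuples N m" using es(2) carrier_tuples(2) unfolding car by blast
    moreover have "block m i (concat es) \<in> C'" if "i < n" for i
      using in_tuples(3)[OF es(1) esN that] es nth_mem[of i es] that unfolding car by auto
    ultimately show ?thesis using in_tuples(2)[OF es(1) esN] by auto
  qed
  have "codef N N A (n * m) (\<lambda>xs. xs \<in> D) (\<lambda>xs. xs \<in> D)" if "D \<in> star ` \<D>" for D
    using that star codef_mono[OF codef_right[OF ext] A] by auto
  from cq.generic_slices[OF _ this cover'] fin
  obtain D es F where D: "D \<in> \<D>" and es: "length es = n" "set es \<subseteq> C'" "concat es \<in> star D"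
    and F: "finite F" "F \<subseteq> C'"
    and gen: "\<And>z. z \<in> C' \<Longrightarrow> \<exists>r\<in>F. \<exists>h\<in>C'. z = h \<otimes>\<^bsub>G'\<^esub> r \<and>
      (\<forall>i<n. concat (es[i := h \<otimes>\<^bsub>G'\<^esub> es ! i]) \<in> star D)"
    unfolding car by auto
  obtain fs where fs: "set fs = F" using finite_list[OF F(1)] by blast
  \<comment> \<open>The number of translates is fixed outside the sentence; the translates
    themselves are coded by one tuple of length \<open>t * m\<close>.\<close>
  define t where "t = length fs"
  \<comment> \<open>Group, graph, member of the cover and set of tuples are arguments, so that the
    versions for \<open>M\<close> and \<open>N\<close> are two instances. The list update is spelled
    out entry by entry, to match \<open>proj_concat_const\<close>.\<close>
  define P where "P G \<Gamma> D T e f \<longleftrightarrow> (\<forall>i<n. block m i e \<in> G) \<and> e \<in> D \<and> (\<forall>s<t. block m s f \<in> G) \<and>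
    (\<forall>z\<in>T. z \<in> G \<longrightarrow> (\<exists>s<t. \<exists>h\<in>T. h \<in> G \<and> h @ block m s f @ z \<in> \<Gamma> \<and>
      (\<forall>i<n. \<exists>g\<in>T. h @ block m i e @ g \<in> \<Gamma> \<and>
        concat (map (\<lambda>j. if j = i then g else block m j e) [0..<n]) \<in> D)))"
    for G \<Gamma> D :: "'a list set" and T e f
  have if_proj: "proj (universe M) k m (\<lambda>xs. if b then p xs else q xs)"
    if "proj (universe M) k m p" "proj (universe M) k m q" for b k and p q :: "'a list \<Rightarrow> 'a list"
    using that by (cases b) auto
  have "codef M N (universe M) 0
     (\<lambda>_. \<exists>e\<in>tuples M (n * m). \<exists>f\<in>tuples M (t * m). P (carrier G) \<Gamma> D (tuples M m) e f)
     (\<lambda>_. \<exists>e\<in>tuples N (n * m). \<exists>f\<in>tuples N (t * m). P C' \<Gamma>' (star D) (tuples N m) e f)"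
    unfolding P_def
    by (intro codef_ex[where l="n * m"] codef_ex[where l="t * m"] codef_ex[where l=m] codef_all codef_imp
        codef_conj codef_all_less codef_ex_less codef_carrier codef_graph
        codef_mem[OF star[OF D] _ universes] proj_concat_const if_proj proj_append
        proj_block[where n=n] proj_block[where n=t] proj_take_left proj_comp_drop)
  note trans = codef_transfer_0[OF ext this]
  have esN: "set es \<subseteq> tuples N m" and fsN: "set fs \<subseteq> tuples N m" using es(2) F(2) carrier_tuples(2) fs by auto
  have update: "es[i := g] = map (\<lambda>j. if j = i then g else es ! j) [0..<n]" if "length es = n"
    for es :: "'a list list" and i g
    using that by (auto simp: list_eq_iff_nth_eq nth_list_update)
  have be: "block m i (concat es) = es ! i" "es ! i \<in> C'" if "i < n" for i
    using in_tuples(3)[OF es(1) esN that] es nth_mem[of i es] that by auto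
  have bf: "block m s (concat fs) = fs ! s" "fs ! s \<in> C'" if "s < t" for s
    using in_tuples(3)[OF t_def[symmetric] fsN that] fs F(2) nth_mem[of s fs] that by (auto simp: t_def)
  have upd: "concat (map (\<lambda>j. if j = i then g else block m j (concat es)) [0..<n]) = concat (es[i := g])"
    for i g unfolding update[OF es(1)] by (intro arg_cong[where f=concat] map_cong) (auto simp: be)
  have C'N: "x \<in> C' \<Longrightarrow> x \<in> tuples N m" for x using carrier_tuples(2) by blast
  have closed: "x \<otimes>\<^bsub>G'\<^esub> y \<in> C'" if "x \<in> C'" "y \<in> C'" for x y
    using cq.m_closed that unfolding car by blast
  have "P C' \<Gamma>' (star D) (tuples N m) (concat es) (concat fs)"
    unfolding P_def
  proof (intro conjI allI ballI impI)
    fix z assume z: "z \<in> C'"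
    obtain r h where r: "r \<in> F" "h \<in> C'" "z = h \<otimes>\<^bsub>G'\<^esub> r"
      "\<forall>i<n. concat (es[i := h \<otimes>\<^bsub>G'\<^esub> es ! i]) \<in> star D" using gen[OF z] by blast
    obtain s where s: "s < t" "r = fs ! s" using r(1) fs by (auto simp: in_set_conv_nth t_def)
    have "h @ fs ! s @ z \<in> \<Gamma>'" using graph'_iff r s bf by auto
    moreover have "\<exists>g\<in>tuples N m. h @ block m i (concat es) @ g \<in> \<Gamma>' \<and>
        concat (map (\<lambda>j. if j = i then g else block m j (concat es)) [0..<n]) \<in> star D" if "i < n" for i
      unfolding upd be(1)[OF that]
      by (intro bexI[of _ "h \<otimes>\<^bsub>G'\<^esub> es ! i"] conjI)
        (use graph'_iff r be[OF that] that C'N closed in auto)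
    ultimately show "\<exists>s<t. \<exists>h\<in>tuples N m. h \<in> C' \<and> h @ block m s (concat fs) @ z \<in> \<Gamma>' \<and>
      (\<forall>i<n. \<exists>g\<in>tuples N m. h @ block m i (concat es) @ g \<in> \<Gamma>' \<and>
        concat (map (\<lambda>j. if j = i then g else block m j (concat es)) [0..<n]) \<in> star D)"
      using s(1) bf(1) r(2) C'N by (intro exI[of _ s] conjI bexI[of _ h]) auto
  qed (use be bf es(3) in auto)
  then have "\<exists>e\<in>tuples N (n * m). \<exists>f\<in>tuples N (t * m). P C' \<Gamma>' (star D) (tuples N m) e f"
    using in_tuples(2)[OF es(1) esN] in_tuples(2)[OF t_def[symmetric] fsN] by blast
  then have "\<exists>e\<in>tuples M (n * m). \<exists>f\<in>tuples M (t * m). P (carrier G) \<Gamma> D (tuples M m) e f"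
    by (rule iffD2[OF trans])
  then obtain e f where e: "e \<in> tuples M (n * m)" and "P (carrier G) \<Gamma> D (tuples M m) e f" by blast
  then have P: "\<And>i. i < n \<Longrightarrow> block m i e \<in> carrier G" "\<And>s. s < t \<Longrightarrow> block m s f \<in> carrier G" "e \<in> D"
    and P4: "\<forall>z\<in>tuples M m. z \<in> carrier G \<longrightarrow> (\<exists>s<t. \<exists>h\<in>tuples M m. h \<in> carrier G \<and> h @ block m s f @ z \<in> \<Gamma> \<and>
      (\<forall>i<n. \<exists>g\<in>tuples M m. h @ block m i e @ g \<in> \<Gamma> \<and>
        concat (map (\<lambda>j. if j = i then g else block m j e) [0..<n]) \<in> D))"
    unfolding P_def by simp_all
  \<comment> \<open>These are blocks of the new witnesses in \<open>M\<close>, not the lists found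
    in \<open>N\<close>.\<close>
  let ?es = "map (\<lambda>i. block m i e) [0..<n]" and ?F = "(\<lambda>s. block m s f) ` {..<t}"
  have upd: "concat (map (\<lambda>j. if j = i then g else block m j e) [0..<n]) = concat (?es[i := g])" for i g
    using update[of ?es i g] by (intro arg_cong[where f=concat]) auto
  have GM: "x \<in> carrier G \<Longrightarrow> x \<in> tuples M m" for x using carrier_tuples(1) by blast
  have "\<exists>r\<in>?F. \<exists>h\<in>carrier G. z = h \<otimes> r \<and> (\<forall>i<n. concat (?es[i := h \<otimes> ?es ! i]) \<in> D)"
    if z: "z \<in> carrier G" for z
  proof -
    obtain s h where s: "s < t" "h \<in> carrier G" "h @ block m s f @ z \<in> \<Gamma>"
      and h: "\<And>i. i < n \<Longrightarrow> \<exists>g\<in>tuples M m. h @ block m i e @ g \<in> \<Gamma> \<and>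
        concat (map (\<lambda>j. if j = i then g else block m j e) [0..<n]) \<in> D"
      using P4[rule_format, OF GM[OF z] z] by auto
    have "z = h \<otimes> block m s f" using graph_iff[of h "block m s f" z] s P(2) z GM by auto
    moreover have "concat (?es[i := h \<otimes> ?es ! i]) \<in> D" if i: "i < n" for i
    proof -
      obtain g where g: "g \<in> tuples M m" "h @ block m i e @ g \<in> \<Gamma>" "concat (?es[i := g]) \<in> D"
        using h[OF i] unfolding upd by blast
      then have "g = h \<otimes> block m i e" using graph_iff[of h "block m i e" g] GM s(2) P(1) i by auto
      then show ?thesis using g(3) i by simp
    qed
    ultimately show ?thesis using s(1,2) by blast
  qed
  moreover have "?F \<subseteq> carrier G" "set ?es \<subseteq> carrier G" "concat ?es \<in> D"
    using P blocks(2)[OF e] by auto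
  ultimately show ?thesis
    using D blocks(1)[OF e] by (intro bexI[of _ D] exI[of _ ?es] exI[of _ ?F] conjI) auto
qed

section \<open>Internal sets\<close>

lemma tprod_iff:
  assumes "\<And>i. i < n \<Longrightarrow> U i \<subseteq> {u. length u = l i}"
  shows "xs \<in> tprod n U \<longleftrightarrow> length xs = (\<Sum>i<n. l i) \<and> (\<forall>i<n. part l i xs \<in> U i)"
proof
  assume "xs \<in> tprod n U"
  then obtain x where x: "xs = concat (map x [0..<n])" "\<forall>i<n. x i \<in> U i" by (auto simp: tprod_def)
  then have "\<And>i. i < n \<Longrightarrow> length (x i) = l i" using assms by blast
  then show "length xs = (\<Sum>i<n. l i) \<and> (\<forall>i<n. part l i xs \<in> U i)"
    using x length_concat_map[of n x l] part_concat[of n x l] by simp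
next
  assume *: "length xs = (\<Sum>i<n. l i) \<and> (\<forall>i<n. part l i xs \<in> U i)"
  then show "xs \<in> tprod n U"
    unfolding tprod_def using concat_parts[of xs l n] by (auto intro!: exI[of _ "\<lambda>i. part l i xs"])
qed

lemma tpower_iff:
  assumes "V \<subseteq> tuples M d"
  shows "xs \<in> tpower V k \<longleftrightarrow> xs \<in> tuples M (k * d) \<and> (\<forall>i<k. block d i xs \<in> V)"
proof -
  have iff: "xs \<in> tpower V k \<longleftrightarrow> length xs = k * d \<and> (\<forall>i<k. block d i xs \<in> V)"
    unfolding tpower_def using tprod_iff[of k "\<lambda>_. V" "\<lambda>_. d" xs] assms
    by (auto simp: part_const tuples_def)
  moreover have "set xs \<subseteq> universe M" if *: "length xs = k * d" "\<forall>i<k. block d i xs \<in> V"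
  proof -
    have "set xs = (\<Union>i\<in>{0..<k}. set (block d i xs))"
      using arg_cong[OF concat_blocks[OF *(1)], of set] by auto
    then show ?thesis using * assms by (fastforce simp: tuples_def)
  qed
  ultimately show ?thesis by (auto simp: tuples_def)
qed

lemma tpower_tuples: "V \<subseteq> tuples M d \<Longrightarrow> tpower V k \<subseteq> tuples M (k * d)"
  using tpower_iff by blast

lemma tpower_0 [simp]: "tpower V 0 = {[]}"
  by (auto simp: tpower_def tprod_def)

lemma tpower_1 [simp]: "tpower V (Suc 0) = V"
  by (auto simp: tpower_def tprod_def)

lemma tpower_add: "tpower V (p + q) = {u @ v | u v. u \<in> tpower V p \<and> v \<in> tpower V q}"
proof -
  have split: "concat (map x [0..<p + q]) = concat (map x [0..<p]) @ concat (map (\<lambda>i. x (p + i)) [0..<q])"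
    for x :: "nat \<Rightarrow> 'a list" by (induction q) auto
  show ?thesis
  proof (intro equalityI subsetI)
    fix w assume "w \<in> tpower V (p + q)"
    then obtain x where x: "w = concat (map x [0..<p + q])" "\<forall>i<p + q. x i \<in> V"
      by (auto simp: tpower_def tprod_def)
    have "concat (map x [0..<p]) \<in> tpower V p" "concat (map (\<lambda>i. x (p + i)) [0..<q]) \<in> tpower V q"
      unfolding tpower_def tprod_def using x(2) by auto
    then show "w \<in> {u @ v | u v. u \<in> tpower V p \<and> v \<in> tpower V q}" using split x(1) by auto
  next
    fix w assume "w \<in> {u @ v | u v. u \<in> tpower V p \<and> v \<in> tpower V q}"
    then obtain x y where *: "w = concat (map x [0..<p]) @ concat (map y [0..<q])"
      "\<forall>i<p. x i \<in> V" "\<forall>i<q. y i \<in> V" by (auto simp: tpower_def tprod_def)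
    let ?z = "\<lambda>i. if i < p then x i else y (i - p)"
    have "w = concat (map ?z [0..<p + q])" unfolding split *(1) by (intro arg_cong2[where f=append] arg_cong[where f=concat] map_cong) auto
    then show "w \<in> tpower V (p + q)" unfolding tpower_def tprod_def using *(2,3) by (auto intro!: exI[of _ ?z])
  qed
qed

lemma definable_tpower:
  assumes "definable M d V"
  shows "definable M (k * d) (tpower V k)"
proof -
  have V: "V \<subseteq> tuples M d" "codef M M (universe M) d (\<lambda>xs. xs \<in> V) (\<lambda>xs. xs \<in> V)"
    using assms by (auto simp: definable_iff_codef)
  have "codef M M (universe M) (k * d) (\<lambda>xs. \<forall>i<k. block d i xs \<in> V) (\<lambda>xs. \<forall>i<k. block d i xs \<in> V)"
    by (intro codef_all_less codef_mem[OF V(2)] proj_block[where n=k] proj_id) auto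
  from definable_Collect[OF this] show ?thesis
    by (rule back_subst) (use tpower_iff[OF V(1)] in auto)
qed

lemma internalI:
  assumes "\<And>v. v \<in> tpower V k \<Longrightarrow> f v \<in> A" "\<And>a. a \<in> A \<Longrightarrow> \<exists>v\<in>tpower V k. f v = a"
    and "definable M (k * d + e) {v @ f v | v. v \<in> tpower V k}"
  shows "internal M e A d V"
  unfolding internal_def using assms by (intro exI[of _ k] exI[of _ f]) auto

text \<open>The graph is released as a relation \<open>S\<close>. Its membership rule depends on the
  length of \<open>v\<close> being known, as concatenation alone does not tell where
  \<open>v\<close> ends.\<close>

lemma internalE:
  assumes "internal M e A d V" "V \<subseteq> tuples M d" "A \<subseteq> tuples M e"
  obtains k f S where "\<forall>v\<in>tpower V k. f v \<in> A" "\<forall>a\<in>A. \<exists>v\<in>tpower V k. f v = a"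
    and "codef M M (universe M) (k * d + e) (\<lambda>xs. xs \<in> S) (\<lambda>xs. xs \<in> S)"
    and "\<forall>v\<in>tuples M (k * d). \<forall>y. v @ y \<in> S \<longleftrightarrow> v \<in> tpower V k \<and> y = f v"
proof -
  obtain k f where kf: "f ` tpower V k = A" "definable M (k * d + e) {v @ f v | v. v \<in> tpower V k}"
    using assms(1) unfolding internal_def by blast
  show ?thesis
  proof (rule that[of k f "{v @ f v | v. v \<in> tpower V k}"])
    have "length u = k * d" if "u \<in> tpower V k" for u
      using that tpower_tuples[OF assms(2), of k] by (auto simp: tuples_def)
    then show "\<forall>v\<in>tuples M (k * d). \<forall>y. v @ y \<in> {v @ f v | v. v \<in> tpower V k} \<longleftrightarrow>
        v \<in> tpower V k \<and> y = f v"
      by (auto simp: tuples_def)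
  qed (use kf in \<open>auto simp: definable_iff_codef\<close>)
qed

text \<open>\<open>A\<close> is the projection of the graph of the surjection.\<close>

lemma internal_imp_definable:
  assumes "internal M e A d V" "V \<subseteq> tuples M d" "A \<subseteq> tuples M e"
  shows "definable M e A"
  using assms
proof (rule internalE)
  fix k f S
  assume f: "\<forall>v\<in>tpower V k. f v \<in> A" "\<forall>a\<in>A. \<exists>v\<in>tpower V k. f v = a"
    and S: "codef M M (universe M) (k * d + e) (\<lambda>xs. xs \<in> S) (\<lambda>xs. xs \<in> S)"
      "\<forall>v\<in>tuples M (k * d). \<forall>y. v @ y \<in> S \<longleftrightarrow> v \<in> tpower V k \<and> y = f v"
  have "codef M M (universe M) e (\<lambda>y. \<exists>v\<in>tuples M (k * d). v @ y \<in> S) (\<lambda>y. \<exists>v\<in>tuples M (k * d). v @ y \<in> S)"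
    by (rule codef_ex) (use S(1) in simp)
  from definable_Collect[OF this] show "definable M e A"
  proof (rule back_subst, intro equalityI subsetI)
    fix y assume "y \<in> {y \<in> tuples M e. \<exists>v\<in>tuples M (k * d). v @ y \<in> S}"
    then obtain v where "v \<in> tuples M (k * d)" "v @ y \<in> S" by blast
    then show "y \<in> A" using S(2) f(1) by auto
  next
    fix y assume y: "y \<in> A"
    then obtain v where v: "v \<in> tpower V k" "f v = y" using f(2) by blast
    then have "v \<in> tuples M (k * d)" using tpower_tuples[OF assms(2)] by blast
    moreover from this have "v @ y \<in> S" using S(2) v by auto
    moreover have "y \<in> tuples M e" using y assms(3) by blast
    ultimately show "y \<in> {y \<in> tuples M e. \<exists>v\<in>tuples M (k * d). v @ y \<in> S}" by blast
  qed
qed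

text \<open>One extra coordinate in \<open>V\<close> chooses between the two surjections: the value
  \<open>a\<close> selects \<open>f\<close>, any other value selects \<open>g\<close>. Two distinct
  elements let both choices occur.\<close>

lemma internal_Un:
  assumes A: "internal M e A d V" "A \<subseteq> tuples M e" and B: "internal M e B d V" "B \<subseteq> tuples M e"
    and V: "definable M d V" and ab: "a \<in> V" "b \<in> V" "a \<noteq> b"
  shows "internal M e (A \<union> B) d V"
proof -
  have Vt: "V \<subseteq> tuples M d" and Vd: "codef M M (universe M) d (\<lambda>xs. xs \<in> V) (\<lambda>xs. xs \<in> V)"
    using V by (auto simp: definable_iff_codef)
  obtain p f S where f: "\<forall>v\<in>tpower V p. f v \<in> A" "\<forall>a\<in>A. \<exists>v\<in>tpower V p. f v = a"
    and S: "codef M M (universe M) (p * d + e) (\<lambda>xs. xs \<in> S) (\<lambda>xs. xs \<in> S)"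
      "\<forall>v\<in>tuples M (p * d). \<forall>y. v @ y \<in> S \<longleftrightarrow> v \<in> tpower V p \<and> y = f v"
    by (rule internalE[OF A(1) Vt A(2)])
  obtain q g T where g: "\<forall>v\<in>tpower V q. g v \<in> B" "\<forall>a\<in>B. \<exists>v\<in>tpower V q. g v = a"
    and T: "codef M M (universe M) (q * d + e) (\<lambda>xs. xs \<in> T) (\<lambda>xs. xs \<in> T)"
      "\<forall>v\<in>tuples M (q * d). \<forall>y. v @ y \<in> T \<longleftrightarrow> v \<in> tpower V q \<and> y = g v"
    by (rule internalE[OF B(1) Vt B(2)])
  define h where "h w = (if take d w = a then f (take (p * d) (drop d w)) else g (drop (p * d) (drop d w)))" for w
  have pow: "tpower V (Suc (p + q)) = {c @ u @ v | c u v. c \<in> V \<and> u \<in> tpower V p \<and> v \<in> tpower V q}"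
    using tpower_add[of V "Suc 0" "p + q"] tpower_add[of V p q] by fastforce
  have powI: "c @ u @ v \<in> tpower V (Suc (p + q))"
    if "c \<in> V" "u \<in> tpower V p" "v \<in> tpower V q" for c u v
    unfolding pow using that by blast
  have len: "length c = d" "length u = p * d" if "c \<in> V" "u \<in> tpower V p" for c u
    using that Vt tpower_tuples[OF Vt, of p] by (auto simp: tuples_def)
  have h: "h (c @ u @ v) = (if c = a then f u else g v)" if "c \<in> V" "u \<in> tpower V p" for c u v
  proof -
    have "take d (c @ u @ v) = c" "take (p * d) (drop d (c @ u @ v)) = u" "drop (p * d) (drop d (c @ u @ v)) = v"
      using len[OF that] by simp_all
    then show ?thesis by (simp only: h_def)
  qed
  show ?thesis
  proof (rule internalI[where k="Suc (p + q)" and f=h])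
    show "h w \<in> A \<union> B" if "w \<in> tpower V (Suc (p + q))" for w
      using that f(1) g(1) unfolding pow by (auto simp: h)
    \<comment> \<open>Copies of \<open>a\<close> fill the block that the chosen surjection
      ignores.\<close>
    define c where "c k = concat (map (\<lambda>_. a) [0..<k])" for k :: nat
    have c: "c k \<in> tpower V k" for k unfolding c_def tpower_def tprod_def using ab(1) by blast
    show "\<exists>w\<in>tpower V (Suc (p + q)). h w = y" if "y \<in> A \<union> B" for y
    proof (cases "y \<in> A")
      case True
      then obtain u where "u \<in> tpower V p" "f u = y" using f(2) by blast
      then have "h (a @ u @ c q) = y" "a @ u @ c q \<in> tpower V (Suc (p + q))"
        using h[OF ab(1)] powI[OF ab(1) _ c] by auto
      then show ?thesis by (rule bexI)
    next
      case False
      then have "y \<in> B" using that by simp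
      then obtain v where "v \<in> tpower V q" "g v = y" using g(2) by blast
      then have "h (b @ c p @ v) = y" "b @ c p @ v \<in> tpower V (Suc (p + q))"
        using h[OF ab(2) c] ab(3) powI[OF ab(2) c] by auto
      then show ?thesis by (rule bexI)
    qed
    \<comment> \<open>The graph of \<open>h\<close> as a formula: the pieces of the tuple are
      quantified, and the first of them decides between the relations \<open>S\<close> and
      \<open>T\<close>.\<close>
    define Q where "Q xs c u v y \<longleftrightarrow> xs = c @ u @ v @ y \<and> c \<in> V \<and> u \<in> tpower V p \<and> v \<in> tpower V q \<and>
      ((c = a \<and> u @ y \<in> S) \<or> (c \<noteq> a \<and> v @ y \<in> T))" for xs c u v y
    have pd: "codef M M (universe M) (k * d) (\<lambda>xs. xs \<in> tpower V k) (\<lambda>xs. xs \<in> tpower V k)" for k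
      using definable_tpower[OF V] by (simp add: definable_iff_codef)
    have "codef M M (universe M) (d + (p * d + (q * d + e)))
      (\<lambda>xs. \<exists>c\<in>tuples M d. \<exists>u\<in>tuples M (p * d). \<exists>v\<in>tuples M (q * d). \<exists>y\<in>tuples M e. Q xs c u v y)
      (\<lambda>xs. \<exists>c\<in>tuples M d. \<exists>u\<in>tuples M (p * d). \<exists>v\<in>tuples M (q * d). \<exists>y\<in>tuples M e. Q xs c u v y)"
      unfolding Q_def
      by (intro codef_ex codef_conj codef_disj codef_not codef_mem[OF S(1)] codef_mem[OF T(1)]
          codef_mem[OF Vd] codef_mem[OF pd] codef_eq[where l=d] codef_eq[where l="d + (p * d + (q * d + e))"]
          proj_append proj_take_left proj_comp_drop proj_id proj_const)
        (use ab(1) Vt in \<open>auto simp: tuples_def\<close>)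
    moreover have "d + (p * d + (q * d + e)) = Suc (p + q) * d + e" by (simp add: algebra_simps)
    ultimately have "definable M (Suc (p + q) * d + e) {xs \<in> tuples M (Suc (p + q) * d + e).
      \<exists>c\<in>tuples M d. \<exists>u\<in>tuples M (p * d). \<exists>v\<in>tuples M (q * d). \<exists>y\<in>tuples M e. Q xs c u v y}"
      by (simp only: definable_Collect)
    also have "{xs \<in> tuples M (Suc (p + q) * d + e).
      \<exists>c\<in>tuples M d. \<exists>u\<in>tuples M (p * d). \<exists>v\<in>tuples M (q * d). \<exists>y\<in>tuples M e. Q xs c u v y} =
      {w @ h w | w. w \<in> tpower V (Suc (p + q))}"
    proof (intro equalityI subsetI)
      fix xs assume "xs \<in> {xs \<in> tuples M (Suc (p + q) * d + e).
      \<exists>c\<in>tuples M d. \<exists>u\<in>tuples M (p * d). \<exists>v\<in>tuples M (q * d). \<exists>y\<in>tuples M e. Q xs c u v y}"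
      then obtain c u v y where *: "u \<in> tuples M (p * d)" "v \<in> tuples M (q * d)" "Q xs c u v y" by blast
      then have "y = h (c @ u @ v)" using S(2) T(2) h unfolding Q_def by auto
      then have "xs = (c @ u @ v) @ h (c @ u @ v)" "c @ u @ v \<in> tpower V (Suc (p + q))"
        using *(3) powI[of c u v] unfolding Q_def by auto
      then show "xs \<in> {w @ h w | w. w \<in> tpower V (Suc (p + q))}" by (auto intro!: exI[of _ "c @ u @ v"])
    next
      fix xs assume "xs \<in> {w @ h w | w. w \<in> tpower V (Suc (p + q))}"
      then obtain c u v where *: "c \<in> V" "u \<in> tpower V p" "v \<in> tpower V q"
        "xs = c @ u @ v @ h (c @ u @ v)" unfolding pow by auto
      have t: "c \<in> tuples M d" "u \<in> tuples M (p * d)" "v \<in> tuples M (q * d)" "h (c @ u @ v) \<in> tuples M e"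
        using * Vt tpower_tuples[OF Vt] f(1) g(1) A(2) B(2) by (auto simp: h)
      moreover have "Q xs c u v (h (c @ u @ v))" using * S(2) T(2) t unfolding Q_def by (auto simp: h)
      moreover have "xs \<in> tuples M (Suc (p + q) * d + e)"
        using t *(4) by (auto simp: tuples_def algebra_simps)
      ultimately show "xs \<in> {xs \<in> tuples M (Suc (p + q) * d + e).
      \<exists>c\<in>tuples M d. \<exists>u\<in>tuples M (p * d). \<exists>v\<in>tuples M (q * d). \<exists>y\<in>tuples M e. Q xs c u v y}" by blast
    qed
    finally show "definable M (Suc (p + q) * d + e) {w @ h w | w. w \<in> tpower V (Suc (p + q))}" .
  qed
qed

section \<open>Groups in a product of sorts\<close>

lemma finprod_lessThan_Suc:
  assumes "comm_group G" "\<And>j. j \<le> k \<Longrightarrow> g j \<in> carrier G"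
  shows "finprod G g {..<Suc k} = finprod G g {..<k} \<otimes>\<^bsub>G\<^esub> g k"
proof -
  interpret comm_group G by fact
  have "finprod G g {..<Suc k} = g k \<otimes>\<^bsub>G\<^esub> finprod G g {..<k}"
    unfolding lessThan_Suc using assms(2) by (intro finprod_insert) auto
  then show ?thesis using assms(2) by (simp add: m_comm finprod_closed)
qed

text \<open>Commutativity in use: the effect on the product does not depend on which factor is
  moved.\<close>

lemma finprod_update:
  assumes "comm_group G" "\<And>j. j < n \<Longrightarrow> g j \<in> carrier G" "i < (n::nat)" "h \<in> carrier G"
  shows "finprod G (g(i := h \<otimes>\<^bsub>G\<^esub> g i)) {..<n} = h \<otimes>\<^bsub>G\<^esub> finprod G g {..<n}"
proof -
  interpret comm_group G by fact
  have eq: "{..<n} = insert i ({..<n} - {i})" using assms(3) by auto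
  have "finprod G g' {..<n} = g' i \<otimes>\<^bsub>G\<^esub> finprod G g' ({..<n} - {i})" if "\<And>j. j < n \<Longrightarrow> g' j \<in> carrier G" for g'
    by (subst eq, rule finprod_insert) (use that assms(3) in auto)
  note split = this
  have "finprod G (g(i := h \<otimes>\<^bsub>G\<^esub> g i)) ({..<n} - {i}) = finprod G g ({..<n} - {i})"
    using assms(2) by (intro finprod_cong') auto
  moreover have "finprod G g ({..<n} - {i}) \<in> carrier G" using assms(2) by (intro finprod_closed) auto
  ultimately show ?thesis
    using split[of "g(i := h \<otimes>\<^bsub>G\<^esub> g i)"] split[of g] assms by (simp add: m_assoc)
qed

locale sorted_group = comm_group G for G :: "'a list monoid" (structure) +
  fixes M :: "('f, 'r, 'a) fo_structure" and n :: nat and d :: "nat \<Rightarrow> nat" and X :: "nat \<Rightarrow> 'a list set"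
    and m :: nat
  assumes m: "m = (\<Sum>i<n. d i)"
    and def_group: "definable_group M m G"
    and X: "\<And>i. i < n \<Longrightarrow> definable M (d i) (X i)"
    and sub: "carrier G \<subseteq> tprod n X"
begin

lemma carrier_tuples: "x \<in> carrier G \<Longrightarrow> x \<in> tuples M m"
  and def_carrier: "codef M M (universe M) m (\<lambda>xs. xs \<in> carrier G) (\<lambda>xs. xs \<in> carrier G)"
  and def_graph: "codef M M (universe M) (m + (m + m)) (\<lambda>xs. xs \<in> mult_graph G) (\<lambda>xs. xs \<in> mult_graph G)"
  using def_group by (auto simp: definable_group_def definable_iff_codef add.assoc)

lemmas codef_carrier = codef_mem[OF def_carrier _ subset_refl subset_refl]
lemmas codef_graph = codef_mem[OF def_graph _ subset_refl subset_refl]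

lemma X_tuples: "i < n \<Longrightarrow> X i \<subseteq> tuples M (d i)"
  and def_X: "i < n \<Longrightarrow> codef M M (universe M) (d i) (\<lambda>xs. xs \<in> X i) (\<lambda>xs. xs \<in> X i)"
  using X by (auto simp: definable_iff_codef)

lemma length_carrier: "x \<in> carrier G \<Longrightarrow> length x = m" "x \<in> carrier G \<Longrightarrow> set x \<subseteq> universe M"
  using carrier_tuples by (auto simp: tuples_def)

lemma part_carrier: "x \<in> carrier G \<Longrightarrow> i < n \<Longrightarrow> part d i x \<in> X i"
proof -
  assume *: "x \<in> carrier G" "i < n"
  have "X i \<subseteq> {u. length u = d i}" if "i < n" for i using X_tuples[OF that] by (auto simp: tuples_def)
  from tprod_iff[of n X d, OF this, of x] show "part d i x \<in> X i" using * sub by blast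
qed

lemma graph_iff:
  assumes "length x = m" "length y = m"
  shows "x @ y @ z \<in> mult_graph G \<longleftrightarrow> x \<in> carrier G \<and> y \<in> carrier G \<and> z = x \<otimes> y"
proof
  assume "x @ y @ z \<in> mult_graph G"
  then obtain x' y' where *: "x @ y @ z = x' @ y' @ (x' \<otimes> y')" "x' \<in> carrier G" "y' \<in> carrier G"
    by (auto simp: mult_graph_def)
  then have "length x' = length x" "length y' = length y"
    using length_carrier assms by auto
  then show "x \<in> carrier G \<and> y \<in> carrier G \<and> z = x \<otimes> y" using * by auto
qed (auto simp: mult_graph_def)

text \<open>The surjection is composed with the translation, which is definable with parameter
  \<open>g\<close>.\<close>

lemma internal_translate:
  assumes i: "i < n" and A: "internal M m A (d i) (X i)" "A \<subseteq> carrier G" and g: "g \<in> carrier G"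
  shows "internal M m ((\<lambda>x. x \<otimes> g) ` A) (d i) (X i)"
proof -
  have At: "A \<subseteq> tuples M m" using A(2) carrier_tuples by blast
  obtain k f S where f: "\<forall>v\<in>tpower (X i) k. f v \<in> A" "\<forall>a\<in>A. \<exists>v\<in>tpower (X i) k. f v = a"
    and S: "codef M M (universe M) (k * d i + m) (\<lambda>xs. xs \<in> S) (\<lambda>xs. xs \<in> S)"
      "\<forall>v\<in>tuples M (k * d i). \<forall>y. v @ y \<in> S \<longleftrightarrow> v \<in> tpower (X i) k \<and> y = f v"
    by (rule internalE[OF A(1) X_tuples[OF i] At])
  define Q where "Q xs u z y \<longleftrightarrow> xs = u @ z \<and> u @ y \<in> S \<and> y @ g @ z \<in> mult_graph G" for xs u z y
  show ?thesis
  proof (rule internalI)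
    show "f v \<otimes> g \<in> (\<lambda>x. x \<otimes> g) ` A" if "v \<in> tpower (X i) k" for v using f(1) that by blast
    show "\<exists>v\<in>tpower (X i) k. f v \<otimes> g = y" if y: "y \<in> (\<lambda>x. x \<otimes> g) ` A" for y
    proof -
      obtain a where a: "a \<in> A" "y = a \<otimes> g" using y by blast
      obtain v where "v \<in> tpower (X i) k" "f v = a" using f(2) a(1) by blast
      then show ?thesis using a(2) by auto
    qed
    have "codef M M (universe M) (k * d i + m)
      (\<lambda>xs. \<exists>u\<in>tuples M (k * d i). \<exists>z\<in>tuples M m. \<exists>y\<in>tuples M m. Q xs u z y)
      (\<lambda>xs. \<exists>u\<in>tuples M (k * d i). \<exists>z\<in>tuples M m. \<exists>y\<in>tuples M m. Q xs u z y)"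
      unfolding Q_def
      by (intro codef_ex codef_conj codef_mem[OF S(1)] codef_graph codef_eq[where l="k * d i + m"]
          proj_append proj_take_left proj_comp_drop proj_id proj_const)
        (use length_carrier[OF g] in auto)
    from definable_Collect[OF this]
    show "definable M (k * d i + m) {v @ (f v \<otimes> g) | v. v \<in> tpower (X i) k}"
    proof (rule back_subst[where P="definable M (k * d i + m)"])
      show "{xs \<in> tuples M (k * d i + m). \<exists>u\<in>tuples M (k * d i). \<exists>z\<in>tuples M m. \<exists>y\<in>tuples M m. Q xs u z y} =
        {v @ (f v \<otimes> g) | v. v \<in> tpower (X i) k}" (is "?L = ?R")
      proof (intro equalityI subsetI)
        fix xs assume "xs \<in> ?L"
        then obtain u z y where *: "u \<in> tuples M (k * d i)" "Q xs u z y" "y \<in> tuples M m" by blast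
        then have "z = f u \<otimes> g" "u \<in> tpower (X i) k"
          using S(2) graph_iff[of y g z] length_carrier[OF g] unfolding Q_def by (auto simp: tuples_def)
        then show "xs \<in> ?R" using *(2) unfolding Q_def by blast
      next
        fix xs assume "xs \<in> ?R"
        then obtain v where v: "v \<in> tpower (X i) k" "xs = v @ (f v \<otimes> g)" by blast
        then have c: "v \<in> tuples M (k * d i)" "f v \<in> carrier G"
          using tpower_tuples[OF X_tuples[OF i]] f(1) A(2) by blast+
        then have "f v \<otimes> g \<in> tuples M m" "f v \<in> tuples M m" using g carrier_tuples by auto
        moreover have "Q xs v (f v \<otimes> g) (f v)" unfolding Q_def using v c g S(2) by (auto simp: mult_graph_def)
        moreover have "xs \<in> tuples M (k * d i + m)" unfolding v(2) using c(1) calculation(1) by (rule tuples_append)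
        ultimately show "xs \<in> ?L" using c(1) by blast
      qed
    qed
  qed
qed

text \<open>These are the sets \<open>A\<^sub>i\<close> of the overview, before translations are
  absorbed.\<close>

definition axis :: "'a list \<Rightarrow> nat \<Rightarrow> 'a list set" where
  "axis e i = {g \<in> carrier G. \<forall>k<n. k \<noteq> i \<longrightarrow> part d k g = part d k e}"

text \<open>An element of the axis is determined by its coordinate in \<open>X i\<close>, so a map
  on the first power of \<open>X i\<close> already reaches all of it.\<close>

lemma internal_axis:
  assumes i: "i < n" and e: "e \<in> carrier G"
  shows "internal M m (axis e i) (d i) (X i)"
proof -
  define y where "y x = concat (map (\<lambda>k. if k = i then x else part d k e) [0..<n])" for x
  \<comment> \<open>Changing one coordinate of \<open>e\<close> may lead out of the group; the
    default \<open>e\<close> keeps the map total and inside the axis.\<close>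
  define f where "f x = (if y x \<in> carrier G then y x else e)" for x
  have len: "length (part d k e) = d k" if "k < n" for k
    using length_part[OF _ that, of e d] length_carrier[OF e] m by simp
  have part_y: "part d k (y x) = (if k = i then x else part d k e)" if "k < n" "length x = d i" for k x
    unfolding y_def using that len by (intro part_concat) auto
  have Xl: "length x = d i" if "x \<in> X i" for x using X_tuples[OF i] that by (auto simp: tuples_def)
  have proj_y: "proj (universe M) k m (\<lambda>xs. y (p xs))" if "proj (universe M) k (d i) p" for k p
    unfolding y_def m
  proof (rule proj_concat)
    fix j assume j: "j < n"
    have "set (part d j e) \<subseteq> universe M"
      using length_carrier(2)[OF e] unfolding part_def by (meson order_trans set_drop_subset set_take_subset)
    then show "proj (universe M) k (d j) (\<lambda>xs. if j = i then p xs else part d j e)"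
      using that len[OF j] by (cases "j = i") (auto intro: proj_const)
  qed
  define Q where "Q xs x z \<longleftrightarrow> xs = x @ z \<and> x \<in> X i \<and>
    ((y x \<in> carrier G \<and> z = y x) \<or> (y x \<notin> carrier G \<and> z = e))" for xs x z
  show ?thesis
  proof (rule internalI[where k="Suc 0" and f=f], unfold tpower_1)
    fix x assume "x \<in> X i"
    then show "f x \<in> axis e i" using e part_y Xl unfolding f_def axis_def by auto
  next
    fix g assume g: "g \<in> axis e i"
    then have gc: "g \<in> carrier G" by (simp add: axis_def)
    have "y (part d i g) = concat (map (\<lambda>k. part d k g) [0..<n])"
      unfolding y_def using g by (intro arg_cong[where f=concat] map_cong) (auto simp: axis_def)
    then have "y (part d i g) = g" using concat_parts[of g d n] length_carrier[OF gc] m by simp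
    then show "\<exists>x\<in>X i. f x = g" using part_carrier[OF gc i] gc by (intro bexI[of _ "part d i g"]) (auto simp: f_def)
  next
    have "codef M M (universe M) (d i + m)
      (\<lambda>xs. \<exists>x\<in>tuples M (d i). \<exists>z\<in>tuples M m. Q xs x z) (\<lambda>xs. \<exists>x\<in>tuples M (d i). \<exists>z\<in>tuples M m. Q xs x z)"
      unfolding Q_def
      by (intro codef_ex codef_conj codef_disj codef_not codef_carrier
          codef_mem[OF def_X[OF i] _ subset_refl subset_refl] codef_eq[where l="d i + m"] codef_eq[where l=m]
          proj_append proj_y proj_take_left proj_comp_drop proj_id proj_const length_carrier e)
    from definable_Collect[OF this]
    have "definable M (d i + m) {x @ f x | x. x \<in> X i}"
    proof (rule back_subst[where P="definable M (d i + m)"])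
      show "{xs \<in> tuples M (d i + m). \<exists>x\<in>tuples M (d i). \<exists>z\<in>tuples M m. Q xs x z} = {x @ f x | x. x \<in> X i}"
        (is "?L = ?R")
      proof (intro equalityI subsetI)
        fix xs assume "xs \<in> ?L"
        then show "xs \<in> ?R" unfolding Q_def f_def by force
      next
        fix xs assume "xs \<in> ?R"
        then obtain x where x: "x \<in> X i" "xs = x @ f x" by blast
        then have "x \<in> tuples M (d i)" "f x \<in> tuples M m"
          using X_tuples[OF i] e carrier_tuples unfolding f_def by auto
        moreover have "Q xs x (f x)" using x unfolding Q_def f_def by auto
        ultimately show "xs \<in> ?L" using tuples_append[of x M "d i" "f x" m] x(2) by blast
      qed
    qed
    then show "definable M (Suc 0 * d i + m) {x @ f x | x. x \<in> X i}" by simp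
  qed
qed

lemma internal_finite_union:
  assumes i: "i < n" and ab: "a \<in> X i" "b \<in> X i" "a \<noteq> b"
    and F: "finite F" "F \<noteq> {}" "F \<subseteq> carrier G" and A: "internal M m A (d i) (X i)" "A \<subseteq> carrier G"
  shows "internal M m (\<Union>f\<in>F. (\<lambda>x. x \<otimes> f) ` A) (d i) (X i)"
  using F
proof (induction F rule: finite_ne_induct)
  case (singleton f)
  then show ?case using internal_translate[OF i A] by simp
next
  case (insert f F)
  have "(\<lambda>x. x \<otimes> f) ` A \<subseteq> tuples M m" "(\<Union>f\<in>F. (\<lambda>x. x \<otimes> f) ` A) \<subseteq> tuples M m"
    using A(2) insert.prems carrier_tuples by blast+
  then have "internal M m ((\<lambda>x. x \<otimes> f) ` A \<union> (\<Union>f\<in>F. (\<lambda>x. x \<otimes> f) ` A)) (d i) (X i)"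
    using insert.prems insert.IH by (intro internal_Un[OF internal_translate[OF i A] _ _ _ X[OF i] ab]) auto
  then show ?case by simp
qed

lemma admits_decompositionI:
  assumes "\<And>i. i < n \<Longrightarrow> A i \<subseteq> carrier G \<and> internal M m (A i) (d i) (X i)"
    and "\<And>z. z \<in> carrier G \<Longrightarrow> \<exists>a. (\<forall>i<n. a i \<in> A i) \<and> z = finprod G a {..<n}"
  shows "admits_decomposition M n d X m G"
proof -
  have def: "definable M m (A i)" if "i < n" for i
    using internal_imp_definable[OF _ X_tuples[OF that]] assms(1)[OF that] carrier_tuples by blast
  moreover have "finprod G a {..<n} \<in> carrier G" if "\<forall>i<n. a i \<in> A i" for a
    using that assms(1) by (intro finprod_closed) blast
  ultimately have "carrier G = {finprod G a {..<n} | a. \<forall>i<n. a i \<in> A i}"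
    using assms(2) by blast
  then show ?thesis
    unfolding admits_decomposition_def using assms(1) def by (intro exI[of _ A] conjI allI impI) auto
qed

text \<open>Translates of one axis can be united by \<open>internal_Un\<close> when its sort has two
  elements. Otherwise every sort has at most one element, so the group, a subset of their product,
  is trivial.\<close>

lemma admits_decomposition_if_axes:
  assumes e: "\<And>i. i < n \<Longrightarrow> e i \<in> carrier G"
    and F: "finite F" "F \<subseteq> carrier G"
    and gen: "\<And>z. z \<in> carrier G \<Longrightarrow>
      \<exists>f\<in>F. \<exists>g. (\<forall>i<n. g i \<in> axis (e i) i) \<and> z = f \<otimes> finprod G g {..<n}"
  shows "admits_decomposition M n d X m G"
proof (cases "\<exists>i<n. \<exists>a\<in>X i. \<exists>b\<in>X i. a \<noteq> b")
  case True
  then obtain i a b where i: "i < n" "a \<in> X i" "b \<in> X i" "a \<noteq> b" by blast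
  define A where "A j = (if j = i then \<Union>f\<in>F. (\<lambda>x. x \<otimes> f) ` axis (e i) i else axis (e j) j)" for j
  have axis: "axis (e j) j \<subseteq> carrier G" for j by (auto simp: axis_def)
  have "F \<noteq> {}" using gen[OF one_closed] by blast
  show ?thesis
  proof (rule admits_decompositionI)
    fix j assume j: "j < n"
    show "A j \<subseteq> carrier G \<and> internal M m (A j) (d j) (X j)"
    proof (cases "j = i")
      case True
      have "(\<Union>f\<in>F. (\<lambda>x. x \<otimes> f) ` axis (e i) i) \<subseteq> carrier G" using axis[of i] F(2) by blast
      then show ?thesis
        using internal_finite_union[OF i F(1) \<open>F \<noteq> {}\<close> F(2) internal_axis[OF i(1) e[OF i(1)]] axis]
        unfolding A_def True by simp
    next
      case False
      then show ?thesis using internal_axis[OF j e[OF j]] axis unfolding A_def by simp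
    qed
  next
    fix z assume "z \<in> carrier G"
    then obtain f g where fg: "f \<in> F" "\<forall>i<n. g i \<in> axis (e i) i" "z = f \<otimes> finprod G g {..<n}"
      using gen by blast
    then have gc: "\<And>j. j < n \<Longrightarrow> g j \<in> carrier G" using axis by blast
    have fc: "f \<in> carrier G" using fg(1) F(2) by blast
    \<comment> \<open>The translation \<open>f\<close> goes into the \<open>i\<close>-th factor, the
      one whose set was enlarged.\<close>
    have "finprod G (g(i := f \<otimes> g i)) {..<n} = z"
      using finprod_update[OF comm_group_axioms gc i(1) fc] fg(3) by simp
    moreover have "f \<otimes> g i = g i \<otimes> f" using fc gc[OF i(1)] by (simp add: m_comm)
    then have "(g(i := f \<otimes> g i)) j \<in> A j" if "j < n" for j using fg(1,2) that i(1) unfolding A_def by auto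
    ultimately show "\<exists>a. (\<forall>i<n. a i \<in> A i) \<and> z = finprod G a {..<n}" by blast
  qed
next
  case False
  have triv: "x = \<one>" if x: "x \<in> carrier G" for x
  proof (rule part_eqI[where l=d and n=n])
    show "length x = (\<Sum>j<n. d j)" "length \<one> = (\<Sum>j<n. d j)" using length_carrier x m by auto
    show "part d i x = part d i \<one>" if "i < n" for i
      using False part_carrier[OF x that] part_carrier[OF one_closed that] that by blast
  qed
  show ?thesis
  proof (rule admits_decompositionI[where A="\<lambda>_. {\<one>}"])
    fix i assume i: "i < n"
    have "definable M m {\<one>}"
      using triv def_group one_closed by (auto simp: definable_group_def intro: back_subst[where P="definable M m"])
    \<comment> \<open>The zeroth power of \<open>X i\<close> is a single point, and the unit is its
      image.\<close>
    then have "internal M m {\<one>} (d i) (X i)" by (intro internalI[where k=0 and f="\<lambda>_. \<one>"]) auto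
    then show "{\<one>} \<subseteq> carrier G \<and> internal M m {\<one>} (d i) (X i)" by simp
  next
    fix z assume "z \<in> carrier G"
    then show "\<exists>a. (\<forall>i<n. a i \<in> {\<one>}) \<and> z = finprod G a {..<n}"
      using triv by (intro exI[of _ "\<lambda>_. \<one>"]) (simp add: finprod_one_eqI)
  qed
qed

end

section \<open>Boxes in the graph of multiplication\<close>

lemma concat_map_tuples:
  "(\<And>j. j < n \<Longrightarrow> x j \<in> tuples M (l j)) \<Longrightarrow> concat (map x [0..<n]) \<in> tuples M (\<Sum>j<n. l j)"
proof (induction n)
  case (Suc n)
  then have "concat (map x [0..<n]) @ x n \<in> tuples M ((\<Sum>j<n. l j) + l n)" by (intro tuples_append) auto
  then show ?case by simp
qed simp

lemma concat_map_tuples_const: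
  "(\<And>j. j < n \<Longrightarrow> x j \<in> tuples M l) \<Longrightarrow> concat (map x [0..<n]) \<in> tuples M (n * l)"
  using concat_map_tuples[of n x M "\<lambda>_. l"] by simp

context sorted_group
begin

text \<open>Orthogonality describes subsets of products of powers of the sorts, while a list of
  group elements is ordered by element. A row collects the coordinates in one sort of
  \<open>n + 1\<close> elements, the last column being meant for the product.\<close>

definition row :: "nat \<Rightarrow> (nat \<Rightarrow> 'a list) \<Rightarrow> 'a list" where
  "row i g = concat (map (\<lambda>j. part d i (g j)) [0..<Suc n])"

definition rows :: "(nat \<Rightarrow> 'a list) \<Rightarrow> 'a list" where
  "rows g = concat (map (\<lambda>i. row i g) [0..<n])"

definition with_prod :: "(nat \<Rightarrow> 'a list) \<Rightarrow> nat \<Rightarrow> 'a list" where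
  "with_prod g j = (if j < n then g j else finprod G g {..<n})"

lemma proj_rows:
  assumes "\<And>j. j < Suc n \<Longrightarrow> proj A k m (\<lambda>xs. p xs j)"
  shows "proj A k (\<Sum>i<n. Suc n * d i) (\<lambda>xs. rows (p xs))"
  unfolding rows_def row_def
  by (intro proj_concat proj_concat_const proj_part) (use assms m in auto)

lemma finprod_carrier: "(\<And>j. j < n \<Longrightarrow> g j \<in> carrier G) \<Longrightarrow> finprod G g {..<n} \<in> carrier G"
  by (intro finprod_closed) auto

lemma with_prod_carrier: "(\<And>j. j < n \<Longrightarrow> g j \<in> carrier G) \<Longrightarrow> with_prod g j \<in> carrier G"
  unfolding with_prod_def using finprod_carrier by simp

lemma length_row: "(\<And>j. j < Suc n \<Longrightarrow> length (g j) = m) \<Longrightarrow> i < n \<Longrightarrow> length (row i g) = Suc n * d i"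
proof -
  assume *: "\<And>j. j < Suc n \<Longrightarrow> length (g j) = m" "i < n"
  have "length (part d i (g j)) = d i" if "j < Suc n" for j using length_part *(1)[OF that] *(2) m by metis
  from length_concat_map[of "Suc n" "\<lambda>j. part d i (g j)" "\<lambda>_. d i", OF this] show ?thesis
    unfolding row_def by simp
qed

lemma part_row:
  assumes "\<And>j. j < Suc n \<Longrightarrow> length (g j) = m" "i < n" "j < Suc n"
  shows "block (d i) j (row i g) = part d i (g j)"
  unfolding row_def part_const[symmetric]
  by (rule part_concat) (use assms length_part[of _ d n i] m in auto)

text \<open>A predicate of one concatenated tuple, so that \<open>codef_subst\<close> can be applied
  to it.\<close>

definition is_prod :: "'a list \<Rightarrow> bool" where
  "is_prod xs \<longleftrightarrow> (\<forall>j<n. block m j (take (n * m) xs) \<in> carrier G) \<and>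
     drop (n * m) xs = finprod G (\<lambda>j. block m j (take (n * m) xs)) {..<n}"

text \<open>The witness \<open>S\<close> lists the partial products.\<close>

lemma codef_is_prod: "codef M M (universe M) (n * m + m) is_prod is_prod"
proof -
  define Q where "Q e s S \<longleftrightarrow> (\<forall>j<n. block m j e \<in> carrier G) \<and> block m 0 S = \<one> \<and>
    (\<forall>j<n. block m j S @ block m j e @ block m (Suc j) S \<in> mult_graph G) \<and> block m n S = s" for e s S
  have def_ex: "codef M M (universe M) (n * m + m)
    (\<lambda>xs. \<exists>S\<in>tuples M (Suc n * m). Q (take (n * m) xs) (drop (n * m) xs) S)
    (\<lambda>xs. \<exists>S\<in>tuples M (Suc n * m). Q (take (n * m) xs) (drop (n * m) xs) S)"
    unfolding Q_def
    by (intro codef_ex codef_conj codef_all_less codef_carrier codef_graph codef_eq[where l=m] proj_append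
        proj_block[where n=n] proj_block[where n="Suc n"] proj_comp_drop proj_take_left proj_id proj_const)
      (use length_carrier[OF one_closed] in auto)
  have "(\<exists>S\<in>tuples M (Suc n * m). Q e s S) \<longleftrightarrow>
      (\<forall>j<n. block m j e \<in> carrier G) \<and> s = finprod G (\<lambda>j. block m j e) {..<n}"
    if e: "e \<in> tuples M (n * m)" for e s
  proof
    assume "\<exists>S\<in>tuples M (Suc n * m). Q e s S"
    then obtain S where S: "S \<in> tuples M (Suc n * m)" "\<And>j. j < n \<Longrightarrow> block m j e \<in> carrier G"
      "block m 0 S = \<one>" "block m n S = s"
      "\<And>j. j < n \<Longrightarrow> block m j S @ block m j e @ block m (Suc j) S \<in> mult_graph G"
      unfolding Q_def by blast
    have "block m k S = finprod G (\<lambda>j. block m j e) {..<k}" if "k \<le> n" for k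
      using that
    proof (induction k)
      case 0
      then show ?case using S(3) by simp
    next
      case (Suc k)
      have "length (block m k S) = m" "length (block m k e) = m"
        using block_tuples[OF S(1), of k] block_tuples[OF e, of k] Suc.prems by (auto simp: tuples_def)
      then have "block m (Suc k) S = block m k S \<otimes> block m k e"
        using S(5)[of k] graph_iff Suc.prems by auto
      then show ?case
        using Suc finprod_lessThan_Suc[OF comm_group_axioms, of k "\<lambda>j. block m j e"] S(2) by auto
    qed
    then show "(\<forall>j<n. block m j e \<in> carrier G) \<and> s = finprod G (\<lambda>j. block m j e) {..<n}"
      using S(2,4) by auto
  next
    assume *: "(\<forall>j<n. block m j e \<in> carrier G) \<and> s = finprod G (\<lambda>j. block m j e) {..<n}"
    define P where "P k = finprod G (\<lambda>j. block m j e) {..<k}" for k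
    have P: "P k \<in> carrier G" if "k < Suc n" for k
      unfolding P_def using * that by (intro finprod_closed) auto
    let ?S = "concat (map P [0..<Suc n])"
    have b: "block m k ?S = P k" if "k < Suc n" for k
      unfolding part_const[symmetric] by (rule part_concat) (use P that length_carrier in auto)
    have "?S \<in> tuples M (Suc n * m)"
      by (intro concat_map_tuples_const carrier_tuples P)
    moreover have "Q e s ?S"
      unfolding Q_def
    proof (intro conjI allI impI)
      show "block m 0 ?S = \<one>" using b[of 0] by (simp add: P_def)
      show "block m n ?S = s" using b[of n] * by (simp add: P_def)
      fix j assume j: "j < n"
      then show "block m j e \<in> carrier G" using * by blast
      have "P (Suc j) = P j \<otimes> block m j e"
        unfolding P_def using finprod_lessThan_Suc[OF comm_group_axioms, of j "\<lambda>j. block m j e"] * j by auto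
      then show "block m j ?S @ block m j e @ block m (Suc j) ?S \<in> mult_graph G"
        using b[of j] b[of "Suc j"] P[of j] * j by (auto simp: mult_graph_def)
    qed
    ultimately show "\<exists>S\<in>tuples M (Suc n * m). Q e s S" by blast
  qed
  note iff = this
  have "take (n * m) xs \<in> tuples M (n * m)" if "xs \<in> tuples M (n * m + m)" for xs
    using that by (auto simp: tuples_def dest!: in_set_takeD)
  then show ?thesis by (intro codef_cong[OF def_ex]) (simp_all only: iff is_prod_def)
qed

text \<open>The graph of n-fold multiplication with its coordinates regrouped by sort, the set to
  which orthogonality is applied.\<close>

definition graph_rows :: "'a list set" where
  "graph_rows = {rows (with_prod g) | g. \<forall>j<n. g j \<in> carrier G}"

text \<open>With one such set for each box, these are the members of the cover handed to
  \<open>generic_slices\<close>.\<close>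

definition preimage_rows :: "'a list set \<Rightarrow> 'a list set" where
  "preimage_rows B = {xs \<in> tuples M (n * m). (\<forall>j<n. block m j xs \<in> carrier G) \<and>
     rows (with_prod (\<lambda>j. block m j xs)) \<in> B}"

lemma rows_tuples:
  assumes "\<And>j. j < Suc n \<Longrightarrow> g j \<in> carrier G"
  shows "rows g \<in> tuples M (\<Sum>i<n. Suc n * d i)" "rows g \<in> tprod n (\<lambda>i. tpower (X i) (Suc n))"
proof -
  have len: "length (g j) = m" if "j < Suc n" for j using assms[OF that] length_carrier by blast
  have rp: "row i g \<in> tpower (X i) (Suc n)" if "i < n" for i
    unfolding row_def tpower_def tprod_def using part_carrier[OF assms that] by blast
  then show "rows g \<in> tprod n (\<lambda>i. tpower (X i) (Suc n))" unfolding rows_def tprod_def by blast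
  have "row i g \<in> tuples M (Suc n * d i)" if "i < n" for i using rp[OF that] tpower_tuples[OF X_tuples[OF that]] by blast
  then show "rows g \<in> tuples M (\<Sum>i<n. Suc n * d i)"
    unfolding rows_def by (rule concat_map_tuples)
qed

lemma with_prod_cong: "(\<And>j. j < n \<Longrightarrow> g j = h j) \<Longrightarrow> (\<And>j. j < n \<Longrightarrow> h j \<in> carrier G) \<Longrightarrow> with_prod g = with_prod h"
  unfolding with_prod_def using finprod_cong'[of "{..<n}" "{..<n}" h g] by (auto simp: fun_eq_iff)

lemma rows_cong: "(\<And>j. j < Suc n \<Longrightarrow> g j = h j) \<Longrightarrow> rows g = rows h"
  unfolding rows_def row_def by (intro arg_cong[where f=concat] map_cong refl) (auto intro!: arg_cong[where f="part d _"])

text \<open>\<open>with_prod\<close> computes a product and is therefore no coordinate map. Here the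
  last column is an argument of its own, tied to the product by \<open>is_prod\<close> when formulas
  are built.\<close>

definition rows_of :: "'a list \<Rightarrow> 'a list \<Rightarrow> 'a list" where
  "rows_of e s = rows (\<lambda>j. if j < n then block m j e else s)"

lemma proj_rows_of:
  assumes "proj (universe M) k (n * m) p" "proj (universe M) k m q"
  shows "proj (universe M) k (\<Sum>i<n. Suc n * d i) (\<lambda>xs. rows_of (p xs) (q xs))"
  unfolding rows_of_def
proof (rule proj_rows)
  fix j
  show "proj (universe M) k m (\<lambda>xs. if j < n then block m j (p xs) else q xs)"
    using assms proj_block[of j n] by (cases "j < n") auto
qed

lemma definable_graph_rows: "definable M (\<Sum>i<n. Suc n * d i) graph_rows"
  and graph_rows_sub: "graph_rows \<subseteq> tprod n (\<lambda>i. tpower (X i) (Suc n))"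
proof -
  let ?L = "\<Sum>i<n. Suc n * d i"
  have "codef M M (universe M) ?L
    (\<lambda>xs. \<exists>e\<in>tuples M (n * m). \<exists>s\<in>tuples M m. is_prod (e @ s) \<and> xs = rows_of e s)
    (\<lambda>xs. \<exists>e\<in>tuples M (n * m). \<exists>s\<in>tuples M m. is_prod (e @ s) \<and> xs = rows_of e s)"
    by (intro codef_ex codef_conj codef_subst[OF codef_is_prod] codef_eq[where l="?L"] proj_rows_of proj_append
        proj_comp_drop proj_take_left proj_id subset_refl)
  from definable_Collect[OF this] show "definable M ?L graph_rows"
  proof (rule back_subst[where P="definable M ?L"])
    show "{xs \<in> tuples M ?L. \<exists>e\<in>tuples M (n * m). \<exists>s\<in>tuples M m. is_prod (e @ s) \<and> xs = rows_of e s} = graph_rows"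
      (is "?A = _")
    proof (intro equalityI subsetI)
      fix xs assume "xs \<in> ?A"
      then obtain e s where e: "e \<in> tuples M (n * m)" "is_prod (e @ s)" "xs = rows_of e s" by blast
      then have z: "\<forall>j<n. block m j e \<in> carrier G" "s = finprod G (\<lambda>j. block m j e) {..<n}"
        unfolding is_prod_def by (auto simp: tuples_def)
      have "xs = rows (with_prod (\<lambda>j. block m j e))"
        unfolding e(3) rows_of_def z(2) by (rule rows_cong) (simp add: with_prod_def)
      then show "xs \<in> graph_rows" unfolding graph_rows_def using z(1) by blast
    next
      fix xs assume "xs \<in> graph_rows"
      then obtain g where g: "xs = rows (with_prod g)" "\<And>j. j < n \<Longrightarrow> g j \<in> carrier G" unfolding graph_rows_def by blast
      let ?e = "concat (map g [0..<n])"
      have e: "?e \<in> tuples M (n * m)"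
        by (intro concat_map_tuples_const carrier_tuples g(2))
      have b: "block m j ?e = g j" if "j < n" for j
        unfolding part_const[symmetric] by (rule part_concat) (use g(2) that length_carrier in auto)
      let ?s = "finprod G g {..<n}"
      have s: "?s \<in> tuples M m" using finprod_carrier[of g] g(2) carrier_tuples by blast
      have "finprod G (\<lambda>j. block m j ?e) {..<n} = ?s" using b g(2) by (intro finprod_cong') auto
      then have "is_prod (?e @ ?s)" unfolding is_prod_def using e b g(2) by (auto simp: tuples_def)
      moreover have "xs = rows_of ?e ?s" unfolding g(1) rows_of_def by (rule rows_cong) (simp add: with_prod_def b)
      moreover have "xs \<in> tuples M ?L" unfolding g(1) using rows_tuples(1) with_prod_carrier g(2) by blast
      ultimately show "xs \<in> ?A" using e s by blast
    qed
  qed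
  show "graph_rows \<subseteq> tprod n (\<lambda>i. tpower (X i) (Suc n))"
    unfolding graph_rows_def using rows_tuples(2) with_prod_carrier by blast
qed

lemma definable_preimage_rows:
  assumes "definable M (\<Sum>i<n. Suc n * d i) B"
  shows "definable M (n * m) (preimage_rows B)"
proof -
  let ?L = "\<Sum>i<n. Suc n * d i"
  have B: "codef M M (universe M) ?L (\<lambda>xs. xs \<in> B) (\<lambda>xs. xs \<in> B)" using assms by (simp add: definable_iff_codef)
  have "codef M M (universe M) (n * m)
    (\<lambda>xs. \<exists>s\<in>tuples M m. is_prod (xs @ s) \<and> rows_of xs s \<in> B) (\<lambda>xs. \<exists>s\<in>tuples M m. is_prod (xs @ s) \<and> rows_of xs s \<in> B)"
    by (intro codef_ex codef_conj codef_subst[OF codef_is_prod] codef_mem[OF B] proj_rows_of proj_append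
        proj_comp_drop proj_take_left proj_id subset_refl)
  from definable_Collect[OF this] show ?thesis
  proof (rule back_subst[where P="definable M (n * m)"])
    show "{xs \<in> tuples M (n * m). \<exists>s\<in>tuples M m. is_prod (xs @ s) \<and> rows_of xs s \<in> B} = preimage_rows B"
      unfolding preimage_rows_def
    proof (intro Collect_cong conj_cong refl)
      fix e assume e: "e \<in> tuples M (n * m)"
      have Z_iff: "is_prod (e @ s) \<longleftrightarrow> (\<forall>j<n. block m j e \<in> carrier G) \<and> s = finprod G (\<lambda>j. block m j e) {..<n}" for s
        using e unfolding is_prod_def by (simp add: tuples_def)
      have R_eq: "rows_of e (finprod G (\<lambda>j. block m j e) {..<n}) = rows (with_prod (\<lambda>j. block m j e))"
        unfolding rows_of_def by (rule rows_cong) (simp add: with_prod_def)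
      show "(\<exists>s\<in>tuples M m. is_prod (e @ s) \<and> rows_of e s \<in> B) \<longleftrightarrow>
        (\<forall>j<n. block m j e \<in> carrier G) \<and> rows (with_prod (\<lambda>j. block m j e)) \<in> B"
        using finprod_carrier[of "\<lambda>j. block m j e"] carrier_tuples unfolding Z_iff R_eq[symmetric] by blast
    qed
  qed
qed

text \<open>
  For each \<open>i\<close> take the \<open>i\<close>-th rows of the point of \<open>B\<close> with \<open>e i\<close> replaced by \<open>h \<otimes> e i\<close>: as \<open>B\<close> is
  a box, these rows form a point of \<open>B\<close>, and its factors only move along their own axes.
\<close>

lemma mixing:
  assumes box: "is_box M n (\<lambda>i. Suc n * d i) (\<lambda>i. tpower (X i) (Suc n)) B" and sub: "B \<subseteq> graph_rows"
    and e: "\<And>j. j < n \<Longrightarrow> e j \<in> carrier G" and h: "h \<in> carrier G"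
    and B: "\<And>i. i < n \<Longrightarrow> rows (with_prod (e(i := h \<otimes> e i))) \<in> B"
  shows "\<exists>g. (\<forall>j<n. g j \<in> axis (e j) j) \<and> h \<otimes> finprod G e {..<n} = finprod G g {..<n}"
proof (cases "n = 0")
  case True
  \<comment> \<open>Without sorts every tuple is empty, so the group is trivial.\<close>
  then have "h = \<one>" using length_carrier[OF h] length_carrier[OF one_closed] m by simp
  then show ?thesis using True by simp
next
  case False
  let ?e = "\<lambda>i. e(i := h \<otimes> e i)"
  obtain U where U: "\<And>i. i < n \<Longrightarrow> U i \<subseteq> tpower (X i) (Suc n)" "B = tprod n U"
    using box unfolding is_box_def by blast
  have Ul: "U i \<subseteq> {u. length u = Suc n * d i}" if "i < n" for i
    using U(1)[OF that] tpower_tuples[OF X_tuples[OF that]] by (fastforce simp: tuples_def)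
  have ec: "?e i j \<in> carrier G" if "j < n" for i j using e h that by auto
  have wl: "length (with_prod (?e i) j) = m" for i j by (rule length_carrier(1)[OF with_prod_carrier[OF ec]])
  have row_rows: "part (\<lambda>i. Suc n * d i) i (rows g) = row i g" if "\<And>j. j < Suc n \<Longrightarrow> length (g j) = m" "i < n" for g i
    unfolding rows_def by (rule part_concat) (use length_row that in auto)
  \<comment> \<open>Row \<open>i\<close> is read off from the point with \<open>e i\<close> moved;
    that point lies in the box, so the row lies in side \<open>i\<close>.\<close>
  have "row i (with_prod (?e i)) \<in> U i" if "i < n" for i
    using tprod_iff[of n U "\<lambda>i. Suc n * d i", OF Ul] B[OF that] U(2) row_rows[OF wl that] that by auto
  then have "concat (map (\<lambda>i. row i (with_prod (?e i))) [0..<n]) \<in> B"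
    unfolding U(2) tprod_def by blast
  \<comment> \<open>As \<open>B\<close> lies in the graph, the mixed rows come from genuine group
    elements \<open>g\<close> and their product.\<close>
  then obtain g where g: "\<And>j. j < n \<Longrightarrow> g j \<in> carrier G"
    "concat (map (\<lambda>i. row i (with_prod (?e i))) [0..<n]) = rows (with_prod g)"
    using sub unfolding graph_rows_def by blast
  have gl: "length (with_prod g j) = m" for j by (rule length_carrier(1)[OF with_prod_carrier[OF g(1)]])
  have row_eq: "row i (with_prod (?e i)) = row i (with_prod g)" if "i < n" for i
    using row_rows[OF gl that] part_concat[of n "\<lambda>i. row i (with_prod (?e i))" "\<lambda>i. Suc n * d i" i]
      length_row[OF wl] that unfolding g(2) by simp
  have parts: "part d i (with_prod (?e i) j) = part d i (with_prod g j)" if "i < n" "j < Suc n" for i j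
    using arg_cong[OF row_eq[OF that(1)], of "block (d i) j"] part_row[OF wl that] part_row[OF gl that]
    by simp
  have "g j \<in> axis (e j) j" if "j < n" for j
  proof -
    \<comment> \<open>Row \<open>k\<close> was taken from the point with \<open>e k\<close> moved,
      so for \<open>k\<close> different from \<open>j\<close> its column \<open>j\<close> still
      shows \<open>e j\<close>.\<close>
    have "part d k (g j) = part d k (e j)" if "k < n" "k \<noteq> j" for k
      using parts[of k j] that \<open>j < n\<close> by (simp add: with_prod_def)
    then show ?thesis unfolding axis_def using g(1)[OF that] by blast
  qed
  \<comment> \<open>In the last column all rows come from the same element, because each single move
    multiplies the product by \<open>h\<close>.\<close>
  moreover have "h \<otimes> finprod G e {..<n} = finprod G g {..<n}"
  proof (rule part_eqI[where l=d and n=n])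
    show "length (h \<otimes> finprod G e {..<n}) = (\<Sum>i<n. d i)" "length (finprod G g {..<n}) = (\<Sum>i<n. d i)"
      using length_carrier finprod_carrier e g(1) h m by auto
    fix i assume i: "i < n"
    then show "part d i (h \<otimes> finprod G e {..<n}) = part d i (finprod G g {..<n})"
      using parts[of i n] finprod_update[OF comm_group_axioms _ i h, of e] e by (simp add: with_prod_def)
  qed
  ultimately show ?thesis by blast
qed

end

theorem theorem6p1:
  fixes M N :: "('f, 'r, 'a) fo_structure"
    and \<kappa> :: "'k rel"
    and n :: nat
    and d :: "nat \<Rightarrow> nat"
    and X :: "nat \<Rightarrow> 'a list set"
    and G :: "'a list monoid"
  assumes "is_structure M"
    and "NIP M"
    and "\<forall>i<n. definable M (d i) (X i)"
    and "orthogonal_sets M n d X"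
    and "comm_group G"
    and "definable_group M (\<Sum>i<n. d i) G"
    and "carrier G \<subseteq> tprod n X"
    and "sufficiently_saturated_extension \<kappa> M N"
    and "compactly_dominated \<kappa> M N (\<Sum>i<n. d i) G"
  shows "admits_decomposition M n d X (\<Sum>i<n. d i) G"
proof -
  define m where "m = (\<Sum>i<n. d i)"
  interpret sorted_group G M n d X m
    by (rule sorted_group.intro[OF assms(5)], rule sorted_group_axioms.intro)
      (use assms(3,6,7) in \<open>simp_all add: m_def\<close>)
  interpret ext: definable_extension M N G m
    by (rule definable_extension.intro)
      (use assms(6,8) in \<open>simp_all add: sufficiently_saturated_extension_def m_def\<close>)
  \<comment> \<open>All exponents equal \<open>n + 1\<close>: one column for each factor and one for
    the product.\<close>
  have "\<exists>\<B>. finite \<B> \<and> (\<forall>B\<in>\<B>. is_box M n (\<lambda>i. Suc n * d i) (\<lambda>i. tpower (X i) (Suc n)) B) \<and>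
      graph_rows = \<Union>\<B>"
    by (rule assms(4)[unfolded orthogonal_sets_def, THEN spec, THEN spec, THEN mp])
      (intro conjI definable_graph_rows graph_rows_sub)
  then obtain \<B> where "finite \<B> \<and> (\<forall>B\<in>\<B>. is_box M n (\<lambda>i. Suc n * d i) (\<lambda>i. tpower (X i) (Suc n)) B) \<and>
      graph_rows = \<Union>\<B>" ..
  then have \<B>: "finite \<B>" "\<And>B. B \<in> \<B> \<Longrightarrow> is_box M n (\<lambda>i. Suc n * d i) (\<lambda>i. tpower (X i) (Suc n)) B"
    "graph_rows = \<Union>\<B>" by simp_all
  have lists: "block m j (concat es) = es ! j" if "length es = n" "set es \<subseteq> carrier G" "j < n" for es j
    using block_concat[of es m j] that length_carrier by auto
  have cover: "\<exists>D\<in>preimage_rows ` \<B>. concat es \<in> D" if es: "length es = n" "set es \<subseteq> carrier G" for es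
  proof -
    have c: "es ! j \<in> carrier G" if "j < n" for j using that es nth_mem[of j es] by auto
    have "rows (with_prod (\<lambda>j. es ! j)) \<in> graph_rows" unfolding graph_rows_def using c by blast
    then obtain B where B: "B \<in> \<B>" "rows (with_prod (\<lambda>j. es ! j)) \<in> B" using \<B>(3) by blast
    have "with_prod (\<lambda>j. block m j (concat es)) = with_prod (\<lambda>j. es ! j)"
      using lists[OF es] c by (rule with_prod_cong)
    moreover have "concat (map (\<lambda>j. es ! j) [0..<n]) \<in> tuples M (n * m)"
      by (intro concat_map_tuples_const carrier_tuples c)
    then have "concat es \<in> tuples M (n * m)" using es(1) map_nth[of es] by simp
    ultimately have "concat es \<in> preimage_rows B"
      unfolding preimage_rows_def using B(2) lists[OF es] c by simp
    then show ?thesis using B(1) by blast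
  qed
  have "definable M (n * m) D" if "D \<in> preimage_rows ` \<B>" for D
    using that \<B>(2) definable_preimage_rows unfolding is_box_def by blast
  note slices = ext.generic_slices[OF assms(1,8) assms(9)[folded m_def] finite_imageI[OF \<B>(1)] this cover]
  obtain D es F where D: "D \<in> preimage_rows ` \<B>" and es: "length es = n" "set es \<subseteq> carrier G"
    and F: "finite F" "F \<subseteq> carrier G"
    and gen: "\<forall>z\<in>carrier G. \<exists>r\<in>F. \<exists>h\<in>carrier G. z = h \<otimes>\<^bsub>G\<^esub> r \<and>
      (\<forall>i<n. concat (es[i := h \<otimes>\<^bsub>G\<^esub> es ! i]) \<in> D)"
    by (rule bexE[OF slices], assumption+, elim exE conjE) (rule that)
  obtain B where B: "B \<in> \<B>" "D = preimage_rows B" using D by blast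
  have c: "es ! j \<in> carrier G" if "j < n" for j using that es nth_mem[of j es] by auto
  let ?p = "finprod G (\<lambda>j. es ! j) {..<n}"
  have p: "?p \<in> carrier G" using c by (intro finprod_carrier)
  have "admits_decomposition M n d X m G"
  \<comment> \<open>The cover gives elements \<open>h \<otimes> r\<close>, whereas the axes produce
    \<open>h \<otimes> ?p\<close>; the fixed product \<open>?p\<close> is divided out and merged
    with the translate \<open>r\<close>.\<close>
  proof (rule admits_decomposition_if_axes[where e="\<lambda>j. es ! j" and F="(\<lambda>r. inv\<^bsub>G\<^esub> ?p \<otimes>\<^bsub>G\<^esub> r) ` F"])
    show "finite ((\<lambda>r. inv\<^bsub>G\<^esub> ?p \<otimes>\<^bsub>G\<^esub> r) ` F)" "(\<lambda>r. inv\<^bsub>G\<^esub> ?p \<otimes>\<^bsub>G\<^esub> r) ` F \<subseteq> carrier G"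
      using F p by auto
    fix z assume "z \<in> carrier G"
    then obtain r h where r: "r \<in> F" "h \<in> carrier G" "z = h \<otimes>\<^bsub>G\<^esub> r"
      "\<And>i. i < n \<Longrightarrow> concat (es[i := h \<otimes>\<^bsub>G\<^esub> es ! i]) \<in> D" using gen by blast
    have "rows (with_prod ((\<lambda>j. es ! j)(i := h \<otimes>\<^bsub>G\<^esub> es ! i))) \<in> B" if i: "i < n" for i
    proof -
      let ?es = "es[i := h \<otimes>\<^bsub>G\<^esub> es ! i]"
      have *: "length ?es = n" "set ?es \<subseteq> carrier G"
        using es r(2) c[OF i] set_update_subset_insert[of es i "h \<otimes>\<^bsub>G\<^esub> es ! i"] by auto
      have "with_prod (\<lambda>j. block m j (concat ?es)) = with_prod ((\<lambda>j. es ! j)(i := h \<otimes>\<^bsub>G\<^esub> es ! i))"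
        by (rule with_prod_cong) (use lists[OF *] es(1) c r(2) in \<open>auto simp: nth_list_update\<close>)
      then show ?thesis using r(4)[OF i] unfolding B(2) preimage_rows_def by simp
    qed
    note moved = this
    have "B \<subseteq> graph_rows" using \<B>(3) B(1) by blast
    then have "\<exists>g. (\<forall>j<n. g j \<in> axis (es ! j) j) \<and> h \<otimes>\<^bsub>G\<^esub> ?p = finprod G g {..<n}"
      by (rule mixing[OF \<B>(2)[OF B(1)] _ _ r(2)]) (erule c, erule moved)
    then obtain g where g: "\<forall>j<n. g j \<in> axis (es ! j) j" "h \<otimes>\<^bsub>G\<^esub> ?p = finprod G g {..<n}"
      by blast
    have rc: "r \<in> carrier G" using r(1) F(2) by blast
    have "z = (inv\<^bsub>G\<^esub> ?p \<otimes>\<^bsub>G\<^esub> r) \<otimes>\<^bsub>G\<^esub> (h \<otimes>\<^bsub>G\<^esub> ?p)"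
      unfolding r(3) using p rc r(2) by (metis inv_closed inv_solve_left m_assoc m_closed m_comm)
    then show "\<exists>f\<in>(\<lambda>r. inv\<^bsub>G\<^esub> ?p \<otimes>\<^bsub>G\<^esub> r) ` F. \<exists>g. (\<forall>i<n. g i \<in> axis (es ! i) i) \<and>
        z = f \<otimes>\<^bsub>G\<^esub> finprod G g {..<n}"
      using g r(1) by auto
  qed (rule c)
  then show ?thesis by (simp only: m_def)
qed

end
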